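(* Fix $\lambda>0$ and $0<p<p_c(\lambda)=\frac{1}{\lambda+2}$, and put $\rho(p,\lambda)=\frac{p\lambda}{1-2p}$. Then the following hold. (a) For every $\varepsilon>0$ there is a finite $K=K(\varepsilon)$ such that $$\limsup_{n\to\infty}\mathbb P\left(\operatorname{rank}(\mathcal B_n(1))>K\right)<\varepsilon,$$ where $\operatorname{rank}(\mathcal B_n(1))$ is the position of the root blob in the ranking of the backbone blobs. (b) The normalized counts of retained recursive-tree blobs have a power-law tail. More precisely, if $N_{n,k}$ denotes the number of backbone blobs of size $k$, then for every fixed $k\ge1$, $$\frac{N_{n,k}}{n}\xrightarrow{\ \mathbb P\ } q_k:=\frac{1-p}{p}\,B\left(k,1+\frac1p\right),$$ where $B(\cdot,\cdot)$ is the Beta function. Thus, as $k\to\infty$, $$\sum_{\ell\ge k}q_\ell\sim(1-p)\,\Gamma\left(1+\frac1p\right)k^{-1/p}.$$ If $U_n$ is uniform on $[n]$, independent of the tree and the percolation, then $|\mathcal B_n(U_n)|$ converges in distribution to a random variable $W^\star$ with $\mathbb P(W^\star=k)=kq_k$, $k\ge1$, and, for $p<1/2$, $$\mathbb E W^\star=\sum_{k\ge1}k^2q_k=\frac1{1-2p}.$$ (c) For each fixed $K$, with probability tending to one as $n\to\infty$, the $K$ largest full percolation components are those containing the $K$ largest backbone blobs (with order determined by the tie rule in the context). Moreover, for every fixed $i$, $$\left||\mathcal C_{n,i}^{\mathrm{full}}|-\frac{W_{n,i}}{1-\rho(p,\lambda)}\right|=o_{\mathbb P}(n^p),$$ where $\mathcal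 C_{n,i}^{\mathrm{full}}$ is the full percolation component containing $\mathcal B_{n,i}$.
   Context: $T_n$ is the random recursive tree on $[n]=\{1,\dots,n\}$ rooted at $1$: for $m=2,\dots,n$, vertex $m$ attaches to a uniformly chosen vertex of $[m-1]$, independently. $H_n$ is an Erdős–Rényi graph on $[n]$, independent of $T_n$, with edge probability $\lambda/n$ (for $n\ge\lambda$); its edges are called shortcuts. $G_n=T_n\cup H_n$. Percolation: each edge of $G_n$ is retained independently with probability $p$. The backbone blobs $\mathcal B_{n,1},\mathcal B_{n,2},\dots$ are the connected components of the graph on $[n]$ formed by the retained edges of $T_n$ only, ranked in decreasing order of size, ties broken by increasing smallest label. $W_{n,i}=|\mathcal B_{n,i}|$, and $\mathcal B_n(v)$ is the blob containing vertex $v$; $\mathcal B_n(1)$ is the root blob. The full percolation components are the connected components of the graph on $[n]$ formed by all retained edges of $G_n$ (tree and shortcut edges); they are ranked in decreasing order of number of vertices, exact ties being resolved by a deterministic rule (increasing smallest label). $X_n=o_{\mathbb P}(a_n)$ means $X_n/a_n\to0$ in probability. *)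

theory Defs
  imports "HOL-Probability.Probability"
begin

section \<open>Finite graphs and ranked components\<close>

text \<open>
  A graph is a vertex set together with a set of edges; an edge is a two-element set of vertices.
\<close>

definition component_of :: "nat set \<Rightarrow> nat set set \<Rightarrow> nat \<Rightarrow> nat set" where
  "component_of V E v = {u \<in> V. (v, u) \<in> {(x, y). {x, y} \<in> E}\<^sup>*}"

definition graph_components :: "nat set \<Rightarrow> nat set set \<Rightarrow> nat set set" where
  "graph_components V E = component_of V E ` V"

definition ranked_before :: "nat set \<Rightarrow> nat set \<Rightarrow> bool" where
  "ranked_before C D \<longleftrightarrow> card C > card D \<or> (card C = card D \<and> Min C < Min D)"

text \<open>Ranks start at 1.\<close>

definition component_rank :: "nat set \<Rightarrow> nat set set \<Rightarrow> nat set \<Rightarrow> nat" where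
  "component_rank V E C = Suc (card {D \<in> graph_components V E. ranked_before D C})"

text \<open>The component of rank \<open>i\<close>, or the empty set if no component has rank \<open>i\<close>.\<close>

definition ranked_component :: "nat set \<Rightarrow> nat set set \<Rightarrow> nat \<Rightarrow> nat set" where
  "ranked_component V E i =
     (if \<exists>C \<in> graph_components V E. component_rank V E C = i
      then THE C. C \<in> graph_components V E \<and> component_rank V E C = i
      else {})"


section \<open>The random graphs\<close>

definition random_edge_subset :: "real \<Rightarrow> nat set set \<Rightarrow> nat set set pmf" where
  "random_edge_subset p E =
     map_pmf (\<lambda>f. {e \<in> E. f e}) (Pi_pmf E False (\<lambda>_. bernoulli_pmf p))"

text \<open>\<open>f m\<close> is the vertex to which \<open>m\<close> attaches.\<close>

definition recursive_tree :: "nat \<Rightarrow> nat set set pmf" where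
  "recursive_tree n =
     map_pmf (\<lambda>f. {{m, f m} |m. m \<in> {2..n}})
       (Pi_pmf {2..n} 0 (\<lambda>m. pmf_of_set {1..m - 1}))"

text \<open>
  \<^const>\<open>bernoulli_pmf\<close> truncates its parameter to the unit interval, so this is the
  graph with edge probability \<open>lam / n\<close> whenever \<open>n \<ge> lam\<close>.
\<close>

definition erdos_renyi :: "real \<Rightarrow> nat \<Rightarrow> nat set set pmf" where
  "erdos_renyi lam n = random_edge_subset (lam / real n) {e. e \<subseteq> {1..n} \<and> card e = 2}"

text \<open>
  A sample \<open>(T, H, R)\<close> consists of the edges of the recursive tree, the shortcuts, and
  the retained edges of the union. An edge that lies in both \<open>T\<close> and \<open>H\<close> is
  a single edge of the union and is retained or deleted once.
\<close>

type_synonym sample = "nat set set \<times> nat set set \<times> nat set set"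

definition percolation_model :: "real \<Rightarrow> real \<Rightarrow> nat \<Rightarrow> sample pmf" where
  "percolation_model lam p n =
     do {
       T \<leftarrow> recursive_tree n;
       H \<leftarrow> erdos_renyi lam n;
       R \<leftarrow> random_edge_subset p (T \<union> H);
       return_pmf (T, H, R)
     }"

definition retained_tree_edges :: "sample \<Rightarrow> nat set set" where
  "retained_tree_edges = (\<lambda>(T, H, R). R \<inter> T)"

definition retained_edges :: "sample \<Rightarrow> nat set set" where
  "retained_edges = (\<lambda>(T, H, R). R)"

definition blobs :: "nat \<Rightarrow> sample \<Rightarrow> nat set set" where
  "blobs n \<omega> = graph_components {1..n} (retained_tree_edges \<omega>)"

definition blob_of :: "nat \<Rightarrow> nat \<Rightarrow> sample \<Rightarrow> nat set" where
  "blob_of n v \<omega> = component_of {1..n} (retained_tree_edges \<omega>) v"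

definition blob_rank :: "nat \<Rightarrow> nat set \<Rightarrow> sample \<Rightarrow> nat" where
  "blob_rank n B \<omega> = component_rank {1..n} (retained_tree_edges \<omega>) B"

definition ranked_blob :: "nat \<Rightarrow> nat \<Rightarrow> sample \<Rightarrow> nat set" where
  "ranked_blob n i \<omega> = ranked_component {1..n} (retained_tree_edges \<omega>) i"

definition blob_count :: "nat \<Rightarrow> nat \<Rightarrow> sample \<Rightarrow> nat" where
  "blob_count n k \<omega> = card {B \<in> blobs n \<omega>. card B = k}"

definition full_components :: "nat \<Rightarrow> sample \<Rightarrow> nat set set" where
  "full_components n \<omega> = graph_components {1..n} (retained_edges \<omega>)"

definition ranked_full_component :: "nat \<Rightarrow> nat \<Rightarrow> sample \<Rightarrow> nat set" where
  "ranked_full_component n i \<omega> = ranked_component {1..n} (retained_edges \<omega>) i"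

text \<open>
  The full component containing the blob of rank \<open>i\<close>; it is only meaningful when there
  are at least \<open>i\<close> blobs.
\<close>

definition full_component_of_blob :: "nat \<Rightarrow> nat \<Rightarrow> sample \<Rightarrow> nat set" where
  "full_component_of_blob n i \<omega> =
     (THE C. C \<in> full_components n \<omega> \<and> ranked_blob n i \<omega> \<subseteq> C)"


section \<open>Convergence in probability\<close>

text \<open>The \<open>n\<close>-th variable lives on its own probability space.\<close>

definition tendsto_in_prob :: "(nat \<Rightarrow> 'a pmf) \<Rightarrow> (nat \<Rightarrow> 'a \<Rightarrow> real) \<Rightarrow> real \<Rightarrow> bool" where
  "tendsto_in_prob M X c \<longleftrightarrow>
     (\<forall>\<delta>>0. (\<lambda>n. measure_pmf.prob (M n) {\<omega>. \<bar>X n \<omega> - c\<bar> > \<delta>}) \<longlonglongrightarrow> 0)"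

definition small_o_prob :: "(nat \<Rightarrow> 'a pmf) \<Rightarrow> (nat \<Rightarrow> 'a \<Rightarrow> real) \<Rightarrow> (nat \<Rightarrow> real) \<Rightarrow> bool" where
  "small_o_prob M X a \<longleftrightarrow> tendsto_in_prob M (\<lambda>n \<omega>. X n \<omega> / a n) 0"


section \<open>Constants and limit laws\<close>

definition p_crit :: "real \<Rightarrow> real" where
  "p_crit lam = 1 / (lam + 2)"

definition rho :: "real \<Rightarrow> real \<Rightarrow> real" where
  "rho p lam = p * lam / (1 - 2 * p)"

definition q :: "real \<Rightarrow> nat \<Rightarrow> real" where
  "q p k = (1 - p) / p * Beta (real k) (1 + 1 / p)"

text \<open>The law of the size of the blob of an independent uniform vertex.\<close>

definition uniform_blob_size :: "real \<Rightarrow> real \<Rightarrow> nat \<Rightarrow> nat pmf" where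
  "uniform_blob_size lam p n =
     map_pmf (\<lambda>(\<omega>, u). card (blob_of n u \<omega>))
       (pair_pmf (percolation_model lam p n) (pmf_of_set {1..n}))"

definition conv_in_distr :: "(nat \<Rightarrow> nat pmf) \<Rightarrow> nat pmf \<Rightarrow> bool" where
  "conv_in_distr M W \<longleftrightarrow>
     weak_conv_m (\<lambda>n. distr (measure_pmf (M n)) borel real) (distr (measure_pmf W) borel real)"

end

theory Submission
  imports Defs
begin

text \<open>
  The blob sizes form a preferential attachment process: vertex \<open>m + 1\<close> joins a blob \<open>B\<close> with
  probability \<open>p |B| / m\<close> and founds a new one with probability \<open>1 - p\<close>. Hence rising factorial
  moments of the blob sizes satisfy closed linear recursions, which give tightness of the sizes at
  scale \<open>n\<^sup>p\<close> and show that blobs founded late are negligible at this scale; a negative moment of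
  order 1/2 shows that blobs founded early are not. The sizes of two blobs, given their sum, follow
  a Polya urn, so near ties at scale \<open>n\<^sup>p\<close> are unlikely.

  Given the blobs, the retained shortcuts are independent edges of density \<open>p * lam / n\<close>. Revealing
  them one potential edge at a time from a fixed union of blobs yields exponential moment bounds
  for the size of the explored component. The drift is governed by the susceptibility
  \<open>(\<Sum>B. |B|\<^sup>2) / n\<close>, which tends to \<open>1 / (1 - 2 * p)\<close>, and the third moment of the blob sizes is small
  enough to neglect fluctuations since \<open>p < 1/2\<close>. The bounds are sharp enough to show that each large
  blob grows by the factor \<open>1 / (1 - rho)\<close> and, by a union bound over all vertices, that components
  without large blobs stay small.
\<close>

section \<open>Components and their ranks\<close>

text \<open>No limit law for the rescaled blob sizes is needed: tightness at scale
  \<open>n powr p\<close>, a lower bound for early blobs and a gap between the leading ones suffice.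
  The factor \<open>1 / (1 - rho)\<close> comes from a linear balance: with \<open>s\<close> charged
  per initial and \<open>t\<close> per final vertex, the exploration bound needs
  \<open>t + s * rho\<close> to be about \<open>s\<close>, as an explored vertex leads to
  \<open>rho\<close> new ones on average. The exponent \<open>s\<close> is limited, since
  \<open>exp (s * |B|)\<close> must stay below a small power of \<open>n\<close> for every blob
  present. Blobs of order \<open>n powr p\<close> allow a small multiple of
  \<open>ln n / n powr p\<close>, hence only a small negative power of \<open>n\<close> as failure
  probability. This is enough for the large blobs, whose number is bounded. A union over all
  starting blobs needs \<open>o(1 / n)\<close>; it is obtained because explorations confined to
  blobs below \<open>\<delta> * n powr p\<close> tolerate a large multiple when \<delta> is small.
  Lower bounds use only blobs up to a fixed size, which carry most of the susceptibility. Their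
  obstacle is depletion: visited blobs and tree pairs are no longer available and must be paid for
  in the potential.\<close>

abbreviation edge_rel :: "nat set set \<Rightarrow> nat rel" where
  "edge_rel E \<equiv> {(x, y). {x, y} \<in> E}"

lemma sym_edge_rel_rtrancl: "sym ((edge_rel E)\<^sup>*)"
  by (intro sym_rtrancl) (auto simp: sym_def insert_commute)

lemma edge_rel_rtrancl_commute: "(x, y) \<in> (edge_rel E)\<^sup>* \<longleftrightarrow> (y, x) \<in> (edge_rel E)\<^sup>*"
  using sym_edge_rel_rtrancl[of E] unfolding sym_def by blast

lemma component_of_eq:
  assumes "u \<in> component_of V E v"
  shows "component_of V E u = component_of V E v"
proof -
  have "(v, u) \<in> (edge_rel E)\<^sup>*" "(u, v) \<in> (edge_rel E)\<^sup>*"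
    using assms edge_rel_rtrancl_commute[of v u E] by (auto simp: component_of_def)
  then show ?thesis
    unfolding component_of_def using rtrancl_trans[of v u "edge_rel E"] rtrancl_trans[of u v "edge_rel E"]
    by blast
qed

lemma component_of_self: "v \<in> V \<Longrightarrow> v \<in> component_of V E v"
  by (simp add: component_of_def)

lemma graph_components_eq_component:
  assumes "C \<in> graph_components V E" "v \<in> C"
  shows "component_of V E v = C"
  using assms component_of_eq by (auto simp: graph_components_def)

lemma component_in_graph_components: "v \<in> V \<Longrightarrow> component_of V E v \<in> graph_components V E"
  by (simp add: graph_components_def)

lemma partition_on_graph_components: "partition_on V (graph_components V E)"
proof (rule partition_onI)
  show "\<Union> (graph_components V E) = V"
    using component_of_self by (auto simp: graph_components_def component_of_def)
  show "{} \<notin> graph_components V E"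
    using component_of_self by (fastforce simp: graph_components_def)
  show "disjnt C D" if "C \<in> graph_components V E" "D \<in> graph_components V E" "C \<noteq> D" for C D
    using that graph_components_eq_component unfolding disjnt_def by blast
qed

text \<open>Allows components to be computed by guessing: a closed block cannot be left along an
  edge, a connected block cannot be split. Attaching a new vertex as a singleton or as a leaf is
  handled by this criterion.\<close>

lemma graph_components_eqI:
  assumes P: "partition_on V P"
    and closed: "\<And>x y B. B \<in> P \<Longrightarrow> x \<in> B \<Longrightarrow> {x, y} \<in> E \<Longrightarrow> y \<in> B"
    and conn: "\<And>x y B. B \<in> P \<Longrightarrow> x \<in> B \<Longrightarrow> y \<in> B \<Longrightarrow> (x, y) \<in> (edge_rel E)\<^sup>*"
  shows "graph_components V E = P"
proof -
  have eq: "component_of V E x = B" if "B \<in> P" "x \<in> B" for x B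
  proof
    have "y \<in> B" if "(x, y) \<in> (edge_rel E)\<^sup>*" for y
      using that \<open>x \<in> B\<close> by (induction rule: rtrancl_induct) (auto intro: closed[OF \<open>B \<in> P\<close>])
    then show "component_of V E x \<subseteq> B"
      by (auto simp: component_of_def)
    show "B \<subseteq> component_of V E x"
      using that conn partition_onD1[OF P] by (auto simp: component_of_def)
  qed
  show ?thesis
  proof
    show "graph_components V E \<subseteq> P"
      using eq partition_onD1[OF P] by (auto simp: graph_components_def)
    show "P \<subseteq> graph_components V E"
    proof
      fix B assume "B \<in> P"
      with partition_onD3[OF P] obtain x where "x \<in> B" by fastforce
      with \<open>B \<in> P\<close> eq have "B = component_of V E x" "x \<in> V"
        using partition_onD1[OF P] by auto
      then show "B \<in> graph_components V E"
        by (auto simp: graph_components_def)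
    qed
  qed
qed

lemma graph_components_closed:
  assumes "\<Union> E \<subseteq> V" "C \<in> graph_components V E" "x \<in> C" "{x, y} \<in> E"
  shows "y \<in> C"
proof -
  have "y \<in> V" using assms by auto
  moreover have "(x, y) \<in> (edge_rel E)\<^sup>*" using assms by (intro r_into_rtrancl) simp
  ultimately have "y \<in> component_of V E x" by (simp add: component_of_def)
  then show ?thesis using graph_components_eq_component[OF assms(2,3)] by simp
qed

lemma graph_components_connected:
  assumes "C \<in> graph_components V E" "x \<in> C" "y \<in> C"
  shows "(x, y) \<in> (edge_rel E)\<^sup>*"
  using graph_components_eq_component[OF assms(1,2)] assms(3)
  by (auto simp: component_of_def)

lemma edge_rel_rtrancl_mono: "E \<subseteq> E' \<Longrightarrow> (x, y) \<in> (edge_rel E)\<^sup>* \<Longrightarrow> (x, y) \<in> (edge_rel E')\<^sup>*"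
  by (rule subsetD[OF rtrancl_mono]) auto

definition extend_block :: "nat \<Rightarrow> nat set set \<Rightarrow> nat set \<Rightarrow> nat set set" where
  "extend_block v P B = insert (insert v B) (P - {B})"

lemma partition_on_insert_singleton:
  assumes "partition_on V P" "v \<notin> V"
  shows "partition_on (insert v V) (insert {v} P)"
proof -
  have "\<Union> P = V" using assms(1) by (simp add: partition_on_def)
  with assms(2) have "disjnt {v} (\<Union> P)" by (simp add: disjnt_def)
  with assms show ?thesis by (simp add: partition_on_insert)
qed

lemma partition_on_extend_block:
  assumes "partition_on V P" "v \<notin> V" "B \<in> P"
  shows "partition_on (insert v V) (extend_block v P B)"
proof -
  have *: "B \<inter> C = {}" if "C \<in> P" "C \<noteq> B" for C
    using assms that unfolding partition_on_def disjoint_def by auto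
  have **: "C \<inter> D = {}" if "C \<in> P" "D \<in> P" "C \<noteq> D" for C D
    using assms that unfolding partition_on_def disjoint_def by auto
  have ***: "v \<notin> C" "C \<noteq> {}" "C \<subseteq> V" if "C \<in> P" for C
    using assms that unfolding partition_on_def by auto
  have U: "\<Union> P = V" using assms unfolding partition_on_def by auto
  show ?thesis
  proof (rule partition_onI)
    show "\<Union> (extend_block v P B) = insert v V"
      using U assms(3) unfolding extend_block_def by auto
    show "{} \<notin> extend_block v P B"
      using *** unfolding extend_block_def by auto
    show "disjnt C D" if "C \<in> extend_block v P B" "D \<in> extend_block v P B" "C \<noteq> D" for C D
    proof -
      have a: "insert v B \<inter> C = {}" if "C \<in> P - {B}" for C
        using that *[of C] ***[of C] by auto
      from that show ?thesis
        unfolding extend_block_def disjnt_def using a[of C] a[of D] **[of C D] by blast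
    qed
  qed
qed

lemma graph_components_new_singleton:
  assumes "\<Union> E \<subseteq> V" "v \<notin> V"
  shows "graph_components (insert v V) E = insert {v} (graph_components V E)"
proof (rule graph_components_eqI)
  show "partition_on (insert v V) (insert {v} (graph_components V E))"
    using partition_on_graph_components assms(2) by (rule partition_on_insert_singleton)
  show "y \<in> B" if "B \<in> insert {v} (graph_components V E)" "x \<in> B" "{x, y} \<in> E" for x y B
    using that assms graph_components_closed[OF assms(1)] by auto
  show "(x, y) \<in> (edge_rel E)\<^sup>*"
    if "B \<in> insert {v} (graph_components V E)" "x \<in> B" "y \<in> B" for x y B
    using that graph_components_connected by auto
qed

lemma graph_components_new_leaf:
  assumes "\<Union> E \<subseteq> V" "v \<notin> V" "u \<in> V"
  shows "graph_components (insert v V) (insert {v, u} E) =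
    extend_block v (graph_components V E) (component_of V E u)"
proof (rule graph_components_eqI)
  let ?P = "graph_components V E" and ?B = "component_of V E u"
  have B: "?B \<in> ?P" "u \<in> ?B"
    using assms(3) by (simp_all add: component_in_graph_components component_of_self)
  show "partition_on (insert v V) (extend_block v ?P ?B)"
    using partition_on_graph_components assms(2) B(1) by (rule partition_on_extend_block)
  have sub: "C \<subseteq> V" if "C \<in> ?P" for C
    using that by (auto simp: graph_components_def component_of_def)
  show "y \<in> C" if C: "C \<in> extend_block v ?P ?B" "x \<in> C" "{x, y} \<in> insert {v, u} E" for x y C
  proof (cases "C = insert v ?B")
    case True
    then show ?thesis
      using that(2,3) B graph_components_closed[OF assms(1) B(1), of x y] assms(1,2)
      by (auto simp: doubleton_eq_iff)
  next
    case False
    then have "C \<in> ?P" "C \<noteq> ?B" using C(1) by (auto simp: extend_block_def)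
    moreover from this have "u \<notin> C" using graph_components_eq_component by blast
    ultimately show ?thesis
      using that(2,3) graph_components_closed[OF assms(1) \<open>C \<in> ?P\<close>, of x y] sub[OF \<open>C \<in> ?P\<close>] assms(2)
      by (auto simp: doubleton_eq_iff)
  qed
  have mono: "(x, y) \<in> (edge_rel (insert {v, u} E))\<^sup>*" if "C \<in> ?P" "x \<in> C" "y \<in> C" for x y C
    using graph_components_connected[OF that] edge_rel_rtrancl_mono[of E "insert {v, u} E"] by blast
  show "(x, y) \<in> (edge_rel (insert {v, u} E))\<^sup>*"
    if C: "C \<in> extend_block v ?P ?B" "x \<in> C" "y \<in> C" for x y C
  proof (cases "C = insert v ?B")
    case True
    have vu: "(v, u) \<in> (edge_rel (insert {v, u} E))\<^sup>*"
      by (intro r_into_rtrancl) simp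
    have "(z, u) \<in> (edge_rel (insert {v, u} E))\<^sup>*" if "z \<in> C" for z
      using that True vu mono[OF B(1) _ B(2), of z] by auto
    from this[OF C(2)] this[OF C(3)] show ?thesis
      unfolding edge_rel_rtrancl_commute[of y u] by (rule rtrancl_trans)
  next
    case False
    then show ?thesis using C mono by (auto simp: extend_block_def)
  qed
qed

section \<open>Ranks of components\<close>

lemma ranked_before_trans: "ranked_before A B \<Longrightarrow> ranked_before B C \<Longrightarrow> ranked_before A C"
  by (auto simp: ranked_before_def)

lemma ranked_before_irrefl: "\<not> ranked_before A A"
  by (auto simp: ranked_before_def)

lemma finite_graph_components: "finite V \<Longrightarrow> finite (graph_components V E)"
  by (simp add: graph_components_def)

lemma graph_component_finite: "finite V \<Longrightarrow> C \<in> graph_components V E \<Longrightarrow> finite C"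
  by (auto simp: graph_components_def component_of_def)

lemma graph_component_nonempty: "C \<in> graph_components V E \<Longrightarrow> C \<noteq> {}"
  using partition_on_graph_components[of V E] by (auto simp: partition_on_def)

lemma graph_component_subset: "C \<in> graph_components V E \<Longrightarrow> C \<subseteq> V"
  by (auto simp: graph_components_def component_of_def)

text \<open>Distinct components are disjoint, so their minima differ and the tie rule always
  decides. With transitivity this makes the ranks a bijection onto an initial segment of the
  positive integers.\<close>

lemma ranked_before_total:
  assumes "finite V" "C \<in> graph_components V E" "D \<in> graph_components V E" "C \<noteq> D"
  shows "ranked_before C D \<or> ranked_before D C"
proof -
  have "Min C \<in> C" "Min D \<in> D"
    using assms graph_component_finite graph_component_nonempty Min_in by metis+
  then have "Min C \<noteq> Min D"
    using assms graph_components_eq_component by metis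
  then show ?thesis by (auto simp: ranked_before_def)
qed

lemma component_rank_less:
  assumes "finite V" "C \<in> graph_components V E" "ranked_before C D"
  shows "component_rank V E C < component_rank V E D"
proof -
  have "{A \<in> graph_components V E. ranked_before A C} \<subset> {A \<in> graph_components V E. ranked_before A D}"
    using assms ranked_before_trans ranked_before_irrefl by blast
  then show ?thesis
    unfolding component_rank_def using finite_graph_components[OF assms(1)]
    by (simp add: psubset_card_mono)
qed

lemma component_rank_le_card:
  assumes "finite V" "C \<in> graph_components V E"
  shows "component_rank V E C \<le> card (graph_components V E)"
proof -
  have "{A \<in> graph_components V E. ranked_before A C} \<subset> graph_components V E"
    using assms ranked_before_irrefl by blast
  then have "card {A \<in> graph_components V E. ranked_before A C} < card (graph_components V E)"
    using finite_graph_components[OF assms(1)] by (rule psubset_card_mono[rotated])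
  then show ?thesis by (simp add: component_rank_def)
qed

lemma inj_on_component_rank:
  assumes "finite V"
  shows "inj_on (component_rank V E) (graph_components V E)"
proof (rule inj_onI, rule ccontr)
  fix C D assume *: "C \<in> graph_components V E" "D \<in> graph_components V E"
    "component_rank V E C = component_rank V E D" "C \<noteq> D"
  then show False
    using ranked_before_total[OF assms *(1,2,4)] component_rank_less[OF assms] by fastforce
qed

lemma component_rank_image:
  assumes "finite V"
  shows "component_rank V E ` graph_components V E = {1..card (graph_components V E)}"
proof (rule card_subset_eq)
  show "component_rank V E ` graph_components V E \<subseteq> {1..card (graph_components V E)}"
    using component_rank_le_card[OF assms] by (auto simp: component_rank_def)
  show "card (component_rank V E ` graph_components V E) = card {1..card (graph_components V E)}"
    using card_image[OF inj_on_component_rank[OF assms]] by simp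
qed simp

lemma ranked_component_rank:
  assumes "finite V" "C \<in> graph_components V E"
  shows "ranked_component V E (component_rank V E C) = C"
proof -
  have "(THE D. D \<in> graph_components V E \<and> component_rank V E D = component_rank V E C) = C"
    using assms inj_on_component_rank[OF assms(1)] by (intro the_equality) (auto dest: inj_onD)
  then show ?thesis using assms(2) by (auto simp: ranked_component_def)
qed

lemma ranked_component_props:
  assumes "finite V" "1 \<le> i" "i \<le> card (graph_components V E)"
  shows "ranked_component V E i \<in> graph_components V E"
    and "component_rank V E (ranked_component V E i) = i"
proof -
  have "i \<in> component_rank V E ` graph_components V E"
    using component_rank_image[OF assms(1), of E] assms(2,3) by simp
  then obtain C where "C \<in> graph_components V E" "component_rank V E C = i"
    by (rule imageE) simp
  then show "ranked_component V E i \<in> graph_components V E"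
    and "component_rank V E (ranked_component V E i) = i"
    using ranked_component_rank[OF assms(1)] by auto
qed

lemma ranked_before_if_rank_less:
  assumes "finite V" "C \<in> graph_components V E" "D \<in> graph_components V E"
    and "component_rank V E C < component_rank V E D"
  shows "ranked_before C D"
  using assms ranked_before_total[OF assms(1-3)] component_rank_less[OF assms(1,3), of C] by fastforce

section \<open>The law of the percolated tree\<close>

lemma expectation_bind_finite:
  fixes h :: "'b \<Rightarrow> real"
  assumes "finite (set_pmf M)" "\<And>x. x \<in> set_pmf M \<Longrightarrow> finite (set_pmf (f x))"
  shows "measure_pmf.expectation (bind_pmf M f) h =
    measure_pmf.expectation M (\<lambda>x. measure_pmf.expectation (f x) h)"
  by (subst pmf_expectation_bind[OF assms(1)])
     (use assms in \<open>auto simp: integral_measure_pmf_real[OF assms(1)] mult.commute\<close>)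

lemma expectation_mono_finite:
  fixes f g :: "'a \<Rightarrow> real"
  assumes "finite (set_pmf M)" "\<And>x. x \<in> set_pmf M \<Longrightarrow> f x \<le> g x"
  shows "measure_pmf.expectation M f \<le> measure_pmf.expectation M g"
  using assms
  by (intro integral_mono_AE integrable_measure_pmf_finite) (auto simp: AE_measure_pmf_iff)

lemma expectation_cong_pmf:
  fixes f g :: "'a \<Rightarrow> real"
  assumes "\<And>x. x \<in> set_pmf M \<Longrightarrow> f x = g x"
  shows "measure_pmf.expectation M f = measure_pmf.expectation M g"
  using assms by (intro integral_cong_AE) (auto simp: AE_measure_pmf_iff)

lemma prob_le_expectation_finite:
  fixes f :: "'a \<Rightarrow> real"
  assumes "finite (set_pmf M)" "\<And>x. x \<in> set_pmf M \<Longrightarrow> 0 \<le> f x"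
    "\<And>x. x \<in> set_pmf M \<Longrightarrow> x \<in> A \<Longrightarrow> c \<le> f x" "c > 0"
  shows "measure_pmf.prob M A \<le> measure_pmf.expectation M f / c"
proof -
  have "measure_pmf.prob M A = measure_pmf.expectation M (indicator A)" by simp
  also have "\<dots> \<le> measure_pmf.expectation M (\<lambda>x. f x / c)"
    using assms by (intro expectation_mono_finite) (auto simp: indicator_def)
  finally show ?thesis by simp
qed

lemma random_edge_subset_empty: "random_edge_subset r {} = return_pmf {}"
  by (simp add: random_edge_subset_def)

lemma random_edge_subset_insert:
  assumes "finite A" "e \<notin> A"
  shows "random_edge_subset r (insert e A) =
    do {b \<leftarrow> bernoulli_pmf r; S \<leftarrow> random_edge_subset r A; return_pmf (if b then insert e S else S)}"
proof -
  have *: "{x. (x = e \<or> x \<in> A) \<and> (f(e := b)) x} = (if b then insert e {x \<in> A. f x} else {x \<in> A. f x})" for f b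
    using assms(2) by auto
  show ?thesis
    unfolding random_edge_subset_def Pi_pmf_insert'[OF assms]
    by (simp add: map_bind_pmf bind_map_pmf * del: fun_upd_apply)
qed

lemma set_random_edge_subset: "S \<in> set_pmf (random_edge_subset r A) \<Longrightarrow> S \<subseteq> A"
  by (auto simp: random_edge_subset_def)

lemma finite_random_edge_subset: "finite A \<Longrightarrow> finite (set_pmf (random_edge_subset r A))"
  by (rule finite_subset[of _ "Pow A"]) (use set_random_edge_subset in auto)

lemma bernoulli_pmf_conj:
  assumes "0 \<le> r" "r \<le> 1" "0 \<le> s" "s \<le> 1"
  shows "do {a \<leftarrow> bernoulli_pmf r; b \<leftarrow> bernoulli_pmf s; return_pmf (a \<and> b)} = bernoulli_pmf (r * s)"
proof -
  have "r * s \<le> 1" using assms by (simp add: mult_le_one)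
  then have "pmf (do {a \<leftarrow> bernoulli_pmf r; b \<leftarrow> bernoulli_pmf s; return_pmf (a \<and> b)}) x = pmf (bernoulli_pmf (r * s)) x" for x
    using assms by (cases x) (simp_all add: pmf_bind measure_pmf_single algebra_simps)
  then show ?thesis by (rule pmf_eqI)
qed

text \<open>A pair outside the tree survives if it is a shortcut and is retained, with probability
  \<open>r * s\<close>; a tree edge is retained with probability \<open>r\<close> whether or not it
  is also a shortcut. So edges lying in both graphs drop out of the analysis, and the surviving
  shortcuts outside the tree are independent of the tree percolation.\<close>

lemma random_edge_subset_thinning:
  assumes "finite T" "finite D" "T \<inter> D = {}" "0 \<le> r" "r \<le> 1" "0 \<le> s" "s \<le> 1"
  shows "do {H \<leftarrow> random_edge_subset s (T \<union> D); random_edge_subset r (T \<union> H)} =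
    do {F \<leftarrow> random_edge_subset r T; S \<leftarrow> random_edge_subset (r * s) D; return_pmf (F \<union> S)}"
  using assms(2,3)
proof (induction D rule: finite_induct)
  case empty
  have "do {H \<leftarrow> random_edge_subset s T; random_edge_subset r (T \<union> H)} =
     do {H \<leftarrow> random_edge_subset s T; random_edge_subset r T}"
    by (intro bind_pmf_cong refl) (use set_random_edge_subset in \<open>auto simp: Un_absorb2\<close>)
  then show ?case
    by (simp add: random_edge_subset_empty bind_return_pmf bind_return_pmf')
next
  case (insert e D)
  have fin: "finite (T \<union> D)" and e: "e \<notin> T \<union> D"
    using insert assms(1) by auto
  have "do {H \<leftarrow> random_edge_subset s (T \<union> insert e D); random_edge_subset r (T \<union> H)} =
    do {b \<leftarrow> bernoulli_pmf s; H \<leftarrow> random_edge_subset s (T \<union> D);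
        random_edge_subset r (if b then insert e (T \<union> H) else T \<union> H)}"
    unfolding Un_insert_right random_edge_subset_insert[OF fin e]
    by (auto simp: bind_assoc_pmf bind_return_pmf intro!: bind_pmf_cong)
  also have "\<dots> = do {b \<leftarrow> bernoulli_pmf s; H \<leftarrow> random_edge_subset s (T \<union> D);
       a \<leftarrow> bernoulli_pmf r; R \<leftarrow> random_edge_subset r (T \<union> H);
       return_pmf (if a \<and> b then insert e R else R)}"
  proof (intro bind_pmf_cong refl)
    fix b H assume "H \<in> set_pmf (random_edge_subset s (T \<union> D))"
    then have H: "H \<subseteq> T \<union> D" by (rule set_random_edge_subset)
    then have "finite (T \<union> H)" "e \<notin> T \<union> H" using fin e by (auto intro: finite_subset)
    from random_edge_subset_insert[OF this]
    show "random_edge_subset r (if b then insert e (T \<union> H) else T \<union> H) =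
      do {a \<leftarrow> bernoulli_pmf r; R \<leftarrow> random_edge_subset r (T \<union> H);
       return_pmf (if a \<and> b then insert e R else R)}"
      by (cases b) (simp_all add: bind_return_pmf')
  qed
  also have "\<dots> = do {a \<leftarrow> bernoulli_pmf r; b \<leftarrow> bernoulli_pmf s; c \<leftarrow> return_pmf (a \<and> b);
       R \<leftarrow> do {H \<leftarrow> random_edge_subset s (T \<union> D); random_edge_subset r (T \<union> H)};
       return_pmf (if c then insert e R else R)}"
    by (simp add: bind_assoc_pmf bind_return_pmf)
       (subst bind_commute_pmf[of "bernoulli_pmf r"], subst bind_commute_pmf[of "bernoulli_pmf r"], rule refl)
  also have "\<dots> = do {c \<leftarrow> bernoulli_pmf (r * s);
       R \<leftarrow> do {H \<leftarrow> random_edge_subset s (T \<union> D); random_edge_subset r (T \<union> H)};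
       return_pmf (if c then insert e R else R)}"
    by (simp add: bernoulli_pmf_conj[OF assms(4-7), symmetric] bind_assoc_pmf)
  also have "\<dots> = do {c \<leftarrow> bernoulli_pmf (r * s); F \<leftarrow> random_edge_subset r T;
       S \<leftarrow> random_edge_subset (r * s) D; return_pmf (if c then insert e (F \<union> S) else F \<union> S)}"
    using insert by (simp add: bind_assoc_pmf bind_return_pmf)
  also have "\<dots> = do {F \<leftarrow> random_edge_subset r T; c \<leftarrow> bernoulli_pmf (r * s);
       S \<leftarrow> random_edge_subset (r * s) D; return_pmf (if c then insert e (F \<union> S) else F \<union> S)}"
    by (rule bind_commute_pmf)
  also have "\<dots> = do {F \<leftarrow> random_edge_subset r T; S \<leftarrow> random_edge_subset (r * s) (insert e D); return_pmf (F \<union> S)}"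
    unfolding random_edge_subset_insert[OF insert(1,2)]
    by (auto simp: bind_assoc_pmf bind_return_pmf intro!: bind_pmf_cong)
  finally show ?case .
qed

abbreviation vertex_pairs :: "nat \<Rightarrow> nat set set" where
  "vertex_pairs n \<equiv> {e. e \<subseteq> {1..n} \<and> card e = 2}"

lemma finite_vertex_pairs: "finite (vertex_pairs n)"
  by (rule finite_subset[of _ "Pow {1..n}"]) auto

section \<open>The recursive tree and its percolation\<close>

lemma recursive_tree_support:
  assumes "T \<in> set_pmf (recursive_tree n)"
  shows "T \<subseteq> vertex_pairs n" "finite T" "card T \<le> n"
proof -
  from assms obtain f where f: "f \<in> set_pmf (Pi_pmf {2..n} 0 (\<lambda>m. pmf_of_set {1..m - 1}))"
    and T: "T = {{m, f m} |m. m \<in> {2..n}}"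
    by (auto simp: recursive_tree_def)
  have "f m \<in> {1..m - 1}" if "m \<in> {2..n}" for m
  proof -
    have "f m \<in> set_pmf (pmf_of_set {1..m - 1})"
      using f that by (auto simp: set_Pi_pmf PiE_dflt_def)
    then show ?thesis using that by (subst (asm) set_pmf_of_set) auto
  qed
  then have "{m, f m} \<subseteq> {1..n} \<and> card {m, f m} = 2" if "m \<in> {2..n}" for m
    using that by (fastforce simp: card_2_iff)
  then show "T \<subseteq> vertex_pairs n" unfolding T by blast
  have eq: "T = (\<lambda>m. {m, f m}) ` {2..n}" unfolding T by blast
  show "finite T" unfolding eq by simp
  have "card T \<le> card {2..n}" unfolding eq by (rule card_image_le) simp
  then show "card T \<le> n" by simp
qed

lemma finite_recursive_tree: "finite (set_pmf (recursive_tree n))"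
  by (rule finite_subset[of _ "Pow (vertex_pairs n)"])
     (use recursive_tree_support finite_vertex_pairs in auto)

lemma recursive_tree_Suc:
  assumes "m \<ge> 1"
  shows "recursive_tree (Suc m) =
    do {T \<leftarrow> recursive_tree m; u \<leftarrow> pmf_of_set {1..m}; return_pmf (insert {Suc m, u} T)}"
proof -
  have *: "{2..Suc m} = insert (Suc m) {2..m}" using assms by auto
  have img: "{{k, g k} |k. k \<in> A} = (\<lambda>k. {k, g k}) ` A" for g :: "nat \<Rightarrow> nat" and A
    by blast
  have **: "(\<lambda>k. {k, (f(Suc m := u)) k}) ` insert (Suc m) {2..m} =
     insert {Suc m, u} ((\<lambda>k. {k, f k}) ` {2..m})" for f u
    by (subst image_insert) (auto intro!: arg_cong2[of _ _ _ _ insert] image_cong)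
  show ?thesis
    unfolding recursive_tree_def img * by (subst Pi_pmf_insert')
      (simp_all add: map_bind_pmf bind_map_pmf ** del: fun_upd_apply image_insert, rule bind_commute_pmf)
qed

definition perc_tree :: "real \<Rightarrow> nat \<Rightarrow> (nat set set \<times> nat set set) pmf" where
  "perc_tree p n = do {T \<leftarrow> recursive_tree n; F \<leftarrow> random_edge_subset p T; return_pmf (T, F)}"

lemma perc_tree_support:
  assumes "(T, F) \<in> set_pmf (perc_tree p n)"
  shows "T \<subseteq> vertex_pairs n" "finite T" "card T \<le> n" "F \<subseteq> T"
proof -
  have "T \<in> set_pmf (recursive_tree n)" "F \<in> set_pmf (random_edge_subset p T)"
    using assms by (auto simp: perc_tree_def)
  then show "T \<subseteq> vertex_pairs n" "finite T" "card T \<le> n" "F \<subseteq> T"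
    by (blast dest: recursive_tree_support set_random_edge_subset)+
qed

lemma finite_perc_tree: "finite (set_pmf (perc_tree p n))"
  unfolding perc_tree_def
  using finite_recursive_tree[of n] finite_random_edge_subset recursive_tree_support(2) by auto

lemma percolation_model_decomposition:
  assumes "0 \<le> p" "p \<le> 1" "0 \<le> lam" "lam \<le> real n" "n \<ge> 1"
  shows "map_pmf (\<lambda>(T, H, R). (T, R)) (percolation_model lam p n) =
    do {(T, F) \<leftarrow> perc_tree p n; S \<leftarrow> random_edge_subset (p * (lam / real n)) (vertex_pairs n - T);
        return_pmf (T, F \<union> S)}"
proof -
  have "map_pmf (\<lambda>(T, H, R). (T, R)) (percolation_model lam p n) =
    do {T \<leftarrow> recursive_tree n;
        R \<leftarrow> do {H \<leftarrow> random_edge_subset (lam / real n) (vertex_pairs n); random_edge_subset p (T \<union> H)};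
        return_pmf (T, R)}"
    by (simp add: percolation_model_def erdos_renyi_def map_bind_pmf bind_assoc_pmf)
  also have "\<dots> = do {T \<leftarrow> recursive_tree n;
        R \<leftarrow> do {F \<leftarrow> random_edge_subset p T;
          S \<leftarrow> random_edge_subset (p * (lam / real n)) (vertex_pairs n - T); return_pmf (F \<union> S)};
        return_pmf (T, R)}"
  proof (rule bind_pmf_cong[OF refl])
    fix T assume "T \<in> set_pmf (recursive_tree n)"
    from recursive_tree_support[OF this]
    have T: "vertex_pairs n = T \<union> (vertex_pairs n - T)" "finite T" by auto
    have "do {H \<leftarrow> random_edge_subset (lam / real n) (T \<union> (vertex_pairs n - T)); random_edge_subset p (T \<union> H)} =
      do {F \<leftarrow> random_edge_subset p T;
          S \<leftarrow> random_edge_subset (p * (lam / real n)) (vertex_pairs n - T); return_pmf (F \<union> S)}"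
      using assms T(2) finite_vertex_pairs by (intro random_edge_subset_thinning) auto
    then show "do {R \<leftarrow> do {H \<leftarrow> random_edge_subset (lam / real n) (vertex_pairs n); random_edge_subset p (T \<union> H)};
        return_pmf (T, R)} = do {R \<leftarrow> do {F \<leftarrow> random_edge_subset p T;
          S \<leftarrow> random_edge_subset (p * (lam / real n)) (vertex_pairs n - T); return_pmf (F \<union> S)};
        return_pmf (T, R)}"
      unfolding T(1)[symmetric] by (rule arg_cong)
  qed
  also have "\<dots> = do {(T, F) \<leftarrow> perc_tree p n;
      S \<leftarrow> random_edge_subset (p * (lam / real n)) (vertex_pairs n - T); return_pmf (T, F \<union> S)}"
    by (simp add: perc_tree_def bind_assoc_pmf bind_return_pmf)
  finally show ?thesis .
qed

section \<open>The blob partition as a Markov chain\<close>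

definition block_at :: "nat set set \<Rightarrow> nat \<Rightarrow> nat set" where
  "block_at P u = \<Union> {B \<in> P. u \<in> B}"

lemma partition_on_disjointD:
  assumes "partition_on V P" "A \<in> P" "B \<in> P" "u \<in> A" "u \<in> B"
  shows "A = B"
  using assms unfolding partition_on_def disjoint_def by blast

lemma block_at_eq:
  assumes "partition_on V P" "B \<in> P" "u \<in> B"
  shows "block_at P u = B"
proof -
  have "{A \<in> P. u \<in> A} = {B}"
    using assms partition_on_disjointD[OF assms(1)] by blast
  then show ?thesis by (simp add: block_at_def)
qed

lemma block_at_in:
  assumes "partition_on V P" "u \<in> V"
  shows "block_at P u \<in> P" "u \<in> block_at P u"
proof -
  obtain B where B: "B \<in> P" "u \<in> B" using assms unfolding partition_on_def by blast
  from block_at_eq[OF assms(1) this] B show "block_at P u \<in> P" "u \<in> block_at P u" by auto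
qed

definition blob_pmf :: "real \<Rightarrow> nat \<Rightarrow> nat set set pmf" where
  "blob_pmf p n = map_pmf (\<lambda>(T, F). graph_components {1..n} F) (perc_tree p n)"

lemma finite_blob_pmf: "finite (set_pmf (blob_pmf p n))"
  by (simp add: blob_pmf_def finite_perc_tree)

lemma blob_pmf_partition: "P \<in> set_pmf (blob_pmf p n) \<Longrightarrow> partition_on {1..n} P"
  by (auto simp: blob_pmf_def partition_on_graph_components)

lemma blob_pmf_1: "blob_pmf p 1 = return_pmf {{1}}"
proof -
  have "recursive_tree 1 = return_pmf {}"
    by (simp add: recursive_tree_def)
  then have "perc_tree p 1 = return_pmf ({}, {})"
    by (simp add: perc_tree_def bind_return_pmf random_edge_subset_empty)
  moreover have "graph_components {1..1} {} = {{1}}"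
    by (rule graph_components_eqI) (auto simp: partition_on_def)
  ultimately show ?thesis by (simp add: blob_pmf_def)
qed

text \<open>The partition alone is Markov: the new vertex is a leaf whose single edge is retained or
  not independently of the past, so earlier blobs never merge and only the block of the uniform
  parent matters.\<close>

lemma blob_pmf_Suc:
  assumes "m \<ge> 1"
  shows "blob_pmf p (Suc m) = do {P \<leftarrow> blob_pmf p m; u \<leftarrow> pmf_of_set {1..m}; b \<leftarrow> bernoulli_pmf p;
    return_pmf (if b then extend_block (Suc m) P (block_at P u) else insert {Suc m} P)}"
proof -
  have "blob_pmf p (Suc m) = do {T \<leftarrow> recursive_tree m; u \<leftarrow> pmf_of_set {1..m};
     F \<leftarrow> random_edge_subset p (insert {Suc m, u} T); return_pmf (graph_components {1..Suc m} F)}"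
    unfolding blob_pmf_def perc_tree_def recursive_tree_Suc[OF assms]
    by (simp add: map_bind_pmf bind_assoc_pmf bind_return_pmf)
  also have "\<dots> = do {T \<leftarrow> recursive_tree m; u \<leftarrow> pmf_of_set {1..m};
     b \<leftarrow> bernoulli_pmf p; F \<leftarrow> random_edge_subset p T; 
     return_pmf (graph_components {1..Suc m} (if b then insert {Suc m, u} F else F))}"
  proof (intro bind_pmf_cong refl)
    fix T u assume "T \<in> set_pmf (recursive_tree m)"
    from recursive_tree_support[OF this] have "finite T" "{Suc m, u} \<notin> T"
      by auto
    from random_edge_subset_insert[OF this]
    show "do {F \<leftarrow> random_edge_subset p (insert {Suc m, u} T); return_pmf (graph_components {1..Suc m} F)} =
      do {b \<leftarrow> bernoulli_pmf p; F \<leftarrow> random_edge_subset p T; 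
        return_pmf (graph_components {1..Suc m} (if b then insert {Suc m, u} F else F))}"
      by (simp add: bind_assoc_pmf bind_return_pmf)
  qed
  also have "\<dots> = do {T \<leftarrow> recursive_tree m; F \<leftarrow> random_edge_subset p T; u \<leftarrow> pmf_of_set {1..m};
     b \<leftarrow> bernoulli_pmf p;
     return_pmf (graph_components {1..Suc m} (if b then insert {Suc m, u} F else F))}"
    by (subst bind_commute_pmf[of "bernoulli_pmf p"], subst bind_commute_pmf[of "pmf_of_set {1..m}"], rule refl)
  also have "\<dots> = do {T \<leftarrow> recursive_tree m; F \<leftarrow> random_edge_subset p T; u \<leftarrow> pmf_of_set {1..m};
     b \<leftarrow> bernoulli_pmf p; 
     return_pmf (let P = graph_components {1..m} F in
       if b then extend_block (Suc m) P (block_at P u) else insert {Suc m} P)}"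
  proof (intro bind_pmf_cong refl)
    fix T F u b assume T: "T \<in> set_pmf (recursive_tree m)" "F \<in> set_pmf (random_edge_subset p T)"
      and u: "u \<in> set_pmf (pmf_of_set {1..m})"
    from T have F: "\<Union> F \<subseteq> {1..m}"
      using recursive_tree_support(1)[of T m] set_random_edge_subset[of F p T] by auto
    have u': "u \<in> {1..m}" using u assms by (subst (asm) set_pmf_of_set) auto
    have eq: "{1..Suc m} = insert (Suc m) {1..m}" by auto
    have "component_of {1..m} F u = block_at (graph_components {1..m} F) u"
      using block_at_eq[OF partition_on_graph_components component_in_graph_components component_of_self] u'
      by metis
    then show "return_pmf (graph_components {1..Suc m} (if b then insert {Suc m, u} F else F)) =
      return_pmf (let P = graph_components {1..m} F in
       if b then extend_block (Suc m) P (block_at P u) else insert {Suc m} P)"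
      using graph_components_new_leaf[OF F _ u', of "Suc m"] graph_components_new_singleton[OF F, of "Suc m"]
      unfolding eq Let_def by (cases b) simp_all
  qed
  also have "\<dots> = do {P \<leftarrow> blob_pmf p m; u \<leftarrow> pmf_of_set {1..m}; b \<leftarrow> bernoulli_pmf p;
    return_pmf (if b then extend_block (Suc m) P (block_at P u) else insert {Suc m} P)}"
    by (simp add: blob_pmf_def perc_tree_def bind_map_pmf map_bind_pmf bind_assoc_pmf bind_return_pmf Let_def)
  finally show ?thesis .
qed

lemma sum_over_partition:
  fixes f :: "nat set \<Rightarrow> real"
  assumes "partition_on V P" "finite V"
  shows "(\<Sum>u\<in>V. f (block_at P u)) = (\<Sum>B\<in>P. real (card B) * f B)"
proof -
  have "finite B" if "B \<in> P" for B
    using that assms by (auto simp: partition_on_def intro: finite_subset)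
  moreover have "A \<inter> B = {}" if "A \<in> P" "B \<in> P" "A \<noteq> B" for A B
    using partition_on_disjointD[OF assms(1) that(1,2)] that(3) by auto
  ultimately have "(\<Sum>u\<in>\<Union>P. f (block_at P u)) = (\<Sum>B\<in>P. \<Sum>u\<in>B. f (block_at P u))"
    by (subst sum.Union_disjoint) auto
  also have "\<dots> = (\<Sum>B\<in>P. \<Sum>u\<in>B. f B)"
    by (intro sum.cong refl arg_cong[of _ _ f] block_at_eq[OF assms(1)])
  finally show ?thesis using assms(1) by (simp add: partition_on_def)
qed

text \<open>One step of the chain acting on test functions. Averaging over the uniform parent
  becomes a size-biased choice of the block; every recursion for blob statistics starts from this
  identity.\<close>

lemma expectation_blob_pmf_Suc:
  assumes "m \<ge> 1" "0 \<le> p" "p \<le> 1"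
  shows "measure_pmf.expectation (blob_pmf p (Suc m)) \<Psi> =
    measure_pmf.expectation (blob_pmf p m) (\<lambda>P. (1 - p) * \<Psi> (insert {Suc m} P) +
      p / real m * (\<Sum>B\<in>P. real (card B) * \<Psi> (extend_block (Suc m) P B)))"
proof -
  define step where "step P u = do {b \<leftarrow> bernoulli_pmf p;
    return_pmf (if b then extend_block (Suc m) P (block_at P u) else insert {Suc m} P)}" for P u
  have fin: "finite (set_pmf (step P u))" for P u
    by (simp add: step_def)
  have step: "measure_pmf.expectation (step P u) \<Psi> =
      p * \<Psi> (extend_block (Suc m) P (block_at P u)) + (1 - p) * \<Psi> (insert {Suc m} P)" for P u
    unfolding step_def using assms by (subst expectation_bind_finite) (auto simp: mult.commute)
  have fin': "finite (set_pmf (bind_pmf (pmf_of_set {1..m}) (step P)))" for P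
    using assms by (auto simp: fin)
  have "measure_pmf.expectation (blob_pmf p (Suc m)) \<Psi> =
    measure_pmf.expectation (blob_pmf p m) (\<lambda>P. measure_pmf.expectation (bind_pmf (pmf_of_set {1..m}) (step P)) \<Psi>)"
    unfolding blob_pmf_Suc[OF assms(1)] step_def[symmetric]
    by (rule expectation_bind_finite[OF finite_blob_pmf fin'])
  also have "\<dots> = measure_pmf.expectation (blob_pmf p m) (\<lambda>P. (1 - p) * \<Psi> (insert {Suc m} P) +
      p / real m * (\<Sum>B\<in>P. real (card B) * \<Psi> (extend_block (Suc m) P B)))"
  proof (rule expectation_cong_pmf)
    fix P assume "P \<in> set_pmf (blob_pmf p m)"
    then have P: "partition_on {1..m} P" by (rule blob_pmf_partition)
    have "measure_pmf.expectation (bind_pmf (pmf_of_set {1..m}) (step P)) \<Psi> =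
      (\<Sum>u\<in>{1..m}. p * \<Psi> (extend_block (Suc m) P (block_at P u)) + (1 - p) * \<Psi> (insert {Suc m} P)) / real m"
      using assms fin by (subst expectation_bind_finite) (auto simp: step integral_pmf_of_set)
    also have "\<dots> = (1 - p) * \<Psi> (insert {Suc m} P) +
        p / real m * (\<Sum>u\<in>{1..m}. \<Psi> (extend_block (Suc m) P (block_at P u)))"
      unfolding sum.distrib sum_distrib_left[symmetric] sum_constant
      using assms(1) by (simp add: field_simps)
    also have "(\<Sum>u\<in>{1..m}. \<Psi> (extend_block (Suc m) P (block_at P u))) =
        (\<Sum>B\<in>P. real (card B) * \<Psi> (extend_block (Suc m) P B))"
      by (rule sum_over_partition[OF P]) simp
    finally show "measure_pmf.expectation (bind_pmf (pmf_of_set {1..m}) (step P)) \<Psi> =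
      (1 - p) * \<Psi> (insert {Suc m} P) +
        p / real m * (\<Sum>B\<in>P. real (card B) * \<Psi> (extend_block (Suc m) P B))" .
  qed
  finally show ?thesis .
qed

section \<open>Moments of the blob sizes\<close>

lemma powr_Bernoulli:
  fixes x a :: real
  assumes "0 \<le> x" "1 \<le> a"
  shows "1 + a * x \<le> (1 + x) powr a"
proof -
  define f where "f t = (1 + t) powr a - a * t" for t :: real
  have "f 0 \<le> f x"
  proof (rule DERIV_nonneg_imp_nondecreasing[OF assms(1)])
    fix t :: real assume t: "0 \<le> t" "t \<le> x"
    have "1 \<le> (1 + t) powr (a - 1)" using t assms(2) by (intro ge_one_powr_ge_zero) auto
    then have "0 \<le> a * (1 + t) powr (a - 1) - a"
      using assms(2) by (simp add: mult_left_mono[of 1, simplified])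
    moreover have "(f has_real_derivative (a * (1 + t) powr (a - 1) - a)) (at t)"
      unfolding f_def using t by (auto intro!: derivative_eq_intros simp: powr_diff field_simps)
    ultimately show "\<exists>y. (f has_real_derivative y) (at t) \<and> 0 \<le> y" by blast
  qed
  then show ?thesis by (simp add: f_def)
qed

text \<open>Makes \<open>n powr a\<close> a supersolution of the homogeneous recursion with factor
  \<open>1 + a / m\<close>.\<close>

lemma powr_Suc_lower:
  assumes "m \<ge> 1" "1 \<le> a"
  shows "real m powr a * (1 + a / real m) \<le> real (Suc m) powr a"
proof -
  have "real m powr a * (1 + a / real m) \<le> real m powr a * (1 + 1 / real m) powr a"
    using powr_Bernoulli[of "1 / real m" a] assms by (intro mult_left_mono) auto
  also have "\<dots> = (real m * (1 + 1 / real m)) powr a"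
    using assms by (simp add: powr_mult)
  also have "real m * (1 + 1 / real m) = real (Suc m)" using assms by (simp add: field_simps)
  finally show ?thesis .
qed

text \<open>For \<open>a > 1\<close> the linear function \<open>- b / (a - 1) * n\<close> solves the
  inhomogeneous recursion exactly, and \<open>n powr a\<close> dominates the homogeneous part.
  Keeping the linear term allows a start from value 0 at time \<open>k\<close>, which is the origin
  of the factor \<open>k powr (1 - a)\<close> for late blobs.\<close>

lemma linear_recursion_growth:
  fixes S :: "nat \<Rightarrow> real"
  assumes step: "\<And>m. m \<ge> n0 \<Longrightarrow> S (Suc m) \<le> (1 + a / real m) * S m + b"
    and "a > 1" "b \<ge> 0" "n0 \<ge> 1" "A \<ge> 0"
    and init: "S n0 \<le> A * real n0 powr a - b / (a - 1) * real n0"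
    and "n \<ge> n0"
  shows "S n \<le> A * real n powr a - b / (a - 1) * real n"
  using \<open>n \<ge> n0\<close>
proof (induction n rule: nat_induct_at_least)
  case base
  show ?case by (rule init)
next
  case (Suc m)
  define C where "C = b / (a - 1)"
  have m: "m \<ge> 1" using Suc assms by simp
  have "S (Suc m) \<le> (1 + a / real m) * (A * real m powr a - C * real m) + b"
    using step[OF Suc(1)] mult_left_mono[OF Suc(2), of "1 + a / real m"] assms(2) unfolding C_def
    by (simp add: add_nonneg_nonneg)
  also have "\<dots> = A * (real m powr a * (1 + a / real m)) - C * (real m + a) + b"
    using m by (simp add: field_simps)
  also have "\<dots> \<le> A * real (Suc m) powr a - C * (real m + a) + b"
    using powr_Suc_lower[OF m, of a] assms by (simp add: mult_left_mono)
  also have "C * (real m + a) = C * real (Suc m) + b"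
    using \<open>a > 1\<close> by (simp add: C_def field_simps)
  finally show ?case by (simp add: C_def)
qed

text \<open>An exponent strictly above \<open>a\<close> leaves the slack \<open>\<beta> - a\<close>,
  which absorbs the constant forcing. This serves moments with \<open>r * p\<close> possibly at most
  1, including the value 1, where the exact growth carries a logarithm.\<close>

lemma linear_recursion_growth_above:
  fixes S :: "nat \<Rightarrow> real"
  assumes step: "\<And>m. m \<ge> 1 \<Longrightarrow> S (Suc m) \<le> (1 + a / real m) * S m + b"
    and "a \<ge> 0" "\<beta> \<ge> 1" "\<beta> > a" "b \<ge> 0" "S 1 \<le> C" "b \<le> C * (\<beta> - a)" "C \<ge> 0" "n \<ge> 1"
  shows "S n \<le> C * real n powr \<beta>"
  using \<open>n \<ge> 1\<close>
proof (induction n rule: nat_induct_at_least)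
  case base
  show ?case using assms by simp
next
  case (Suc m)
  have m: "m \<ge> 1" using Suc by simp
  have 1: "1 \<le> real m powr (\<beta> - 1)"
    using m assms by (intro ge_one_powr_ge_zero) auto
  have "S (Suc m) \<le> (1 + a / real m) * (C * real m powr \<beta>) + b"
    using step[OF m] mult_left_mono[OF Suc(2), of "1 + a / real m"] assms(2)
    by (simp add: add_nonneg_nonneg)
  also have "\<dots> \<le> (1 + a / real m) * (C * real m powr \<beta>) + C * (\<beta> - a) * real m powr (\<beta> - 1)"
    using assms mult_left_mono[OF 1, of "C * (\<beta> - a)"] by simp
  also have "\<dots> = C * (real m powr \<beta> * (1 + \<beta> / real m))"
    using m by (simp add: powr_diff field_simps)
  also have "\<dots> \<le> C * real (Suc m) powr \<beta>"
    using powr_Suc_lower[OF m, of \<beta>] assms by (intro mult_left_mono) auto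
  finally show ?case .
qed

section \<open>Additive functionals of the blob partition\<close>

lemma partition_upto_facts:
  assumes "partition_on {1..m::nat} P"
  shows "finite P" "\<And>B. B \<in> P \<Longrightarrow> finite B" "\<And>B. B \<in> P \<Longrightarrow> Suc m \<notin> B"
    "\<And>B. B \<in> P \<Longrightarrow> B \<subseteq> {1..m}" "\<And>B. B \<in> P \<Longrightarrow> B \<noteq> {}" "\<And>B. B \<in> P \<Longrightarrow> 1 \<le> card B"
    "(\<Sum>B\<in>P. real (card B)) = real m" "{Suc m} \<notin> P" "\<And>B. insert (Suc m) B \<notin> P"
proof -
  have U: "\<Union> P = {1..m}" using assms by (simp add: partition_on_def)
  show "finite P" by (rule finite_elements[OF _ assms]) simp
  show sub: "B \<subseteq> {1..m}" if "B \<in> P" for B using U that by auto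
  show fin: "finite B" if "B \<in> P" for B using sub[OF that] finite_subset by blast
  show S: "Suc m \<notin> B" if "B \<in> P" for B using sub[OF that] by auto
  show ne: "B \<noteq> {}" if "B \<in> P" for B using assms that by (auto simp: partition_on_def)
  show "1 \<le> card B" if "B \<in> P" for B using fin[OF that] ne[OF that] by (simp add: Suc_le_eq card_gt_0_iff)
  show "(\<Sum>B\<in>P. real (card B)) = real m"
    using sum_over_partition[OF assms, of "\<lambda>_. 1"] by simp
  show "{Suc m} \<notin> P" "\<And>B. insert (Suc m) B \<notin> P" using S by blast+
qed

lemma sum_insert_singleton:
  assumes "partition_on {1..m::nat} P"
  shows "(\<Sum>B\<in>insert {Suc m} P. \<phi> B) = \<phi> {Suc m} + (\<Sum>B\<in>P. \<phi> B :: real)"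
  using partition_upto_facts[OF assms] by simp

lemma sum_extend_block:
  assumes "partition_on {1..m::nat} P" "A \<in> P"
  shows "(\<Sum>B\<in>extend_block (Suc m) P A. \<phi> B) = (\<Sum>B\<in>P. \<phi> B) + (\<phi> (insert (Suc m) A) - \<phi> A :: real)"
  using partition_upto_facts[OF assms(1)] assms(2) by (simp add: extend_block_def sum_diff1)

text \<open>The sizes add up to \<open>m\<close>, so the probabilities of growth add up to
  \<open>p\<close> and the functional changes only through the one block that grows or through the
  new singleton.\<close>

lemma additive_step:
  assumes P: "partition_on {1..m::nat} P" and m: "m \<ge> 1"
  shows "(1 - p) * (\<Sum>B\<in>insert {Suc m} P. \<phi> B) +
      p / real m * (\<Sum>A\<in>P. real (card A) * (\<Sum>B\<in>extend_block (Suc m) P A. \<phi> B)) =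
    (\<Sum>B\<in>P. \<phi> B) + p / real m * (\<Sum>B\<in>P. real (card B) * (\<phi> (insert (Suc m) B) - \<phi> B)) + (1 - p) * \<phi> {Suc m}"
proof -
  have "(\<Sum>A\<in>P. real (card A) * (\<Sum>B\<in>extend_block (Suc m) P A. \<phi> B)) =
     (\<Sum>A\<in>P. real (card A) * (\<Sum>B\<in>P. \<phi> B) + real (card A) * (\<phi> (insert (Suc m) A) - \<phi> A))"
    by (intro sum.cong refl) (simp add: sum_extend_block[OF P] algebra_simps)
  also have "\<dots> = real m * (\<Sum>B\<in>P. \<phi> B) + (\<Sum>B\<in>P. real (card B) * (\<phi> (insert (Suc m) B) - \<phi> B))"
    by (simp only: sum.distrib sum_distrib_right[symmetric] partition_upto_facts(7)[OF P])
  finally show ?thesis using m by (simp add: sum_insert_singleton[OF P] field_simps)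
qed

lemma expectation_additive_Suc:
  assumes "m \<ge> 1" "0 \<le> p" "p \<le> 1"
  shows "measure_pmf.expectation (blob_pmf p (Suc m)) (\<lambda>P. \<Sum>B\<in>P. \<phi> B) =
    measure_pmf.expectation (blob_pmf p m) (\<lambda>P. \<Sum>B\<in>P. \<phi> B + p / real m * (real (card B) * (\<phi> (insert (Suc m) B) - \<phi> B)))
    + (1 - p) * \<phi> {Suc m}"
proof -
  have "measure_pmf.expectation (blob_pmf p (Suc m)) (\<lambda>P. \<Sum>B\<in>P. \<phi> B) =
    measure_pmf.expectation (blob_pmf p m) (\<lambda>P. (\<Sum>B\<in>P. \<phi> B + p / real m * (real (card B) * (\<phi> (insert (Suc m) B) - \<phi> B)))
      + (1 - p) * \<phi> {Suc m})"
    unfolding expectation_blob_pmf_Suc[OF assms]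
    by (intro expectation_cong_pmf, subst additive_step[OF blob_pmf_partition assms(1)])
       (simp_all add: sum.distrib sum_distrib_left)
  also have "\<dots> = measure_pmf.expectation (blob_pmf p m) (\<lambda>P. \<Sum>B\<in>P. \<phi> B + p / real m * (real (card B) * (\<phi> (insert (Suc m) B) - \<phi> B)))
    + (1 - p) * \<phi> {Suc m}"
    by (subst Bochner_Integration.integral_add)
       (auto intro: integrable_measure_pmf_finite finite_blob_pmf)
  finally show ?thesis .
qed

text \<open>The total over blobs founded after vertex \<open>k\<close>; \<open>k = 0\<close> gives
  all blobs. The rising factorial replaces the power because it is an eigenfunction of size-biased
  growth, so the recursion closes at each order without lower moments.\<close>

definition late_moment :: "real \<Rightarrow> nat \<Rightarrow> nat \<Rightarrow> nat \<Rightarrow> real" where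
  "late_moment p r k n = measure_pmf.expectation (blob_pmf p n)
     (\<lambda>P. \<Sum>B\<in>P. if B \<inter> {1..k} = {} then pochhammer (real (card B)) r else 0)"

lemma pochhammer_increment:
  "real w * (pochhammer (real (Suc w)) r - pochhammer (real w) r) = real r * pochhammer (real w) r"
proof -
  have "real w * pochhammer (real w + 1) r = (real w + real r) * pochhammer (real w) r"
    by (metis pochhammer_rec pochhammer_rec' of_nat_eq_of_nat_power_cancel_iff)
  then show ?thesis by (simp add: algebra_simps)
qed

lemma late_moment_Suc:
  assumes "m \<ge> 1" "k \<le> m" "0 \<le> p" "p \<le> 1"
  shows "late_moment p r k (Suc m) = (1 + real r * p / real m) * late_moment p r k m + (1 - p) * fact r"
proof -
  let ?\<phi> = "\<lambda>B. if B \<inter> {1..k} = {} then pochhammer (real (card B)) r else 0"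
  have "measure_pmf.expectation (blob_pmf p m) (\<lambda>P. \<Sum>B\<in>P. ?\<phi> B + p / real m * (real (card B) * (?\<phi> (insert (Suc m) B) - ?\<phi> B))) =
    measure_pmf.expectation (blob_pmf p m) (\<lambda>P. (1 + real r * p / real m) * (\<Sum>B\<in>P. ?\<phi> B))"
  proof (rule expectation_cong_pmf)
    fix P assume "P \<in> set_pmf (blob_pmf p m)"
    then have P: "partition_on {1..m} P" by (rule blob_pmf_partition)
    show "(\<Sum>B\<in>P. ?\<phi> B + p / real m * (real (card B) * (?\<phi> (insert (Suc m) B) - ?\<phi> B))) =
      (1 + real r * p / real m) * (\<Sum>B\<in>P. ?\<phi> B)"
      unfolding sum_distrib_left
    proof (rule sum.cong[OF refl])
      fix B assume B: "B \<in> P"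
      note facts = partition_upto_facts(2,3)[OF P B]
      have "insert (Suc m) B \<inter> {1..k} = B \<inter> {1..k}" using assms by auto
      then show "?\<phi> B + p / real m * (real (card B) * (?\<phi> (insert (Suc m) B) - ?\<phi> B)) =
        (1 + real r * p / real m) * ?\<phi> B"
        using facts pochhammer_increment[of "card B" r] by (simp add: algebra_simps add_divide_distrib)
    qed
  qed
  moreover have "?\<phi> {Suc m} = fact r" using assms by (simp add: pochhammer_fact)
  ultimately show ?thesis
    unfolding late_moment_def by (subst expectation_additive_Suc) (use assms in simp_all)
qed

lemma late_moment_self:
  assumes "k \<ge> 1"
  shows "late_moment p r k k = 0"
proof -
  have "late_moment p r k k = measure_pmf.expectation (blob_pmf p k) (\<lambda>_. 0)"
    unfolding late_moment_def
  proof (intro expectation_cong_pmf sum.neutral ballI)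
    fix P B assume "P \<in> set_pmf (blob_pmf p k)" and B: "B \<in> P"
    then have P: "partition_on {1..k} P" by (intro blob_pmf_partition)
    have "B \<inter> {1..k} \<noteq> {}" using partition_upto_facts(4,5)[OF P B] by blast
    then show "(if B \<inter> {1..k} = {} then pochhammer (real (card B)) r else 0) = 0" by simp
  qed
  then show ?thesis by simp
qed

lemma late_moment_0_1: "late_moment p r 0 1 = fact r"
  unfolding late_moment_def blob_pmf_1 by (simp add: pochhammer_fact)

text \<open>At time \<open>k\<close> there is no late blob, so the recursion starts from 0. The
  resulting factor \<open>k powr (1 - r * p)\<close> tends to 0 with \<open>k\<close>, which makes
  blobs founded late negligible at scale \<open>n powr p\<close>.\<close>

lemma late_moment_bound:
  assumes "0 \<le> p" "p \<le> 1" "real r * p > 1" "1 \<le> k" "k \<le> n"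
  shows "late_moment p r k n \<le> fact r / (real r * p - 1) * real k powr (1 - real r * p) * real n powr (real r * p)"
proof -
  define a where "a = real r * p"
  have k: "real k powr (1 - a) * real k powr a = real k"
    using assms by (simp add: powr_add[symmetric])
  have "late_moment p r k n \<le> (fact r / (a - 1) * real k powr (1 - a)) * real n powr a - fact r / (a - 1) * real n"
  proof (rule linear_recursion_growth[where ?n0.0 = k])
    show "late_moment p r k (Suc m) \<le> (1 + a / real m) * late_moment p r k m + fact r" if "m \<ge> k" for m
      using late_moment_Suc[of m k p r] that assms
      by (simp add: a_def mult_left_le_one_le)
    show "late_moment p r k k \<le> fact r / (a - 1) * real k powr (1 - a) * real k powr a - fact r / (a - 1) * real k"
      using late_moment_self[OF assms(4), of p r] k by (simp add: mult.assoc)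
  qed (use assms in \<open>auto simp: a_def\<close>)
  moreover have "0 \<le> fact r / (a - 1) * real n" using assms by (simp add: a_def)
  ultimately show ?thesis unfolding a_def by linarith
qed

lemma moment_bound:
  assumes "0 \<le> p" "p \<le> 1" "real r * p > 1" "1 \<le> n"
  shows "late_moment p r 0 n \<le> (fact r + fact r / (real r * p - 1)) * real n powr (real r * p)"
proof -
  define a where "a = real r * p"
  have "late_moment p r 0 n \<le> (fact r + fact r / (a - 1)) * real n powr a - fact r / (a - 1) * real n"
  proof (rule linear_recursion_growth[where ?n0.0 = 1])
    show "late_moment p r 0 (Suc m) \<le> (1 + a / real m) * late_moment p r 0 m + fact r" if "m \<ge> 1" for m
      using late_moment_Suc[of m 0 p r] that assms
      by (simp add: a_def mult_left_le_one_le)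
  qed (use assms late_moment_0_1[of p r] in \<open>auto simp: a_def\<close>)
  moreover have "0 \<le> fact r / (a - 1) * real n" using assms by (simp add: a_def)
  ultimately show ?thesis unfolding a_def by linarith
qed

text \<open>The constant matters: it balances the forcing \<open>2 * (1 - p)\<close> against the
  slack \<open>1 - 2 * p\<close>. Subtracting the first moment from it leaves the sharp
  susceptibility \<open>1 / (1 - 2 * p)\<close>.\<close>

lemma second_moment_bound:
  assumes "0 \<le> p" "p < 1 / 2" "1 \<le> n"
  shows "late_moment p 2 0 n \<le> 2 * (1 - p) / (1 - 2 * p) * real n"
proof -
  have "late_moment p 2 0 n \<le> 2 * (1 - p) / (1 - 2 * p) * real n powr 1"
  proof (rule linear_recursion_growth_above[where a = "2 * p" and b = "2 * (1 - p)"])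
    show "late_moment p 2 0 (Suc m) \<le> (1 + 2 * p / real m) * late_moment p 2 0 m + 2 * (1 - p)" if "m \<ge> 1" for m
      using late_moment_Suc[of m 0 p 2] that assms by (simp add: fact_2)
    show "late_moment p 2 0 1 \<le> 2 * (1 - p) / (1 - 2 * p)"
      unfolding late_moment_0_1 using assms by (simp add: fact_2 field_simps)
  qed (use assms in \<open>auto simp: field_simps\<close>)
  then show ?thesis using assms by simp
qed

text \<open>The exponent lies strictly between \<open>3 * p\<close> and \<open>1 + p\<close>, where
  there is room because \<open>p < 1 / 2\<close>. Exceeding \<open>3 * p\<close> closes the
  recursion; staying below \<open>1 + p\<close> makes the third moment negligible in the
  exploration.\<close>

lemma third_moment_bound:
  assumes "0 < p" "p < 1 / 2"
  shows "\<exists>C\<ge>0. \<forall>n\<ge>1. late_moment p 3 0 n \<le> C * real n powr (max 1 (1 / 2 + 2 * p))"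
proof -
  define \<beta> where "\<beta> = max 1 (1 / 2 + 2 * p)"
  have \<beta>: "\<beta> \<ge> 1" "\<beta> > 3 * p" using assms by (auto simp: \<beta>_def max_def)
  define C where "C = 6 + 6 / (\<beta> - 3 * p)"
  have "C * (\<beta> - 3 * p) = 6 * (\<beta> - 3 * p) + 6"
  proof -
    have "(6 + 6 / d) * d = 6 * d + 6" if "d \<noteq> 0" for d :: real
      using that by (simp add: distrib_right)
    from this[of "\<beta> - 3 * p"] \<beta> show ?thesis by (simp add: C_def)
  qed
  then have C: "C \<ge> 6" "6 \<le> C * (\<beta> - 3 * p)" using \<beta> by (auto simp: C_def)
  have "late_moment p 3 0 n \<le> C * real n powr \<beta>" if "n \<ge> 1" for n
  proof (rule linear_recursion_growth_above[where a = "3 * p" and b = 6])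
    show "late_moment p 3 0 (Suc m) \<le> (1 + 3 * p / real m) * late_moment p 3 0 m + 6" if "m \<ge> 1" for m
      using late_moment_Suc[of m 0 p 3] that assms by (simp add: eval_nat_numeral)
    show "late_moment p 3 0 1 \<le> C"
      unfolding late_moment_0_1 using C by (simp add: eval_nat_numeral)
  qed (use assms C \<beta> that in auto)
  then show ?thesis using C unfolding \<beta>_def by (intro exI[of _ C]) auto
qed

section \<open>Concentration of the blob counts\<close>

lemma q_1:
  assumes "0 < p"
  shows "q p 1 * (1 + p) = 1 - p"
proof -
  define y where "y = 1 + 1 / p"
  have y: "y > 0" using assms by (simp add: y_def add_pos_pos)
  then have "y \<notin> \<int>\<^sub>\<le>\<^sub>0" by (auto elim!: nonpos_Ints_cases)
  then have "Gamma (1 + y) = y * Gamma y" using Gamma_plus1[of y] by (simp add: add.commute)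
  then have "Beta 1 y = 1 / y"
    using less_imp_neq[OF Gamma_real_pos[OF y]] y by (simp add: Beta_def)
  then have "q p 1 = (1 - p) / p * (1 / y)" by (simp add: q_def y_def)
  also have "y = (1 + p) / p" using assms by (simp add: y_def field_simps)
  also have "(1 - p) / p * (1 / ((1 + p) / p)) = (1 - p) / (1 + p)" using assms by simp
  finally show ?thesis using assms by simp
qed

text \<open>The functional equation of the Beta function in its first argument, cleared of
  denominators.\<close>

lemma q_Suc:
  assumes "0 < p" "1 \<le> k"
  shows "q p (Suc k) * (1 + p * real (Suc k)) = p * real k * q p k"
proof -
  have "real k \<notin> \<int>\<^sub>\<le>\<^sub>0" using assms(2) by (auto elim!: nonpos_Ints_cases)
  from Beta_plus1_left[OF this, of "1 + 1 / p"]
  have "(real k + (1 + 1 / p)) * Beta (real (Suc k)) (1 + 1 / p) = real k * Beta (real k) (1 + 1 / p)"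
    by (simp add: add.commute)
  moreover have "1 + p * real (Suc k) = p * (real k + (1 + 1 / p))"
    using assms by (simp add: field_simps)
  ultimately have "q p (Suc k) * (1 + p * real (Suc k)) = (1 - p) / p * p * (real k * Beta (real k) (1 + 1 / p))"
    by (simp add: q_def mult_ac)
  then show ?thesis by (simp add: q_def)
qed

lemma q_bounds:
  assumes "0 < p" "p < 1" "1 \<le> k"
  shows "0 < q p k" "q p k \<le> 1"
proof -
  have "0 < q p k \<and> q p k \<le> 1"
    using assms(3)
  proof (induction k rule: nat_induct_at_least)
    case base
    have "q p 1 = (1 - p) / (1 + p)" using q_1[OF assms(1)] assms by (simp add: field_simps)
    then show ?case using assms by simp
  next
    case (Suc k)
    have pos: "1 + p * real (Suc k) > 0" using assms by (simp add: add_pos_nonneg)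
    have "q p (Suc k) = p * real k * q p k / (1 + p * real (Suc k))"
      using q_Suc[OF assms(1) Suc(1)] pos by (simp add: field_simps)
    moreover have "p * real k * q p k \<le> 1 + p * real (Suc k)"
    proof -
      have "p * real k * q p k \<le> p * real k * 1" using Suc assms by (intro mult_left_mono) auto
      then show ?thesis
        using assms(1) unfolding mult_1_right of_nat_Suc distrib_left by linarith
    qed
    ultimately show ?case using Suc assms pos by simp
  qed
  then show "0 < q p k" "q p k \<le> 1" by auto
qed

text \<open>If the count of each size \<open>k\<close> is \<open>q p k * m\<close>, its mean
  increment must be \<open>q p k\<close>: new singletons, plus growth out of size
  \<open>k - 1\<close>, minus growth out of size \<open>k\<close>. This cancels the constant part of
  the drift of the deviations.\<close>

lemma q_balance:
  assumes "0 < p" "1 \<le> k"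
  shows "(if k = 1 then 1 - p else 0) + p * real (k - 1) * q p (k - 1) - p * real k * q p k - q p k = 0"
proof (cases "k = 1")
  case True
  then show ?thesis using q_1[OF assms(1)] by (simp add: algebra_simps)
next
  case False
  with assms obtain j where "k = Suc j" "1 \<le> j" by (cases k) auto
  then show ?thesis using q_Suc[OF assms(1), of j] by (simp add: algebra_simps)
qed

definition size_count :: "nat \<Rightarrow> nat set set \<Rightarrow> real" where
  "size_count k P = (\<Sum>B\<in>P. of_bool (card B = k))"

lemma size_count_eq_card: "finite P \<Longrightarrow> size_count k P = real (card {B \<in> P. card B = k})"
  by (simp add: size_count_def of_bool_def sum.If_cases Int_def)

lemma size_count_weighted:
  assumes "finite P"
  shows "(\<Sum>B\<in>P. real (card B) * of_bool (card B = k)) = real k * size_count k P"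
  unfolding size_count_def sum_distrib_left by (intro sum.cong) auto

lemma size_count_bounds:
  assumes "partition_on {1..m} P"
  shows "0 \<le> size_count k P" "size_count k P \<le> real m"
proof -
  note f = partition_upto_facts[OF assms]
  have "of_bool (card B = k) \<le> real (card B)" if "B \<in> P" for B
    using f(6)[OF that] by (simp add: of_bool_def)
  then have "size_count k P \<le> (\<Sum>B\<in>P. real (card B))"
    unfolding size_count_def by (intro sum_mono)
  then show "0 \<le> size_count k P" "size_count k P \<le> real m"
    using f(7) by (auto simp: size_count_def intro: sum_nonneg)
qed

definition count_deviation :: "real \<Rightarrow> nat \<Rightarrow> nat \<Rightarrow> nat set set \<Rightarrow> real" where
  "count_deviation p k m P = size_count k P - q p k * real m"

lemma convex_square:
  fixes a b x y :: real
  assumes "0 \<le> a" "0 \<le> b" "a + b \<le> 1"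
  shows "(a * x + b * y)\<^sup>2 \<le> a * x\<^sup>2 + b * y\<^sup>2"
proof -
  have "a * x\<^sup>2 + b * y\<^sup>2 - (a * x + b * y)\<^sup>2 =
     a * (1 - a - b) * x\<^sup>2 + b * (1 - a - b) * y\<^sup>2 + a * b * (x - y)\<^sup>2"
    by (simp add: power2_eq_square algebra_simps)
  also have "\<dots> \<ge> 0" using assms by simp
  finally show ?thesis by simp
qed

text \<open>The drift contracts the deviation of \<open>k\<close> towards a sub-convex combination of the
  deviations of \<open>k\<close> and \<open>k - 1\<close>; each step adds bounded noise.\<close>

lemma count_deviation_step:
  assumes P: "partition_on {1..m} P" and m: "1 \<le> m" and p: "0 < p" "p < 1" and k: "1 \<le> k" "k \<le> m"
  shows "(1 - p) * (count_deviation p k (Suc m) (insert {Suc m} P))\<^sup>2 +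
      p / real m * (\<Sum>B\<in>P. real (card B) * (count_deviation p k (Suc m) (extend_block (Suc m) P B))\<^sup>2)
    \<le> (1 - p * real k / real m) * (count_deviation p k m P)\<^sup>2
      + p * real (k - 1) / real m * (count_deviation p (k - 1) m P)\<^sup>2 + 4"
proof -
  note f = partition_upto_facts[OF P]
  define X where "X = count_deviation p k m P"
  define Y where "Y = count_deviation p (k - 1) m P"
  define u where "u = of_bool (k = 1) - q p k"
  define v where "v B = of_bool (card B = k - 1) - of_bool (card B = k) - q p k" for B :: "nat set"
  have qb: "0 \<le> q p k" "q p k \<le> 1" using q_bounds[OF p k(1)] by auto
  have u2: "u\<^sup>2 \<le> 4"
  proof -
    have "\<bar>u\<bar> \<le> 2" using qb by (auto simp: u_def)
    from power_mono[OF this, of 2] show ?thesis by simp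
  qed
  have v2: "(v B)\<^sup>2 \<le> 4" for B
  proof -
    have "\<bar>v B\<bar> \<le> 2" using qb by (auto simp: v_def)
    from power_mono[OF this, of 2] show ?thesis by simp
  qed
  have ins: "count_deviation p k (Suc m) (insert {Suc m} P) = X + u"
    unfolding count_deviation_def X_def u_def size_count_def sum_insert_singleton[OF P]
    by (simp add: algebra_simps of_bool_def)
  have ext: "count_deviation p k (Suc m) (extend_block (Suc m) P B) = X + v B" if B: "B \<in> P" for B
  proof -
    have "card (insert (Suc m) B) = Suc (card B)" using f(2,3)[OF B] by simp
    moreover have "(Suc (card B) = k) = (card B = k - 1)" using k by auto
    ultimately show ?thesis
      unfolding count_deviation_def X_def v_def size_count_def sum_extend_block[OF P B]
      by (simp add: algebra_simps)
  qed
  define w where "w B = p / real m * real (card B)" for B :: "nat set"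
  have w0: "0 \<le> w B" for B using p by (simp add: w_def)
  have ws: "(\<Sum>B\<in>P. w B) = p"
    unfolding w_def sum_distrib_left[symmetric] f(7) using m by simp
  have wv: "(\<Sum>B\<in>P. w B * v B) = p / real m * (real (k - 1) * size_count (k - 1) P - real k * size_count k P) - p * q p k"
  proof -
    have "(\<Sum>B\<in>P. w B * v B) = p / real m * ((\<Sum>B\<in>P. real (card B) * of_bool (card B = k - 1))
       - (\<Sum>B\<in>P. real (card B) * of_bool (card B = k))) - (\<Sum>B\<in>P. w B) * q p k"
      unfolding w_def v_def sum_distrib_left sum_distrib_right sum_subtractf[symmetric]
      by (intro sum.cong refl) (simp add: algebra_simps)
    then show ?thesis unfolding size_count_weighted[OF f(1)] ws .
  qed
  \<comment> \<open>\<open>\<mu>\<close> is the conditional mean increment of the deviation. By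
    \<open>q_balance\<close> its constant part cancels, so \<open>X + \<mu>\<close> combines
    \<open>X\<close> and \<open>Y\<close> with weights adding up to at most 1.\<close>
  define \<mu> where "\<mu> = (1 - p) * u + (\<Sum>B\<in>P. w B * v B)"
  have Xm: "X + \<mu> = (1 - p * real k / real m) * X + p * real (k - 1) / real m * Y"
  proof -
    have "\<mu> = (if k = 1 then 1 - p else 0) - q p k
        + p / real m * (real (k - 1) * (Y + q p (k - 1) * real m) - real k * (X + q p k * real m))"
      unfolding \<mu>_def wv by (simp add: u_def X_def Y_def count_deviation_def of_bool_def algebra_simps)
    also have "\<dots> = p / real m * (real (k - 1) * Y - real k * X) +
        ((if k = 1 then 1 - p else 0) + p * real (k - 1) * q p (k - 1) - p * real k * q p k - q p k)"
      using m by (simp add: field_simps)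
    also have "\<dots> = p / real m * (real (k - 1) * Y - real k * X)"
      unfolding q_balance[OF p(1) k(1)] by simp
    finally show ?thesis by (simp add: algebra_simps)
  qed
  \<comment> \<open>Expand the conditional second moment around \<open>X\<close>. The increments are
    at most 2 in absolute value, so their mean square costs at most 4, and what remains is at most
    \<open>(X + \<mu>)\<^sup>2\<close>.\<close>
  have "(1 - p) * (X + u)\<^sup>2 + (\<Sum>B\<in>P. w B * (X + v B)\<^sup>2)
     = (1 - p) * u\<^sup>2 + (\<Sum>B\<in>P. w B * (v B)\<^sup>2) + (1 - p + (\<Sum>B\<in>P. w B)) * X\<^sup>2 + 2 * X * \<mu>"
    unfolding \<mu>_def power2_sum
    by (simp add: algebra_simps sum.distrib sum_distrib_left sum_distrib_right)
  also have "(1 - p + (\<Sum>B\<in>P. w B)) * X\<^sup>2 = X\<^sup>2" using ws by simp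
  also have "(1 - p) * u\<^sup>2 + (\<Sum>B\<in>P. w B * (v B)\<^sup>2) + X\<^sup>2 + 2 * X * \<mu>
      \<le> (1 - p) * 4 + (\<Sum>B\<in>P. w B * 4) + X\<^sup>2 + 2 * X * \<mu>"
    using u2 v2 w0 p by (intro add_mono mult_left_mono sum_mono order_refl) auto
  also have "(1 - p) * 4 + (\<Sum>B\<in>P. w B * 4) = 4"
    by (simp add: sum_distrib_right[symmetric] ws)
  also have "4 + X\<^sup>2 + 2 * X * \<mu> \<le> (X + \<mu>)\<^sup>2 + 4"
    by (simp add: power2_sum)
  also have "(X + \<mu>)\<^sup>2 \<le> (1 - p * real k / real m) * X\<^sup>2 + p * real (k - 1) / real m * Y\<^sup>2"
    unfolding Xm
  proof (rule convex_square)
    have "p * real k \<le> 1 * real m" using p k by (intro mult_mono) auto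
    then show "0 \<le> 1 - p * real k / real m" using m by simp
    show "0 \<le> p * real (k - 1) / real m" using p by simp
    have "p * real (k - 1) \<le> p * real k" using p by simp
    then show "1 - p * real k / real m + p * real (k - 1) / real m \<le> 1"
      using m by (simp add: divide_right_mono)
  qed
  finally have "(1 - p) * (X + u)\<^sup>2 + (\<Sum>B\<in>P. w B * (X + v B)\<^sup>2) \<le>
     (1 - p * real k / real m) * X\<^sup>2 + p * real (k - 1) / real m * Y\<^sup>2 + 4"
    by simp
  moreover have "p / real m * (\<Sum>B\<in>P. real (card B) * (count_deviation p k (Suc m) (extend_block (Suc m) P B))\<^sup>2)
      = (\<Sum>B\<in>P. w B * (X + v B)\<^sup>2)"
    unfolding sum_distrib_left by (intro sum.cong refl) (simp add: ext w_def)
  ultimately show ?thesis unfolding ins X_def Y_def by simp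
qed

text \<open>All sizes up to \<open>K\<close> are treated together, since the recursion for
  \<open>k\<close> refers to \<open>k - 1\<close>. The weights add up to at most 1, so each step
  adds at most 4. Starting at \<open>n = K\<close> keeps the weight of the deviation for
  \<open>k\<close> nonnegative, and there the trivial bound on counts is enough.\<close>

lemma count_deviation_second_moment:
  assumes p: "0 < p" "p < 1" and k: "1 \<le> k" "k \<le> K" and n: "K \<le> n"
  shows "measure_pmf.expectation (blob_pmf p n) (\<lambda>P. (count_deviation p k n P)\<^sup>2) \<le> 4 * real K * real n"
  using n k
proof (induction n arbitrary: k rule: nat_induct_at_least)
  case base
  have "measure_pmf.expectation (blob_pmf p K) (\<lambda>P. (count_deviation p k K P)\<^sup>2) \<le>
     measure_pmf.expectation (blob_pmf p K) (\<lambda>P. 4 * real K * real K)"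
  proof (rule expectation_mono_finite[OF finite_blob_pmf])
    fix P assume "P \<in> set_pmf (blob_pmf p K)"
    from size_count_bounds[OF blob_pmf_partition[OF this], of k]
    have "\<bar>count_deviation p k K P\<bar> \<le> real K"
      using q_bounds[OF p base(1)] mult_left_le_one_le[of "real K" "q p k"]
        mult_nonneg_nonneg[of "q p k" "real K"]
      unfolding count_deviation_def abs_le_iff by linarith
    from power_mono[OF this, of 2] have "(count_deviation p k K P)\<^sup>2 \<le> (real K)\<^sup>2"
      by simp
    also have "\<dots> \<le> 4 * real K * real K"
      by (simp add: power2_eq_square)
    finally show "(count_deviation p k K P)\<^sup>2 \<le> 4 * real K * real K" .
  qed
  then show ?case by simp
next
  case (Suc m)
  have m: "1 \<le> m" and km: "k \<le> m" using Suc by auto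
  let ?E = "\<lambda>k. measure_pmf.expectation (blob_pmf p m) (\<lambda>P. (count_deviation p k m P)\<^sup>2)"
  have "measure_pmf.expectation (blob_pmf p (Suc m)) (\<lambda>P. (count_deviation p k (Suc m) P)\<^sup>2)
     \<le> measure_pmf.expectation (blob_pmf p m) (\<lambda>P. (1 - p * real k / real m) * (count_deviation p k m P)\<^sup>2
      + p * real (k - 1) / real m * (count_deviation p (k - 1) m P)\<^sup>2 + 4)"
    unfolding expectation_blob_pmf_Suc[OF m less_imp_le[OF p(1)] less_imp_le[OF p(2)]]
    by (intro expectation_mono_finite finite_blob_pmf count_deviation_step blob_pmf_partition p m km Suc(3))
  also have "\<dots> = (1 - p * real k / real m) * ?E k + p * real (k - 1) / real m * ?E (k - 1) + 4"
    by (simp add: integrable_measure_pmf_finite finite_blob_pmf)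
  also have "\<dots> \<le> (1 - p * real k / real m) * (4 * real K * real m) + p * real (k - 1) / real m * (4 * real K * real m) + 4"
  proof (intro add_mono order_refl)
    have "p * real k \<le> 1 * real m" using p km by (intro mult_mono) auto
    then show "(1 - p * real k / real m) * ?E k \<le> (1 - p * real k / real m) * (4 * real K * real m)"
      using m Suc by (intro mult_left_mono) auto
    show "p * real (k - 1) / real m * ?E (k - 1) \<le> p * real (k - 1) / real m * (4 * real K * real m)"
    \<comment> \<open>Size 0 lies outside the induction hypothesis; its coefficient
      \<open>k - 1\<close> vanishes.\<close>
    proof (cases "k = 1")
      case False
      then show ?thesis using Suc p by (intro mult_left_mono Suc.IH) auto
    qed simp
  qed
  also have "\<dots> \<le> 4 * real K * real (Suc m)"
  proof -
    have "(1 - p * real k / real m) + p * real (k - 1) / real m \<le> 1"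
      using p m by (simp add: divide_right_mono)
    then have "((1 - p * real k / real m) + p * real (k - 1) / real m) * (4 * real K * real m) \<le> 1 * (4 * real K * real m)"
      by (intro mult_right_mono) auto
    moreover have "4 \<le> 4 * real K" using Suc by simp
    ultimately show ?thesis unfolding of_nat_Suc distrib_left distrib_right by linarith
  qed
  finally show ?case .
qed

lemma size_count_concentration:
  assumes p: "0 < p" "p < 1" and k: "1 \<le> k" "k \<le> n" and d: "0 < d"
  shows "measure_pmf.prob (blob_pmf p n) {P. d < \<bar>size_count k P / real n - q p k\<bar>} \<le> 4 * real k / (d\<^sup>2 * real n)"
proof -
  have n: "0 < real n" using k by simp
  have "measure_pmf.prob (blob_pmf p n) {P. d < \<bar>size_count k P / real n - q p k\<bar>} \<le>
    measure_pmf.expectation (blob_pmf p n) (\<lambda>P. (count_deviation p k n P)\<^sup>2) / (d * real n)\<^sup>2"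
  proof (rule prob_le_expectation_finite[OF finite_blob_pmf])
    fix P assume "P \<in> {P. d < \<bar>size_count k P / real n - q p k\<bar>}"
    then have "d < \<bar>count_deviation p k n P / real n\<bar>"
      using n by (simp add: count_deviation_def diff_divide_distrib)
    then have "d * real n \<le> \<bar>count_deviation p k n P\<bar>"
      using n by (simp add: field_simps)
    from power_mono[OF this, of 2] show "(d * real n)\<^sup>2 \<le> (count_deviation p k n P)\<^sup>2"
      using d n by simp
  qed (use d n in auto)
  also have "\<dots> \<le> 4 * real k * real n / (d * real n)\<^sup>2"
    using count_deviation_second_moment[OF p k(1) order_refl k(2)] by (intro divide_right_mono) auto
  also have "\<dots> = 4 * real k / (d\<^sup>2 * real n)" using n by (simp add: power2_eq_square)
  finally show ?thesis .
qed

text \<open>This weight is of order \<open>w\<^sup>-\<^sup>1\<^sup>/\<^sup>2\<close>. Unlike that power itself, it makes the expected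
  weight of a growing blob contract by an exact factor.\<close>

fun decay_weight :: "nat \<Rightarrow> real" where
  "decay_weight 0 = 1"
| "decay_weight (Suc 0) = 1"
| "decay_weight (Suc (Suc n)) = decay_weight (Suc n) * (1 - 1 / (2 * real (Suc n)))"

lemma decay_weight_Suc: "w \<ge> 1 \<Longrightarrow> decay_weight (Suc w) = decay_weight w * (1 - 1 / (2 * real w))"
  by (cases w) auto

lemma decay_weight_increment:
  "w \<ge> 1 \<Longrightarrow> real w * (decay_weight (Suc w) - decay_weight w) = - decay_weight w / 2"
  unfolding decay_weight_Suc by (simp add: algebra_simps)

lemma decay_weight_pos: "decay_weight w > 0"
proof (induction w rule: decay_weight.induct)
  case (3 n)
  have "1 / (2 * real (Suc n)) < 1" by simp
  with 3 show ?case by simp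
qed auto

lemma decay_weight_le_1: "decay_weight w \<le> 1"
proof (induction w rule: decay_weight.induct)
  case (3 n)
  have "decay_weight (Suc n) * (1 - 1 / (2 * real (Suc n))) \<le> 1 * 1"
    using 3 decay_weight_pos[of "Suc n"] by (intro mult_mono) auto
  then show ?case by simp
qed auto

lemma decay_weight_lower:
  assumes "w \<ge> 1"
  shows "1 / (4 * real w) \<le> (decay_weight w)\<^sup>2"
proof -
  \<comment> \<open>Shifted by one so that the base case is the equality
    \<open>1 / 4 = (1 / 2)\<^sup>2\<close>; the step rests on
    \<open>1 - 2 * t \<le> (1 - t)\<^sup>2\<close>.\<close>
  have "1 / (4 * real n) \<le> (decay_weight (Suc n))\<^sup>2" if "n \<ge> 1" for n
    using that
  proof (induction n rule: nat_induct_at_least)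
    case base
    then show ?case by (simp add: power2_eq_square)
  next
    case (Suc n)
    have n: "real n > 0" using Suc by simp
    have "1 / (4 * real (Suc n)) = 1 / (4 * real n) * (1 - 1 / real (Suc n))"
    proof -
      have "1 - 1 / real (Suc n) = real n / real (Suc n)" by (simp add: field_simps)
      then show ?thesis using n by simp
    qed
    also have "\<dots> \<le> (decay_weight (Suc n))\<^sup>2 * (1 - 1 / (2 * real (Suc n)))\<^sup>2"
    proof (intro mult_mono Suc)
      show "1 - 1 / real (Suc n) \<le> (1 - 1 / (2 * real (Suc n)))\<^sup>2"
      proof -
        have "1 - 2 * t \<le> (1 - t)\<^sup>2" for t :: real by (simp add: power2_diff)
        moreover have "1 / real (Suc n) = 2 * (1 / (2 * real (Suc n)))" by (simp add: field_simps)
        ultimately show ?thesis by metis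
      qed
    qed (use n in auto)
    also have "\<dots> = (decay_weight (Suc (Suc n)))\<^sup>2"
      by (simp add: power_mult_distrib)
    finally show ?case .
  qed
  note * = this
  show ?thesis
  proof (cases "w = 1")
    case False
    with assms obtain n where w: "w = Suc n" and n: "n \<ge> 1" by (cases w) auto
    have "1 / (4 * real (Suc n)) \<le> 1 / (4 * real n)"
      using n by (intro divide_left_mono) auto
    also have "\<dots> \<le> (decay_weight (Suc n))\<^sup>2" by (rule *[OF n])
    finally show ?thesis unfolding w .
  qed simp
qed

lemma blocks_containing:
  assumes "partition_on V P" "a \<in> V"
  shows "{B \<in> P. a \<in> B} = {block_at P a}"
proof (rule set_eqI)
  fix B
  show "B \<in> {B \<in> P. a \<in> B} \<longleftrightarrow> B \<in> {block_at P a}"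
    unfolding mem_Collect_eq singleton_iff
    using block_at_in[OF assms] block_at_eq[OF assms(1), of B a] by metis
qed

text \<open>The blob of \<open>a\<close> grows with probability proportional to its size, so by
  \<open>decay_weight_increment\<close> the expected weight is multiplied by
  \<open>1 - p / (2 * m)\<close> at each step. The product from \<open>a\<close> to \<open>n\<close>
  is at most \<open>(a / n) powr (p / 2)\<close>, the inverse square root of the typical size
  \<open>(n / a) powr p\<close>. Writing the weight as a sum over blocks makes it an additive
  functional.\<close>

lemma block_decay_expectation:
  assumes p: "0 < p" "p < 1" and a: "1 \<le> a" "a \<le> n"
  shows "measure_pmf.expectation (blob_pmf p n) (\<lambda>P. \<Sum>B\<in>P. if a \<in> B then decay_weight (card B) else 0)
    \<le> (real a / real n) powr (p / 2)"
  using a(2)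
proof (induction n rule: nat_induct_at_least)
  case base
  have "measure_pmf.expectation (blob_pmf p a) (\<lambda>P. \<Sum>B\<in>P. if a \<in> B then decay_weight (card B) else 0) \<le>
    measure_pmf.expectation (blob_pmf p a) (\<lambda>P. 1)"
  proof (rule expectation_mono_finite[OF finite_blob_pmf])
    fix P assume "P \<in> set_pmf (blob_pmf p a)"
    then have P: "partition_on {1..a} P" by (rule blob_pmf_partition)
    have "a \<in> {1..a}" using a by simp
    then have "{B \<in> P. a \<in> B} = {block_at P a}" by (rule blocks_containing[OF P])
    then have "(\<Sum>B\<in>P. if a \<in> B then decay_weight (card B) else 0) = decay_weight (card (block_at P a))"
      using partition_upto_facts(1)[OF P] by (simp add: sum.If_cases Int_def)
    then show "(\<Sum>B\<in>P. if a \<in> B then decay_weight (card B) else 0) \<le> 1"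
      using decay_weight_le_1 by simp
  qed
  then show ?case using a by simp
next
  case (Suc m)
  have m: "1 \<le> m" using Suc a by simp
  let ?\<phi> = "\<lambda>B. if a \<in> B then decay_weight (card B) else 0"
  have "measure_pmf.expectation (blob_pmf p m) (\<lambda>P. \<Sum>B\<in>P. ?\<phi> B + p / real m * (real (card B) * (?\<phi> (insert (Suc m) B) - ?\<phi> B)))
     = measure_pmf.expectation (blob_pmf p m) (\<lambda>P. (1 - p / (2 * real m)) * (\<Sum>B\<in>P. ?\<phi> B))"
  proof (rule expectation_cong_pmf)
    fix P assume "P \<in> set_pmf (blob_pmf p m)"
    then have P: "partition_on {1..m} P" by (rule blob_pmf_partition)
    show "(\<Sum>B\<in>P. ?\<phi> B + p / real m * (real (card B) * (?\<phi> (insert (Suc m) B) - ?\<phi> B))) =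
      (1 - p / (2 * real m)) * (\<Sum>B\<in>P. ?\<phi> B)"
      unfolding sum_distrib_left
    proof (rule sum.cong[OF refl])
      fix B assume B: "B \<in> P"
      note f = partition_upto_facts(2,3,6)[OF P B]
      show "?\<phi> B + p / real m * (real (card B) * (?\<phi> (insert (Suc m) B) - ?\<phi> B)) = (1 - p / (2 * real m)) * ?\<phi> B"
      proof (cases "a \<in> B")
        case True
        have "?\<phi> B + p / real m * (real (card B) * (?\<phi> (insert (Suc m) B) - ?\<phi> B)) =
          decay_weight (card B) + p / real m * (- decay_weight (card B) / 2)"
          using f True decay_weight_increment[OF f(3)] by simp
        then show ?thesis using True m by (simp add: field_simps)
      qed (use Suc in simp)
    qed
  qed
  then have "measure_pmf.expectation (blob_pmf p (Suc m)) (\<lambda>P. \<Sum>B\<in>P. ?\<phi> B) =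
     (1 - p / (2 * real m)) * measure_pmf.expectation (blob_pmf p m) (\<lambda>P. \<Sum>B\<in>P. ?\<phi> B)"
    using p m Suc a by (subst expectation_additive_Suc) auto
  also have "\<dots> \<le> (1 - p / (2 * real m)) * (real a / real m) powr (p / 2)"
    using Suc p m by (intro mult_left_mono) (auto simp: field_simps)
  also have "\<dots> \<le> (real m / real (Suc m)) powr (p / 2) * (real a / real m) powr (p / 2)"
  proof (rule mult_right_mono)
    have "1 - p / (2 * real m) \<le> exp (- (p / (2 * real m)))"
      using exp_ge_add_one_self[of "- (p / (2 * real m))"] by simp
    also have "\<dots> \<le> exp (p / 2 * ln (real m / real (Suc m)))"
    proof -
      have "ln (real (Suc m) / real m) \<le> real (Suc m) / real m - 1"
        using m by (intro ln_le_minus_one) simp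
      also have "\<dots> = 1 / real m" using m by (simp add: field_simps)
      finally have "p / 2 * ln (real (Suc m) / real m) \<le> p / 2 * (1 / real m)"
        using p by (intro mult_left_mono) auto
      then show ?thesis using m by (simp add: ln_div algebra_simps)
    qed
    also have "\<dots> = (real m / real (Suc m)) powr (p / 2)"
      using m by (simp add: powr_def)
    finally show "1 - p / (2 * real m) \<le> (real m / real (Suc m)) powr (p / 2)" .
  qed auto
  also have "\<dots> = (real a / real (Suc m)) powr (p / 2)"
    using m by (simp add: powr_mult[symmetric])
  finally show ?case .
qed

text \<open>Markov's inequality for the decaying weight, which is at least
  \<open>1 / (2 * sqrt w)\<close> at size \<open>w\<close>. The bound is uniform in \<open>n\<close>
  and vanishes with \<open>d\<close>, so the blob of a fixed vertex is not small at scale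
  \<open>n powr p\<close>.\<close>

lemma block_small_prob:
  assumes p: "0 < p" "p < 1" and a: "1 \<le> a" "a \<le> n" and d: "0 < d"
  shows "measure_pmf.prob (blob_pmf p n) {P. real (card (block_at P a)) \<le> d * real n powr p}
    \<le> 2 * sqrt d * real a powr (p / 2)"
proof -
  define x where "x = d * real n powr p"
  have n: "real n > 0" using a by simp
  have x: "x > 0" using d n by (simp add: x_def)
  have "measure_pmf.prob (blob_pmf p n) {P. real (card (block_at P a)) \<le> x} \<le>
    measure_pmf.expectation (blob_pmf p n) (\<lambda>P. \<Sum>B\<in>P. if a \<in> B then decay_weight (card B) else 0) / (1 / (2 * sqrt x))"
  proof (rule prob_le_expectation_finite[OF finite_blob_pmf])
    fix P assume "P \<in> set_pmf (blob_pmf p n)" and le: "P \<in> {P. real (card (block_at P a)) \<le> x}"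
    then have P: "partition_on {1..n} P" by (intro blob_pmf_partition)
    note b = block_at_in[OF P, of a]
    have w: "1 \<le> card (block_at P a)" using b a partition_upto_facts(6)[OF P] by simp
    have "(1 / (2 * sqrt x))\<^sup>2 \<le> 1 / (4 * real (card (block_at P a)))"
      using le w x by (simp add: power_divide power_mult_distrib field_simps)
    also have "\<dots> \<le> (decay_weight (card (block_at P a)))\<^sup>2"
      by (rule decay_weight_lower[OF w])
    finally have "1 / (2 * sqrt x) \<le> decay_weight (card (block_at P a))"
      using decay_weight_pos less_imp_le power2_le_imp_le by blast
    also have "\<dots> = (if a \<in> block_at P a then decay_weight (card (block_at P a)) else 0)"
      using b a by simp
    also have "\<dots> \<le> (\<Sum>B\<in>P. if a \<in> B then decay_weight (card B) else 0)"
      using b a partition_upto_facts(1)[OF P] decay_weight_pos less_imp_le by (intro member_le_sum) auto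
    finally show "1 / (2 * sqrt x) \<le> (\<Sum>B\<in>P. if a \<in> B then decay_weight (card B) else 0)" .
  qed (use x less_imp_le[OF decay_weight_pos] in \<open>auto intro!: sum_nonneg\<close>)
  also have "\<dots> \<le> (real a / real n) powr (p / 2) / (1 / (2 * sqrt x))"
    using block_decay_expectation[OF p a] x by (intro divide_right_mono) auto
  also have "\<dots> = 2 * sqrt d * (real a powr (p / 2) / real n powr (p / 2) * sqrt (real n powr p))"
    using n a by (simp add: x_def real_sqrt_mult powr_divide)
  also have "sqrt (real n powr p) = real n powr (p / 2)"
    using n by (simp add: powr_half_sqrt[symmetric] powr_powr)
  finally show ?thesis using n by (simp add: x_def)
qed

section \<open>Near ties between blobs\<close>

lemma block_at_insert_singleton:
  assumes P: "partition_on {1..m} P" and a: "a \<in> {1..m}"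
  shows "block_at (insert {Suc m} P) a = block_at P a"
proof -
  have "Suc m \<notin> {1..m}" by simp
  then have "partition_on (insert (Suc m) {1..m}) (insert {Suc m} P)"
    by (rule partition_on_insert_singleton[OF P])
  then show ?thesis
    by (rule block_at_eq) (use block_at_in[OF P a] in auto)
qed

lemma block_at_extend_block:
  assumes P: "partition_on {1..m} P" and a: "a \<in> {1..m}" and B: "B \<in> P"
  shows "block_at (extend_block (Suc m) P B) a =
    (if block_at P a = B then insert (Suc m) B else block_at P a)"
proof -
  have "Suc m \<notin> {1..m}" by simp
  then have "partition_on (insert (Suc m) {1..m}) (extend_block (Suc m) P B)"
    by (rule partition_on_extend_block[OF P _ B])
  then show ?thesis
    by (rule block_at_eq) (use block_at_in[OF P a] in \<open>auto simp: extend_block_def\<close>)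
qed

text \<open>The value 0 when \<open>a\<close> and \<open>b\<close> share a blob is consistent in
  time, since blobs never merge or split. The statistic therefore evolves autonomously through the
  two sizes.\<close>

definition pair_test :: "nat \<Rightarrow> nat \<Rightarrow> (nat \<Rightarrow> nat \<Rightarrow> real) \<Rightarrow> nat set set \<Rightarrow> real" where
  "pair_test a b h P = (if block_at P a = block_at P b then 0
     else h (card (block_at P a)) (card (block_at P b)))"

text \<open>The generator on functions of the two sizes: each of the two blobs grows with
  probability \<open>p\<close> times its share of the vertices, and any other move leaves both sizes
  unchanged.\<close>

lemma pair_step:
  assumes P: "partition_on {1..m} P" and a: "a \<in> {1..m}" and b: "b \<in> {1..m}"
  shows "(1 - p) * pair_test a b h (insert {Suc m} P) +
      p / real m * (\<Sum>B\<in>P. real (card B) * pair_test a b h (extend_block (Suc m) P B)) =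
    pair_test a b (\<lambda>j l. (1 - p * real (j + l) / real m) * h j l
      + p / real m * (real j * h (Suc j) l + real l * h j (Suc l))) P"
proof -
  let ?A = "block_at P a" and ?B = "block_at P b"
  note f = partition_upto_facts[OF P]
  note A = block_at_in(1)[OF P a] and B = block_at_in(1)[OF P b]
  have m: "0 < real m" using a by simp
  have ins: "pair_test a b h (insert {Suc m} P) = pair_test a b h P"
    by (simp add: pair_test_def block_at_insert_singleton[OF P a] block_at_insert_singleton[OF P b])
  show ?thesis
  proof (cases "?A = ?B")
    case True
    then have "pair_test a b h (extend_block (Suc m) P C) = 0" if "C \<in> P" for C
      using that by (simp add: pair_test_def block_at_extend_block[OF P a] block_at_extend_block[OF P b])
    then have 0: "(\<Sum>B\<in>P. real (card B) * pair_test a b h (extend_block (Suc m) P B)) = 0"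
      by (intro sum.neutral) simp
    show ?thesis unfolding ins 0 using True by (simp add: pair_test_def)
  next
    case False
    have neq: "insert (Suc m) C \<noteq> D" "D \<noteq> insert (Suc m) C" if "D \<in> P" for C D
      using f(3)[OF that] by auto
    have c: "card (insert (Suc m) C) = Suc (card C)" if "C \<in> P" for C
      using f(2,3)[OF that] by simp
    have B': "?B \<in> P - {?A}" using B False by auto
    have sizes: "(\<Sum>C\<in>P - {?A} - {?B}. real (card C)) = real m - real (card ?A) - real (card ?B)"
      using f(7) sum.remove[OF f(1) A, of "\<lambda>C. real (card C)"]
        sum.remove[OF _ B', of "\<lambda>C. real (card C)"] f(1) by simp
    have "(\<Sum>C\<in>P. real (card C) * pair_test a b h (extend_block (Suc m) P C)) =
       real (card ?A) * pair_test a b h (extend_block (Suc m) P ?A) +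
       (real (card ?B) * pair_test a b h (extend_block (Suc m) P ?B) +
        (\<Sum>C\<in>P - {?A} - {?B}. real (card C) * pair_test a b h (extend_block (Suc m) P C)))"
      using sum.remove[OF f(1) A, of "\<lambda>C. real (card C) * pair_test a b h (extend_block (Suc m) P C)"]
        sum.remove[OF _ B', of "\<lambda>C. real (card C) * pair_test a b h (extend_block (Suc m) P C)"] f(1) by simp
    also have "pair_test a b h (extend_block (Suc m) P ?A) = h (Suc (card ?A)) (card ?B)"
      using False A B neq c by (simp add: pair_test_def block_at_extend_block[OF P a] block_at_extend_block[OF P b])
    also have "pair_test a b h (extend_block (Suc m) P ?B) = h (card ?A) (Suc (card ?B))"
      using False A B neq c by (simp add: pair_test_def block_at_extend_block[OF P a] block_at_extend_block[OF P b])
    also have "(\<Sum>C\<in>P - {?A} - {?B}. real (card C) * pair_test a b h (extend_block (Suc m) P C)) =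
       (\<Sum>C\<in>P - {?A} - {?B}. real (card C) * h (card ?A) (card ?B))"
      using False by (intro sum.cong refl)
        (auto simp: pair_test_def block_at_extend_block[OF P a] block_at_extend_block[OF P b])
    also have "\<dots> = (real m - real (card ?A) - real (card ?B)) * h (card ?A) (card ?B)"
      unfolding sum_distrib_right[symmetric] sizes ..
    finally have sm: "(\<Sum>C\<in>P. real (card C) * pair_test a b h (extend_block (Suc m) P C)) =
       real (card ?A) * h (Suc (card ?A)) (card ?B) + (real (card ?B) * h (card ?A) (Suc (card ?B)) +
       (real m - real (card ?A) - real (card ?B)) * h (card ?A) (card ?B))" .
    show ?thesis
      unfolding ins sm using False m by (simp add: pair_test_def field_simps)
  qed
qed

lemma expectation_pair_Suc:
  assumes "1 \<le> a" "a \<le> m" "1 \<le> b" "b \<le> m" "0 \<le> p" "p \<le> 1"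
  shows "measure_pmf.expectation (blob_pmf p (Suc m)) (pair_test a b h) =
    measure_pmf.expectation (blob_pmf p m) (pair_test a b (\<lambda>j l. (1 - p * real (j + l) / real m) * h j l
      + p / real m * (real j * h (Suc j) l + real l * h j (Suc l))))"
proof -
  have m: "1 \<le> m" using assms by simp
  show ?thesis
    unfolding expectation_blob_pmf_Suc[OF m assms(5,6)]
    by (intro expectation_cong_pmf pair_step blob_pmf_partition) (use assms in auto)
qed

lemma separate_sizes_le:
  assumes P: "partition_on {1..m} P" and a: "a \<in> {1..m}" and b: "b \<in> {1..m}" and ne: "block_at P a \<noteq> block_at P b"
  shows "card (block_at P a) + card (block_at P b) \<le> m"
proof -
  have "real (card (block_at P a)) + real (card (block_at P b)) = (\<Sum>B\<in>{block_at P a, block_at P b}. real (card B))"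
    using ne by simp
  also have "\<dots> \<le> (\<Sum>B\<in>P. real (card B))"
    using block_at_in(1)[OF P a] block_at_in(1)[OF P b] partition_upto_facts(1)[OF P]
    by (intro sum_mono2) auto
  also have "\<dots> = real m" by (rule partition_upto_facts(7)[OF P])
  finally show ?thesis by linarith
qed

definition pair_prob :: "real \<Rightarrow> nat \<Rightarrow> nat \<Rightarrow> nat \<Rightarrow> nat \<Rightarrow> nat \<Rightarrow> real" where
  "pair_prob p a b n j l = measure_pmf.expectation (blob_pmf p n)
     (pair_test a b (\<lambda>x y. of_bool (x = j \<and> y = l)))"

definition pair_total :: "real \<Rightarrow> nat \<Rightarrow> nat \<Rightarrow> nat \<Rightarrow> nat \<Rightarrow> real" where
  "pair_total p a b n N = measure_pmf.expectation (blob_pmf p n)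
     (pair_test a b (\<lambda>x y. of_bool (x + y = N)))"

lemma pair_test_linear:
  "pair_test a b (\<lambda>x y. c1 * h1 x y + c2 * h2 x y + c3 * h3 x y) P =
   c1 * pair_test a b h1 P + c2 * pair_test a b h2 P + c3 * pair_test a b h3 P"
  by (simp add: pair_test_def)

lemma expectation_pair_test_linear:
  "measure_pmf.expectation (blob_pmf p n) (pair_test a b (\<lambda>x y. c1 * h1 x y + c2 * h2 x y + c3 * h3 x y)) =
   c1 * measure_pmf.expectation (blob_pmf p n) (pair_test a b h1)
   + c2 * measure_pmf.expectation (blob_pmf p n) (pair_test a b h2)
   + c3 * measure_pmf.expectation (blob_pmf p n) (pair_test a b h3)"
proof -
  have "pair_test a b (\<lambda>x y. c1 * h1 x y + c2 * h2 x y + c3 * h3 x y) =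
    (\<lambda>P. c1 * pair_test a b h1 P + c2 * pair_test a b h2 P + c3 * pair_test a b h3 P)"
    by (rule ext) (rule pair_test_linear)
  then show ?thesis by (simp add: integrable_measure_pmf_finite finite_blob_pmf)
qed

context
  fixes p :: real and a b :: nat
  assumes p: "0 \<le> p" "p \<le> 1" and ab: "1 \<le> a" "1 \<le> b"
begin

lemma pair_prob_Suc:
  assumes "a \<le> m" "b \<le> m" "1 \<le> j" "1 \<le> l"
  shows "pair_prob p a b (Suc m) j l = (1 - p * real (j + l) / real m) * pair_prob p a b m j l
    + p / real m * real (j - 1) * pair_prob p a b m (j - 1) l
    + p / real m * real (l - 1) * pair_prob p a b m j (l - 1)"
proof -
  have eq: "(\<lambda>x y. (1 - p * real (x + y) / real m) * of_bool (x = j \<and> y = l)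
      + p / real m * (real x * of_bool (Suc x = j \<and> y = l) + real y * of_bool (x = j \<and> Suc y = l))) =
     (\<lambda>x y. (1 - p * real (j + l) / real m) * of_bool (x = j \<and> y = l)
      + (p / real m * real (j - 1)) * of_bool (x = j - 1 \<and> y = l)
      + (p / real m * real (l - 1)) * of_bool (x = j \<and> y = l - 1))"
  proof (intro ext)
    fix x y
    have 1: "(Suc x = j \<and> y = l) = (x = j - 1 \<and> y = l)" "(x = j \<and> Suc y = l) = (x = j \<and> y = l - 1)"
      using assms by auto
    show "(1 - p * real (x + y) / real m) * of_bool (x = j \<and> y = l)
      + p / real m * (real x * of_bool (Suc x = j \<and> y = l) + real y * of_bool (x = j \<and> Suc y = l)) =
     (1 - p * real (j + l) / real m) * of_bool (x = j \<and> y = l)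
      + (p / real m * real (j - 1)) * of_bool (x = j - 1 \<and> y = l)
      + (p / real m * real (l - 1)) * of_bool (x = j \<and> y = l - 1)"
      unfolding 1 by (simp add: of_bool_def distrib_left)
  qed
  show ?thesis
    unfolding pair_prob_def
      expectation_pair_Suc[OF ab(1) assms(1) ab(2) assms(2) p] eq expectation_pair_test_linear ..
qed

lemma pair_total_Suc:
  assumes "a \<le> m" "b \<le> m" "1 \<le> N"
  shows "pair_total p a b (Suc m) N = (1 - p * real N / real m) * pair_total p a b m N
    + p / real m * real (N - 1) * pair_total p a b m (N - 1)"
proof -
  have eq: "(\<lambda>x y. (1 - p * real (x + y) / real m) * of_bool (x + y = N)
      + p / real m * (real x * of_bool (Suc x + y = N) + real y * of_bool (x + Suc y = N))) =
     (\<lambda>x y. (1 - p * real N / real m) * of_bool (x + y = N)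
      + (p / real m * real (N - 1)) * of_bool (x + y = N - 1) + 0 * of_bool (x + y = N))"
  proof (intro ext)
    fix x y
    have 1: "(Suc x + y = N) = (x + y = N - 1)" "(x + Suc y = N) = (x + y = N - 1)"
      using assms by auto
    have "p / real m * (real x * of_bool (x + y = N - 1) + real y * of_bool (x + y = N - 1))
      = (p / real m * real (x + y)) * of_bool (x + y = N - 1)"
      by (simp add: distrib_left of_bool_def)
    also have "\<dots> = (p / real m * real (N - 1)) * of_bool (x + y = N - 1)"
      by (cases "x + y = N - 1") simp_all
    finally have 2: "p / real m * (real x * of_bool (x + y = N - 1) + real y * of_bool (x + y = N - 1)) = \<dots>" .
    have 3: "(1 - p * real (x + y) / real m) * of_bool (x + y = N) = (1 - p * real N / real m) * of_bool (x + y = N)"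
      by (cases "x + y = N") simp_all
    show "(1 - p * real (x + y) / real m) * of_bool (x + y = N)
      + p / real m * (real x * of_bool (Suc x + y = N) + real y * of_bool (x + Suc y = N)) =
     (1 - p * real N / real m) * of_bool (x + y = N)
      + (p / real m * real (N - 1)) * of_bool (x + y = N - 1) + 0 * of_bool (x + y = N)"
      unfolding 1 2 3 by simp
  qed
  show ?thesis
    unfolding pair_total_def
      expectation_pair_Suc[OF ab(1) assms(1) ab(2) assms(2) p] eq expectation_pair_test_linear by simp
qed

lemma pair_prob_nonneg: "0 \<le> pair_prob p a b n j l" "0 \<le> pair_total p a b n N"
  unfolding pair_prob_def pair_total_def
  by (auto intro!: integral_nonneg_AE simp: pair_test_def AE_measure_pmf_iff)

text \<open>Given the total size \<open>N\<close> of two blobs, their sizes perform a Polya urn, whose law is spread out at scale \<open>1 / N\<close>.\<close>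

lemma pair_prob_flat:
  assumes "max a b \<le> n" "1 \<le> j" "1 \<le> l"
  shows "pair_prob p a b n j l * real (j + l - 1) \<le> real (max a b) * pair_total p a b n (j + l)"
  using assms
proof (induction n arbitrary: j l rule: nat_induct_at_least)
  case base
  have "pair_prob p a b (max a b) j l * real (j + l - 1) =
    measure_pmf.expectation (blob_pmf p (max a b)) (\<lambda>P. pair_test a b (\<lambda>x y. of_bool (x = j \<and> y = l)) P * real (j + l - 1))"
    by (simp add: pair_prob_def)
  also have "\<dots> \<le> measure_pmf.expectation (blob_pmf p (max a b)) (\<lambda>P. real (max a b) * pair_test a b (\<lambda>x y. of_bool (x + y = j + l)) P)"
  proof (rule expectation_mono_finite[OF finite_blob_pmf])
    fix P assume "P \<in> set_pmf (blob_pmf p (max a b))"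
    then have P: "partition_on {1..max a b} P" by (rule blob_pmf_partition)
    show "pair_test a b (\<lambda>x y. of_bool (x = j \<and> y = l)) P * real (j + l - 1)
      \<le> real (max a b) * pair_test a b (\<lambda>x y. of_bool (x + y = j + l)) P"
    proof (cases "block_at P a \<noteq> block_at P b \<and> card (block_at P a) = j \<and> card (block_at P b) = l")
      case True
      \<comment> \<open>Two distinct blobs at this time have at most \<open>max a b\<close> vertices
        together; this is the source of the constant.\<close>
      then have "j + l \<le> max a b"
        using separate_sizes_le[OF P, of a b] ab by auto
      then have "real (j + l - 1) \<le> real (max a b)" by linarith
      then show ?thesis using True by (simp add: pair_test_def)
    qed (auto simp: pair_test_def)
  qed
  also have "\<dots> = real (max a b) * pair_total p a b (max a b) (j + l)"
    by (simp add: pair_total_def)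
  finally show ?case .
next
  case (Suc m)
  define C where "C = real (max a b)"
  define N where "N = j + l"
  have m: "a \<le> m" "b \<le> m" "0 < real m" using Suc ab by auto
  have N: "2 \<le> N" "real (N - 1) = real N - 1" using Suc by (auto simp: N_def)
  have C: "0 \<le> C" by (simp add: C_def)
  let ?p = "pair_prob p a b m" and ?F = "pair_total p a b m"
  \<comment> \<open>For \<open>N > m\<close> the factor \<open>1 - p * N / m\<close> may be
    negative, but then both sides vanish, as two disjoint blobs cannot have more than
    \<open>m\<close> vertices.\<close>
  have main: "(1 - p * real N / real m) * ?p j l * real (N - 1) \<le> (1 - p * real N / real m) * (C * ?F N)"
  proof (cases "N \<le> m")
    case True
    then have "p * real N \<le> 1 * real m" using p by (intro mult_mono) auto
    then have "0 \<le> 1 - p * real N / real m" using m by simp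
    from mult_left_mono[OF _ this, of "?p j l * real (N - 1)" "C * ?F N"]
    show ?thesis using Suc.IH[OF Suc.prems] by (simp add: C_def N_def mult.assoc)
  next
    case False
    have "?p j l = measure_pmf.expectation (blob_pmf p m) (\<lambda>_. 0)" "?F N = measure_pmf.expectation (blob_pmf p m) (\<lambda>_. 0)"
      unfolding pair_prob_def pair_total_def
      using separate_sizes_le[OF blob_pmf_partition, of _ p m a b] m ab False
      by (intro expectation_cong_pmf; fastforce simp: pair_test_def N_def)+
    then show ?thesis by simp
  qed
  \<comment> \<open>\<open>R\<close> collects the inflow from \<open>(j - 1, l)\<close> and
    \<open>(j, l - 1)\<close>. Its weights add up to \<open>N - 2\<close>, exactly the factor
    carried by the induction hypothesis, so flatness is inherited. For \<open>N = 2\<close> both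
    weights are 0.\<close>
  define R where "R = real (j - 1) * ?p (j - 1) l + real (l - 1) * ?p j (l - 1)"
  have R: "R \<le> C * ?F (N - 1)"
  proof (cases "N = 2")
    case True
    then have "R = 0" using Suc.prems by (simp add: R_def N_def)
    then show ?thesis using C pair_prob_nonneg by simp
  next
    case False
    have 1: "real (j - 1) * (?p (j - 1) l * real (N - 2)) \<le> real (j - 1) * (C * ?F (N - 1))"
    proof (cases "j = 1")
      case jf: False
      then have "1 \<le> j - 1" and e: "j - 1 + l = N - 1" "N - 1 - 1 = N - 2" using Suc.prems by (auto simp: N_def)
      from Suc.IH[OF this(1) Suc.prems(2)] show ?thesis
        unfolding e C_def by (intro mult_left_mono) auto
    qed simp
    have 2: "real (l - 1) * (?p j (l - 1) * real (N - 2)) \<le> real (l - 1) * (C * ?F (N - 1))"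
    proof (cases "l = 1")
      case lf: False
      then have "1 \<le> l - 1" and e: "j + (l - 1) = N - 1" "N - 1 - 1 = N - 2" using Suc.prems by (auto simp: N_def)
      from Suc.IH[OF Suc.prems(1) this(1)] show ?thesis
        unfolding e C_def by (intro mult_left_mono) auto
    qed simp
    have "R * real (N - 2) = real (j - 1) * (?p (j - 1) l * real (N - 2)) + real (l - 1) * (?p j (l - 1) * real (N - 2))"
      by (simp add: R_def distrib_right)
    also have "\<dots> \<le> real (j - 1) * (C * ?F (N - 1)) + real (l - 1) * (C * ?F (N - 1))"
      using 1 2 by linarith
    also have "\<dots> = (C * ?F (N - 1)) * real (N - 2)"
    proof -
      have "real (j - 1) + real (l - 1) = real (N - 2)" using Suc.prems by (simp add: N_def)
      then show ?thesis by (metis distrib_right mult.commute)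
    qed
    finally show ?thesis using False N by simp
  qed
  have "pair_prob p a b (Suc m) j l * real (N - 1) =
    (1 - p * real N / real m) * ?p j l * real (N - 1) + p / real m * (real (N - 1) * R)"
    unfolding pair_prob_Suc[OF m(1,2) Suc.prems] R_def N_def by (simp add: algebra_simps)
  also have "\<dots> \<le> (1 - p * real N / real m) * (C * ?F N) + p / real m * (real (N - 1) * (C * ?F (N - 1)))"
    using R p m by (intro add_mono main mult_left_mono) auto
  also have "\<dots> = C * pair_total p a b (Suc m) N"
    using N by (subst pair_total_Suc[OF m(1,2)]) (auto simp: algebra_simps add_divide_distrib diff_divide_distrib)
  finally show ?case by (simp add: C_def N_def)
qed

text \<open>For a given total \<open>N\<close> at most \<open>z + 1\<close> splits are within
  \<open>z\<close> of a tie, and by flatness each carries at most the fraction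
  \<open>max a b / (N - 1)\<close> of the mass of \<open>N\<close>. Summing over the totals from
  \<open>y\<close> on gives the bound.\<close>

lemma near_tie_expectation:
  assumes n: "max a b \<le> n" and y: "1 < y" and z: "0 \<le> z"
  shows "measure_pmf.expectation (blob_pmf p n)
     (pair_test a b (\<lambda>j l. of_bool (y \<le> real j + real l \<and> \<bar>real j - real l\<bar> \<le> z)))
    \<le> real (max a b) * (z + 1) / (y - 1)"
proof -
  define Ns where "Ns = {N. N \<le> n \<and> y \<le> real N}"
  define J where "J N = {j. 1 \<le> j \<and> j < N \<and> \<bar>2 * real j - real N\<bar> \<le> z}" for N :: nat
  have fin: "finite Ns" "finite (J N)" for N by (auto simp: Ns_def J_def)
  have cardJ: "real (card (J N)) \<le> z + 1" for N
  proof (cases "J N = {}")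
    case False
    have "J N \<subseteq> {Min (J N)..Min (J N) + nat \<lfloor>z\<rfloor>}"
    proof
      fix j assume j: "j \<in> J N"
      have mn: "Min (J N) \<in> J N" "Min (J N) \<le> j" using fin(2) False j by auto
      have "real j - real (Min (J N)) \<le> z" using j mn(1) by (auto simp: J_def)
      then have "real (j - Min (J N)) \<le> z" using mn(2) by simp
      then have "j - Min (J N) \<le> nat \<lfloor>z\<rfloor>" by (simp add: le_nat_floor)
      then show "j \<in> {Min (J N)..Min (J N) + nat \<lfloor>z\<rfloor>}" using mn by auto
    qed
    then have "card (J N) \<le> card {Min (J N)..Min (J N) + nat \<lfloor>z\<rfloor>}" by (rule card_mono[rotated]) simp
    then have "real (card (J N)) \<le> real (nat \<lfloor>z\<rfloor>) + 1" by simp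
    also have "real (nat \<lfloor>z\<rfloor>) \<le> z" using z by simp
    finally show ?thesis by simp
  qed (use z in simp)
  have "measure_pmf.expectation (blob_pmf p n)
     (pair_test a b (\<lambda>j l. of_bool (y \<le> real j + real l \<and> \<bar>real j - real l\<bar> \<le> z))) \<le>
    measure_pmf.expectation (blob_pmf p n)
     (\<lambda>P. \<Sum>N\<in>Ns. \<Sum>j\<in>J N. pair_test a b (\<lambda>x y. of_bool (x = j \<and> y = N - j)) P)"
  proof (rule expectation_mono_finite[OF finite_blob_pmf])
    fix P assume "P \<in> set_pmf (blob_pmf p n)"
    then have P: "partition_on {1..n} P" by (rule blob_pmf_partition)
    let ?j = "card (block_at P a)" and ?l = "card (block_at P b)"
    let ?S = "\<Sum>N\<in>Ns. \<Sum>j\<in>J N. pair_test a b (\<lambda>x y. of_bool (x = j \<and> y = N - j)) P"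
    have nonneg: "0 \<le> pair_test a b (\<lambda>x y. of_bool (Q x y)) P" for Q by (simp add: pair_test_def)
    show "pair_test a b (\<lambda>j l. of_bool (y \<le> real j + real l \<and> \<bar>real j - real l\<bar> \<le> z)) P \<le> ?S"
    proof (cases "block_at P a \<noteq> block_at P b \<and> y \<le> real ?j + real ?l \<and> \<bar>real ?j - real ?l\<bar> \<le> z")
      case True
      have pos: "1 \<le> ?j" "1 \<le> ?l"
        using partition_upto_facts(6)[OF P] block_at_in(1)[OF P] ab n by auto
      have "?j + ?l \<in> Ns" using True separate_sizes_le[OF P, of a b] ab n by (auto simp: Ns_def)
      moreover have "?j \<in> J (?j + ?l)" using True pos by (auto simp: J_def)
      moreover from this have "pair_test a b (\<lambda>x y. of_bool (x = ?j \<and> y = (?j + ?l) - ?j)) P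
          \<le> (\<Sum>j\<in>J (?j + ?l). pair_test a b (\<lambda>x y. of_bool (x = j \<and> y = (?j + ?l) - j)) P)"
        by (rule member_le_sum) (auto intro: nonneg fin)
      moreover have "\<dots> \<le> ?S"
        using calculation(1)
        by (intro member_le_sum[of "?j + ?l" Ns "\<lambda>N. \<Sum>j\<in>J N. pair_test a b (\<lambda>x y. of_bool (x = j \<and> y = N - j)) P"])
           (auto intro!: sum_nonneg nonneg fin)
      ultimately have "pair_test a b (\<lambda>x y. of_bool (x = ?j \<and> y = (?j + ?l) - ?j)) P \<le> ?S"
        by (meson order_trans)
      then show ?thesis using True by (simp add: pair_test_def)
    next
      case False
      then have "pair_test a b (\<lambda>j l. of_bool (y \<le> real j + real l \<and> \<bar>real j - real l\<bar> \<le> z)) P = 0"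
        by (auto simp: pair_test_def)
      then show ?thesis by (simp add: sum_nonneg nonneg)
    qed
  qed
  also have "\<dots> = (\<Sum>N\<in>Ns. \<Sum>j\<in>J N. pair_prob p a b n j (N - j))"
    unfolding pair_prob_def by (simp add: integrable_measure_pmf_finite finite_blob_pmf)
  also have "\<dots> \<le> (\<Sum>N\<in>Ns. \<Sum>j\<in>J N. real (max a b) * pair_total p a b n N / (y - 1))"
  proof (intro sum_mono)
    fix N j assume N: "N \<in> Ns" and j: "j \<in> J N"
    have 1: "pair_prob p a b n j (N - j) * real (N - 1) \<le> real (max a b) * pair_total p a b n N"
      using pair_prob_flat[OF n, of j "N - j"] j by (auto simp: J_def)
    have "y - 1 \<le> real (N - 1)" using N y by (auto simp: Ns_def)
    then have "pair_prob p a b n j (N - j) * (y - 1) \<le> pair_prob p a b n j (N - j) * real (N - 1)"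
      by (intro mult_left_mono pair_prob_nonneg)
    with 1 show "pair_prob p a b n j (N - j) \<le> real (max a b) * pair_total p a b n N / (y - 1)"
      using y by (simp add: pos_le_divide_eq)
  qed
  also have "\<dots> \<le> (\<Sum>N\<in>Ns. (z + 1) * (real (max a b) * pair_total p a b n N / (y - 1)))"
    unfolding sum_constant using cardJ pair_prob_nonneg(2) y
    by (intro sum_mono mult_right_mono) auto
  also have "\<dots> = real (max a b) * (z + 1) / (y - 1) * (\<Sum>N\<in>Ns. pair_total p a b n N)"
    unfolding sum_distrib_left by (intro sum.cong refl) simp
  also have "\<dots> \<le> real (max a b) * (z + 1) / (y - 1) * 1"
  proof (rule mult_left_mono)
    have "(\<Sum>N\<in>Ns. pair_total p a b n N) = measure_pmf.expectation (blob_pmf p n)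
      (\<lambda>P. \<Sum>N\<in>Ns. pair_test a b (\<lambda>x y. of_bool (x + y = N)) P)"
      unfolding pair_total_def by (simp add: integrable_measure_pmf_finite finite_blob_pmf)
    also have "\<dots> \<le> measure_pmf.expectation (blob_pmf p n) (\<lambda>_. 1)"
    proof (rule expectation_mono_finite[OF finite_blob_pmf])
      fix P
      have "(\<Sum>N\<in>Ns. of_bool (x = N) :: real) \<le> 1" for x
        using fin(1) by (simp add: of_bool_def sum.delta')
      then show "(\<Sum>N\<in>Ns. pair_test a b (\<lambda>x y. of_bool (x + y = N)) P) \<le> 1"
        by (cases "block_at P a = block_at P b") (simp_all add: pair_test_def)
    qed
    finally show "(\<Sum>N\<in>Ns. pair_total p a b n N) \<le> 1" by simp
  qed (use y z in auto)
  finally show ?thesis by simp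
qed

end

section \<open>Blobs meeting the first vertices\<close>

definition early_blocks :: "nat \<Rightarrow> nat set set \<Rightarrow> nat set set" where
  "early_blocks k P = {B \<in> P. B \<inter> {1..k} \<noteq> {}}"

lemma card_early_blocks_step:
  assumes P: "partition_on {1..m} P" and k: "k \<le> m"
  shows "card (early_blocks k (insert {Suc m} P)) = card (early_blocks k P)"
    and "B \<in> P \<Longrightarrow> card (early_blocks k (extend_block (Suc m) P B)) = card (early_blocks k P)"
proof -
  note f = partition_upto_facts[OF P]
  have "early_blocks k (insert {Suc m} P) = early_blocks k P"
    using k by (auto simp: early_blocks_def)
  then show "card (early_blocks k (insert {Suc m} P)) = card (early_blocks k P)" by simp
  assume B: "B \<in> P"
  have *: "insert (Suc m) B \<inter> {1..k} = B \<inter> {1..k}" using k by auto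
  have fin: "finite (early_blocks k P)" using f(1) by (simp add: early_blocks_def)
  show "card (early_blocks k (extend_block (Suc m) P B)) = card (early_blocks k P)"
  proof (cases "B \<inter> {1..k} = {}")
    case True
    then have "early_blocks k (extend_block (Suc m) P B) = early_blocks k P"
      using * by (auto simp: early_blocks_def extend_block_def)
    then show ?thesis by simp
  next
    case False
    then have "early_blocks k (extend_block (Suc m) P B) = insert (insert (Suc m) B) (early_blocks k P - {B})"
      using * by (auto simp: early_blocks_def extend_block_def)
    moreover have "B \<in> early_blocks k P" using False B by (simp add: early_blocks_def)
    moreover have "insert (Suc m) B \<notin> early_blocks k P - {B}" using f(9) by (simp add: early_blocks_def)
    ultimately show ?thesis using fin card_Suc_Diff1[of "early_blocks k P" B] by simp
  qed
qed

text \<open>After time \<open>k\<close> no blobs merge and every new blob avoids the first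
  \<open>k\<close> vertices, so the number of early blobs is frozen at its value at time
  \<open>k\<close>.\<close>

lemma expectation_early_blocks:
  assumes "1 \<le> k" "k \<le> n" "0 \<le> p" "p \<le> 1"
  shows "measure_pmf.expectation (blob_pmf p n) (\<lambda>P. g (card (early_blocks k P)) :: real) =
    measure_pmf.expectation (blob_pmf p k) (\<lambda>P. g (card P))"
  using assms(2)
proof (induction n rule: nat_induct_at_least)
  case base
  show ?case
  proof (rule expectation_cong_pmf)
    fix P assume "P \<in> set_pmf (blob_pmf p k)"
    then have P: "partition_on {1..k} P" by (rule blob_pmf_partition)
    have "early_blocks k P = P"
      using partition_upto_facts(4,5)[OF P] unfolding early_blocks_def by blast
    then show "g (card (early_blocks k P)) = g (card P)" by simp
  qed
next
  case (Suc m)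
  have m: "1 \<le> m" using Suc assms by simp
  have "measure_pmf.expectation (blob_pmf p (Suc m)) (\<lambda>P. g (card (early_blocks k P))) =
    measure_pmf.expectation (blob_pmf p m) (\<lambda>P. g (card (early_blocks k P)))"
    unfolding expectation_blob_pmf_Suc[OF m assms(3,4)]
  proof (rule expectation_cong_pmf)
    fix P assume "P \<in> set_pmf (blob_pmf p m)"
    then have P: "partition_on {1..m} P" by (rule blob_pmf_partition)
    have "(\<Sum>B\<in>P. real (card B) * g (card (early_blocks k (extend_block (Suc m) P B)))) =
      (\<Sum>B\<in>P. real (card B) * g (card (early_blocks k P)))"
      by (intro sum.cong refl) (simp add: card_early_blocks_step[OF P Suc(1)])
    also have "\<dots> = real m * g (card (early_blocks k P))"
      unfolding sum_distrib_right[symmetric] partition_upto_facts(7)[OF P] ..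
    finally show "(1 - p) * g (card (early_blocks k (insert {Suc m} P))) + p / real m *
       (\<Sum>B\<in>P. real (card B) * g (card (early_blocks k (extend_block (Suc m) P B)))) = g (card (early_blocks k P))"
      using m by (simp add: card_early_blocks_step[OF P Suc(1)] algebra_simps)
  qed
  then show ?case using Suc by simp
qed

text \<open>The number of early blobs equals the number of all blobs at time \<open>k\<close>. This
  is at least the number of singletons, which is close to \<open>q p 1 * k\<close> with high
  probability; \<open>d\<close> is half that density.\<close>

lemma many_early_blocks:
  assumes p: "0 < p" "p < 1" and e: "0 < e"
  shows "\<exists>k\<ge>1. \<forall>n\<ge>k. measure_pmf.prob (blob_pmf p n) {P. card (early_blocks k P) < K} \<le> e"
proof -
  define d where "d = q p 1 / 2"
  have d: "0 < d" using q_bounds(1)[OF p, of 1] by (simp add: d_def)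
  obtain k1 where k1: "real K / d \<le> real k1" using real_arch_simple by blast
  obtain k2 where k2: "4 / (d\<^sup>2 * e) \<le> real k2" using real_arch_simple by blast
  define k where "k = max 1 (max k1 k2)"
  have k: "1 \<le> k" "real K / d \<le> real k" "4 / (d\<^sup>2 * e) \<le> real k"
    using k1 k2 by (auto simp: k_def)
  have k': "real K \<le> d * real k" using k(2) d by (simp add: pos_divide_le_eq mult.commute)
  have "measure_pmf.prob (blob_pmf p n) {P. card (early_blocks k P) < K} \<le> e" if n: "k \<le> n" for n
  proof -
    have "measure_pmf.prob (blob_pmf p n) {P. card (early_blocks k P) < K} =
      measure_pmf.expectation (blob_pmf p n) (\<lambda>P. of_bool (card (early_blocks k P) < K))"
    proof -
      have "measure_pmf.prob (blob_pmf p n) {P. card (early_blocks k P) < K} =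
        measure_pmf.expectation (blob_pmf p n) (indicator {P. card (early_blocks k P) < K})" by simp
      also have "\<dots> = measure_pmf.expectation (blob_pmf p n) (\<lambda>P. of_bool (card (early_blocks k P) < K))"
        by (rule expectation_cong_pmf) (simp add: indicator_def)
      finally show ?thesis .
    qed
    also have "\<dots> = measure_pmf.expectation (blob_pmf p k) (\<lambda>P. of_bool (card P < K))"
      using expectation_early_blocks[OF k(1) n, of p "\<lambda>c. of_bool (c < K)"] p by simp
    also have "\<dots> \<le> measure_pmf.expectation (blob_pmf p k) (indicator {P. d < \<bar>size_count 1 P / real k - q p 1\<bar>})"
    proof (rule expectation_mono_finite[OF finite_blob_pmf])
      fix P assume "P \<in> set_pmf (blob_pmf p k)"
      then have P: "partition_on {1..k} P" by (rule blob_pmf_partition)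
      note fin = partition_upto_facts(1)[OF P]
      have "size_count 1 P \<le> real (card P)"
        unfolding size_count_eq_card[OF fin] using fin by (simp add: card_mono)
      then have "size_count 1 P / real k < d" if "card P < K"
        using that k' k(1) by (simp add: pos_divide_less_eq)
      moreover have "d < \<bar>x - q p 1\<bar>" if "x < d" for x
        using that unfolding d_def by linarith
      ultimately show "of_bool (card P < K) \<le> (indicator {P. d < \<bar>size_count 1 P / real k - q p 1\<bar>} P :: real)"
        by (auto simp: indicator_def)
    qed
    also have "\<dots> = measure_pmf.prob (blob_pmf p k) {P. d < \<bar>size_count 1 P / real k - q p 1\<bar>}" by simp
    also have "\<dots> \<le> 4 * real 1 / (d\<^sup>2 * real k)"
      by (rule size_count_concentration[OF p _ k(1) d]) simp
    also have "\<dots> \<le> e" using k d e by (simp add: field_simps)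
    finally show ?thesis .
  qed
  then show ?thesis using k(1) by blast
qed

section \<open>Exploring the shortcuts from a union of blobs\<close>

text \<open>The closure of \<open>A\<close> under the edges of \<open>S\<close>, where hitting one
  vertex of a block in \<open>BB\<close> adds the whole block: connections inside blobs are taken
  for granted and only shortcuts are explored.\<close>

inductive_set reach :: "nat set set \<Rightarrow> nat set set \<Rightarrow> nat set \<Rightarrow> nat set"
  for BB S A where
  base: "a \<in> A \<Longrightarrow> a \<in> reach BB S A"
| step: "x \<in> reach BB S A \<Longrightarrow> {x, y} \<in> S \<Longrightarrow> y \<in> B \<Longrightarrow> B \<in> BB \<Longrightarrow> z \<in> B \<Longrightarrow> z \<in> reach BB S A"

text \<open>The state of an exploration: \<open>A\<close> has been absorbed, the blocks in
  \<open>BB\<close> are fresh.\<close>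

definition block_family :: "nat set \<Rightarrow> nat set set \<Rightarrow> bool" where
  "block_family A BB \<longleftrightarrow> finite A \<and> finite BB \<and> (\<forall>B\<in>BB. finite B \<and> B \<inter> A = {}) \<and>
     (\<forall>B\<in>BB. \<forall>C\<in>BB. B \<noteq> C \<longrightarrow> B \<inter> C = {})"

definition crossing :: "nat set \<Rightarrow> nat set \<Rightarrow> nat set \<Rightarrow> bool" where
  "crossing e A B \<longleftrightarrow> (\<exists>a\<in>A. \<exists>b\<in>B. e = {a, b})"

text \<open>With \<open>E\<close> the set of pairs not yet revealed, this counts the remaining
  chances to reach \<open>B\<close> from \<open>A\<close>.\<close>

definition cross_count :: "nat set set \<Rightarrow> nat set \<Rightarrow> nat set \<Rightarrow> real" where
  "cross_count E A B = real (card {e \<in> E. crossing e A B})"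

lemma block_family_disjoint:
  assumes "block_family A BB" "B \<in> BB"
  shows "A \<inter> B = {}" and "C \<in> BB \<Longrightarrow> B \<noteq> C \<Longrightarrow> B \<inter> C = {}"
  using assms unfolding block_family_def by (blast, blast)

lemma block_family_merge:
  assumes "block_family A BB" "B \<in> BB"
  shows "block_family (A \<union> B) (BB - {B})"
  using assms unfolding block_family_def by (simp add: Int_Un_distrib)

lemma block_family_card_merge:
  assumes "block_family A BB" "B \<in> BB"
  shows "card (A \<union> B) = card A + card B"
  using assms unfolding block_family_def by (intro card_Un_disjoint) auto

lemma reach_superset: "A \<subseteq> reach BB S A"
  by (auto intro: reach.base)

lemma reach_subset: "reach BB S A \<subseteq> A \<union> \<Union>BB"
proof
  fix x assume "x \<in> reach BB S A"
  then show "x \<in> A \<union> \<Union>BB" by induction auto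
qed

lemma finite_reach: "block_family A BB \<Longrightarrow> finite (reach BB S A)"
  by (rule finite_subset[OF reach_subset]) (auto simp: block_family_def)

lemma reach_mono:
  assumes "BB \<subseteq> CC"
  shows "reach BB S A \<subseteq> reach CC S A"
proof
  fix x assume "x \<in> reach BB S A"
  then show "x \<in> reach CC S A"
    by induction (use assms in \<open>auto intro: reach.intros\<close>)
qed

lemma reach_no_crossing:
  assumes "\<And>e B. e \<in> S \<Longrightarrow> B \<in> BB \<Longrightarrow> \<not> crossing e A B"
  shows "reach BB S A = A"
proof
  show "reach BB S A \<subseteq> A"
  proof
    fix x assume "x \<in> reach BB S A"
    then show "x \<in> A" by induction (use assms in \<open>auto simp: crossing_def\<close>)
  qed
qed (rule reach_superset)

text \<open>Contraction: once an edge between \<open>A\<close> and \<open>B\<close> is known to be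
  present, the exploration continues from the merged set. The edge touches no other fresh block, so
  it can be forgotten.\<close>

lemma reach_crossing:
  assumes bf: "block_family A BB" and B: "B \<in> BB" and e: "crossing e A B" and eS: "e \<notin> S"
  shows "reach BB (insert e S) A = reach (BB - {B}) S (A \<union> B)"
proof
  obtain a b where ab: "a \<in> A" "b \<in> B" "e = {a, b}" using e by (auto simp: crossing_def)
  show "reach BB (insert e S) A \<subseteq> reach (BB - {B}) S (A \<union> B)"
  proof
    fix x assume "x \<in> reach BB (insert e S) A"
    then show "x \<in> reach (BB - {B}) S (A \<union> B)"
    proof induction
      case (step x y C z)
      show ?case
      proof (cases "C = B")
        case False
        have "a \<notin> C" "b \<notin> C" using bf ab B step False by (auto simp: block_family_def)
        then have "{x, y} \<noteq> e" using step ab by auto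
        then have "{x, y} \<in> S" using step by auto
        then show ?thesis using step False by (auto intro: reach.step)
      qed (use step in \<open>auto intro: reach.base\<close>)
    qed (auto intro: reach.base)
  qed
  show "reach (BB - {B}) S (A \<union> B) \<subseteq> reach BB (insert e S) A"
  proof
    fix x assume "x \<in> reach (BB - {B}) S (A \<union> B)"
    then show "x \<in> reach BB (insert e S) A"
    proof induction
      case (base x)
      have "x \<in> reach BB (insert e S) A" if "x \<in> B"
        using reach.step[OF reach.base[OF ab(1)] _ ab(2) B that, of "insert e S"] ab by simp
      then show ?case using base by (auto intro: reach.base)
    next
      case (step x y C z)
      then show ?case by (auto intro: reach.step)
    qed
  qed
qed

lemma crossing_unique:
  assumes "block_family A BB" "B \<in> BB" "C \<in> BB" "crossing e A B" "crossing e A C"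
  shows "B = C"
proof (rule ccontr)
  assume "B \<noteq> C"
  with assms have "B \<inter> C = {}" "C \<inter> A = {}" "B \<inter> A = {}" by (auto simp: block_family_def)
  with assms(4,5) show False by (auto simp: crossing_def doubleton_eq_iff)
qed

lemma cross_count_nonneg: "0 \<le> cross_count E A B"
  by (simp add: cross_count_def)

lemma cross_count_insert:
  assumes "finite E" "e \<notin> E"
  shows "cross_count (insert e E) A B = cross_count E A B + of_bool (crossing e A B)"
proof (cases "crossing e A B")
  case True
  then have "{x \<in> insert e E. crossing x A B} = insert e {x \<in> E. crossing x A B}" by auto
  then show ?thesis using assms True by (simp add: cross_count_def)
next
  case False
  then have "{x \<in> insert e E. crossing x A B} = {x \<in> E. crossing x A B}" by auto
  then show ?thesis using False by (simp add: cross_count_def)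
qed

lemma cross_count_le:
  assumes "finite A" "finite B"
  shows "cross_count E A B \<le> real (card A) * real (card B)"
proof -
  have "{e \<in> E. crossing e A B} \<subseteq> (\<lambda>(a, b). {a, b}) ` (A \<times> B)"
    by (auto simp: crossing_def)
  then have "card {e \<in> E. crossing e A B} \<le> card ((\<lambda>(a, b). {a, b}) ` (A \<times> B))"
    using assms by (intro card_mono) auto
  also have "\<dots> \<le> card (A \<times> B)" using assms by (intro card_image_le) auto
  finally have "card {e \<in> E. crossing e A B} \<le> card A * card B" by (simp add: card_cartesian_product)
  from of_nat_mono[OF this, where 'a = real] show ?thesis by (simp add: cross_count_def)
qed

lemma cross_count_Un_le:
  assumes "finite E"
  shows "cross_count E (A \<union> B) C \<le> cross_count E A C + cross_count E B C"
proof -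
  have "{e \<in> E. crossing e (A \<union> B) C} = {e \<in> E. crossing e A C} \<union> {e \<in> E. crossing e B C}"
    by (auto simp: crossing_def)
  then have "card {e \<in> E. crossing e (A \<union> B) C} \<le> card {e \<in> E. crossing e A C} + card {e \<in> E. crossing e B C}"
    by (simp add: card_Un_le)
  then show ?thesis unfolding cross_count_def by linarith
qed

lemma cross_count_Un:
  assumes "finite E" "A \<inter> B = {}" "A \<inter> C = {}" "B \<inter> C = {}"
  shows "cross_count E (A \<union> B) C = cross_count E A C + cross_count E B C"
proof -
  have "{e \<in> E. crossing e (A \<union> B) C} = {e \<in> E. crossing e A C} \<union> {e \<in> E. crossing e B C}"
    by (auto simp: crossing_def)
  moreover have "{e \<in> E. crossing e A C} \<inter> {e \<in> E. crossing e B C} = {}"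
    using assms(2-4) unfolding crossing_def by (auto simp: doubleton_eq_iff)
  ultimately have "card {e \<in> E. crossing e (A \<union> B) C} = card {e \<in> E. crossing e A C} + card {e \<in> E. crossing e B C}"
    using assms(1) by (simp add: card_Un_disjoint)
  then show ?thesis by (simp add: cross_count_def)
qed

lemma cross_count_cover:
  assumes fin: "finite E" "finite T" "finite A" "finite B" and dis: "A \<inter> B = {}"
    and cov: "\<And>a b. a \<in> A \<Longrightarrow> b \<in> B \<Longrightarrow> {a, b} \<in> E \<union> T"
  shows "real (card A) * real (card B) \<le> cross_count E A B + cross_count T A B"
proof -
  let ?f = "\<lambda>(a, b). {a, b}"
  have "inj_on ?f (A \<times> B)"
    using dis by (auto simp: inj_on_def doubleton_eq_iff)
  then have "card (?f ` (A \<times> B)) = card A * card B"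
    by (simp add: card_image card_cartesian_product)
  moreover have "?f ` (A \<times> B) \<subseteq> {e \<in> E. crossing e A B} \<union> {e \<in> T. crossing e A B}"
    using cov by (fastforce simp: crossing_def)
  then have "card (?f ` (A \<times> B)) \<le> card ({e \<in> E. crossing e A B} \<union> {e \<in> T. crossing e A B})"
    using fin by (intro card_mono) auto
  moreover have "\<dots> \<le> card {e \<in> E. crossing e A B} + card {e \<in> T. crossing e A B}"
    by (rule card_Un_le)
  ultimately have "card A * card B \<le> card {e \<in> E. crossing e A B} + card {e \<in> T. crossing e A B}"
    by linarith
  from of_nat_mono[OF this, where 'a = real] show ?thesis by (simp add: cross_count_def)
qed

text \<open>Pairs of \<open>T\<close> between \<open>X\<close> and the other blocks are lost when
  \<open>X\<close> is absorbed, and they are not among the pairs inside the remaining blocks. So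
  each pair is charged once, and a budget proportional to \<open>card T\<close> pays for the whole
  exploration.\<close>

lemma cross_count_inside:
  assumes bf: "block_family X CC" and T: "finite T"
  shows "(\<Sum>C\<in>CC. cross_count T X C) + real (card {e \<in> T. e \<subseteq> \<Union>CC}) \<le> real (card {e \<in> T. e \<subseteq> X \<union> \<Union>CC})"
proof -
  have fin: "finite CC" using bf by (simp add: block_family_def)
  have "(\<Sum>C\<in>CC. card {e \<in> T. crossing e X C}) = card (\<Union>C\<in>CC. {e \<in> T. crossing e X C})"
    using fin T crossing_unique[OF bf] by (subst card_UN_disjoint) auto
  moreover have "(\<Union>C\<in>CC. {e \<in> T. crossing e X C}) \<inter> {e \<in> T. e \<subseteq> \<Union>CC} = {}"
  proof -
    have "a \<notin> \<Union>CC" if "a \<in> X" for a using bf that by (auto simp: block_family_def)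
    then show ?thesis by (auto simp: crossing_def)
  qed
  then have "card (\<Union>C\<in>CC. {e \<in> T. crossing e X C}) + card {e \<in> T. e \<subseteq> \<Union>CC} =
     card ((\<Union>C\<in>CC. {e \<in> T. crossing e X C}) \<union> {e \<in> T. e \<subseteq> \<Union>CC})"
    using T fin by (subst card_Un_disjoint) auto
  moreover have "\<dots> \<le> card {e \<in> T. e \<subseteq> X \<union> \<Union>CC}"
    using T by (intro card_mono) (auto simp: crossing_def)
  ultimately have "(\<Sum>C\<in>CC. card {e \<in> T. crossing e X C}) + card {e \<in> T. e \<subseteq> \<Union>CC} \<le> card {e \<in> T. e \<subseteq> X \<union> \<Union>CC}"
    by linarith
  from of_nat_mono[OF this, where 'a = real] show ?thesis by (simp add: cross_count_def)
qed

lemma expectation_random_edge_subset_insert: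
  fixes g :: "nat set set \<Rightarrow> real"
  assumes "finite E" "e \<notin> E" "0 \<le> r" "r \<le> 1"
  shows "measure_pmf.expectation (random_edge_subset r (insert e E)) g =
    r * measure_pmf.expectation (random_edge_subset r E) (\<lambda>S. g (insert e S))
    + (1 - r) * measure_pmf.expectation (random_edge_subset r E) g"
proof -
  have fin: "finite (set_pmf (random_edge_subset r E))" using assms(1) by (rule finite_random_edge_subset)
  have "measure_pmf.expectation (random_edge_subset r (insert e E)) g =
    measure_pmf.expectation (bernoulli_pmf r) (\<lambda>b. measure_pmf.expectation
      (bind_pmf (random_edge_subset r E) (\<lambda>S. return_pmf (if b then insert e S else S))) g)"
    unfolding random_edge_subset_insert[OF assms(1,2)]
    by (rule expectation_bind_finite) (use fin in auto)
  also have "\<dots> = measure_pmf.expectation (bernoulli_pmf r) (\<lambda>b. measure_pmf.expectation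
      (random_edge_subset r E) (\<lambda>S. g (if b then insert e S else S)))"
    by (subst expectation_bind_finite) (use fin in auto)
  finally show ?thesis using assms by (simp add: mult.commute)
qed

lemma crossing_step_cross_count:
  assumes bf: "block_family A BB" and B: "B \<in> BB" and e: "crossing e A B" and E: "finite E" "e \<notin> E"
  shows "(\<Sum>C\<in>BB. \<theta> C * cross_count (insert e E) A C) = (\<Sum>C\<in>BB. \<theta> C * cross_count E A C) + \<theta> B"
proof -
  have fin: "finite BB" using bf by (simp add: block_family_def)
  have cr: "of_bool (crossing e A C) = (of_bool (C = B) :: real)" if "C \<in> BB" for C
  proof (cases "C = B")
    case False
    then have "\<not> crossing e A C" using crossing_unique[OF bf that B _ e] by blast
    then show ?thesis using False by simp
  qed (use e in simp)
  have "(\<Sum>C\<in>BB. \<theta> C * cross_count (insert e E) A C) = (\<Sum>C\<in>BB. \<theta> C * cross_count E A C + \<theta> C * of_bool (C = B))"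
    by (intro sum.cong refl) (simp add: cross_count_insert[OF E] cr distrib_left)
  also have "\<dots> = (\<Sum>C\<in>BB. \<theta> C * cross_count E A C) + \<theta> B"
    using fin B by (simp add: sum.distrib of_bool_def sum.delta if_distrib[of "\<lambda>x. _ * x"] cong: if_cong)
  finally show ?thesis .
qed

text \<open>Reveal one potential edge between the explored set and a fresh block at a time: an unrevealed
  potential edge to the block \<open>B\<close> contributes \<open>r * (exp (s * |B|) - 1)\<close> to the exponent,
  which makes the bound a supermartingale.\<close>

lemma reach_exp_moment_aux:
  assumes r: "0 \<le> r" "r \<le> 1" and t: "0 \<le> t" and s: "0 \<le> s"
    and E: "finite E" and bf: "block_family A BB"
    and cond: "t + (\<Sum>B\<in>BB. real (card B) * (r * (exp (s * real (card B)) - 1))) \<le> s"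
  shows "measure_pmf.expectation (random_edge_subset r E) (\<lambda>S. exp (t * real (card (reach BB S A))))
    \<le> exp (t * real (card A) + (\<Sum>B\<in>BB. r * (exp (s * real (card B)) - 1) * cross_count E A B))"
  using E bf cond
proof (induction E arbitrary: A BB rule: finite_psubset_induct)
  case (psubset E)
  define \<theta> where "\<theta> B = r * (exp (s * real (card B)) - 1)" for B :: "nat set"
  have \<theta>: "0 \<le> \<theta> B" for B using r s by (simp add: \<theta>_def)
  note bf = psubset.prems(1)
  have finBB: "finite BB" using bf by (simp add: block_family_def)
  have finB: "finite B" if "B \<in> BB" for B using bf that by (simp add: block_family_def)
  show ?case
  proof (cases "\<exists>e\<in>E. \<exists>B\<in>BB. crossing e A B")
    case False
    have "measure_pmf.expectation (random_edge_subset r E) (\<lambda>S. exp (t * real (card (reach BB S A))))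
      = measure_pmf.expectation (random_edge_subset r E) (\<lambda>S. exp (t * real (card A)))"
    proof (rule expectation_cong_pmf)
      fix S assume "S \<in> set_pmf (random_edge_subset r E)"
      then have "S \<subseteq> E" by (rule set_random_edge_subset)
      then have "reach BB S A = A" using False by (intro reach_no_crossing) auto
      then show "exp (t * real (card (reach BB S A))) = exp (t * real (card A))" by simp
    qed
    also have "\<dots> \<le> exp (t * real (card A) + (\<Sum>B\<in>BB. \<theta> B * cross_count E A B))"
      using \<theta> cross_count_nonneg by (auto intro!: sum_nonneg mult_nonneg_nonneg)
    finally show ?thesis by (simp add: \<theta>_def)
  next
    case True
    then obtain e B where e: "e \<in> E" "B \<in> BB" "crossing e A B" by auto
    define E' where "E' = E - {e}"
    have E': "E = insert e E'" "e \<notin> E'" "finite E'" "E' \<subset> E"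
      using e psubset(1) by (auto simp: E'_def)
    define X where "X = t * real (card A) + (\<Sum>C\<in>BB. \<theta> C * cross_count E' A C)"
    have miss: "measure_pmf.expectation (random_edge_subset r E') (\<lambda>S. exp (t * real (card (reach BB S A)))) \<le> exp X"
      using psubset.IH[OF E'(4) bf psubset.prems(2)] by (simp add: X_def \<theta>_def)
    \<comment> \<open>Removing a block only lowers the drift, so the condition passes to the merged
      state.\<close>
    have cond': "t + (\<Sum>C\<in>BB - {B}. real (card C) * \<theta> C) \<le> s"
    proof -
      have "(\<Sum>C\<in>BB - {B}. real (card C) * \<theta> C) \<le> (\<Sum>C\<in>BB. real (card C) * \<theta> C)"
        using finBB \<theta> by (intro sum_mono2) auto
      then show ?thesis using psubset.prems(2) by (simp add: \<theta>_def)
    qed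
    have bf': "block_family (A \<union> B) (BB - {B})" by (rule block_family_merge[OF bf e(2)])
    have "measure_pmf.expectation (random_edge_subset r E') (\<lambda>S. exp (t * real (card (reach BB (insert e S) A))))
      = measure_pmf.expectation (random_edge_subset r E') (\<lambda>S. exp (t * real (card (reach (BB - {B}) S (A \<union> B)))))"
    proof (rule expectation_cong_pmf)
      fix S assume "S \<in> set_pmf (random_edge_subset r E')"
      then have "e \<notin> S" using set_random_edge_subset E'(2) by blast
      from reach_crossing[OF bf e(2,3) this]
      show "exp (t * real (card (reach BB (insert e S) A))) = exp (t * real (card (reach (BB - {B}) S (A \<union> B))))"
        by simp
    qed
    also have "\<dots> \<le> exp (t * real (card (A \<union> B)) + (\<Sum>C\<in>BB - {B}. \<theta> C * cross_count E' (A \<union> B) C))"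
      using psubset.IH[OF E'(4) bf'] cond' by (simp add: \<theta>_def)
    also have "\<dots> \<le> exp (X + s * real (card B))"
    proof -
      \<comment> \<open>Absorbing \<open>B\<close> opens at most \<open>card B * card C\<close> new
        candidates to each fresh \<open>C\<close>. By the drift condition their total cost, together
        with \<open>t\<close> per vertex of \<open>B\<close>, is at most
        \<open>s * card B\<close>.\<close>
      have "(\<Sum>C\<in>BB - {B}. \<theta> C * cross_count E' (A \<union> B) C) \<le>
        (\<Sum>C\<in>BB - {B}. \<theta> C * cross_count E' A C + real (card B) * (real (card C) * \<theta> C))"
      proof (rule sum_mono)
        fix C assume "C \<in> BB - {B}"
        then have "cross_count E' (A \<union> B) C \<le> cross_count E' A C + real (card B) * real (card C)"
          using cross_count_Un_le[OF E'(3), of A B C] cross_count_le[of B C E'] finB e(2) by fastforce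
        from mult_left_mono[OF this \<theta>[of C]]
        show "\<theta> C * cross_count E' (A \<union> B) C \<le> \<theta> C * cross_count E' A C + real (card B) * (real (card C) * \<theta> C)"
          by (simp add: algebra_simps)
      qed
      also have "\<dots> = (\<Sum>C\<in>BB - {B}. \<theta> C * cross_count E' A C) + real (card B) * (\<Sum>C\<in>BB - {B}. real (card C) * \<theta> C)"
        by (simp add: sum.distrib sum_distrib_left)
      also have "(\<Sum>C\<in>BB - {B}. \<theta> C * cross_count E' A C) \<le> (\<Sum>C\<in>BB. \<theta> C * cross_count E' A C)"
        using finBB \<theta> cross_count_nonneg by (intro sum_mono2) auto
      finally have 1: "(\<Sum>C\<in>BB - {B}. \<theta> C * cross_count E' (A \<union> B) C) \<le>
        (\<Sum>C\<in>BB. \<theta> C * cross_count E' A C) + real (card B) * (\<Sum>C\<in>BB - {B}. real (card C) * \<theta> C)" by simp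
      have "real (card B) * (t + (\<Sum>C\<in>BB - {B}. real (card C) * \<theta> C)) \<le> real (card B) * s"
        using cond' by (intro mult_left_mono) auto
      then have "t * real (card (A \<union> B)) + (\<Sum>C\<in>BB - {B}. \<theta> C * cross_count E' (A \<union> B) C) \<le> X + s * real (card B)"
        using 1 unfolding block_family_card_merge[OF bf e(2)] X_def by (simp add: algebra_simps)
      then show ?thesis by simp
    qed
    finally have hit: "measure_pmf.expectation (random_edge_subset r E') (\<lambda>S. exp (t * real (card (reach BB (insert e S) A))))
      \<le> exp (X + s * real (card B))" .
    have "measure_pmf.expectation (random_edge_subset r E) (\<lambda>S. exp (t * real (card (reach BB S A))))
      \<le> r * exp (X + s * real (card B)) + (1 - r) * exp X"
      unfolding E'(1) expectation_random_edge_subset_insert[OF E'(3,2) r]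
      using hit miss r by (intro add_mono mult_left_mono) auto
    \<comment> \<open>\<open>r * exp (s * card B) + (1 - r)\<close> is the mean factor of one
      revelation; it is covered by the contribution \<open>\<theta> B\<close> of the candidate
      \<open>e\<close> to the exponent.\<close>
    also have "\<dots> = exp X * (1 + \<theta> B)"
      by (simp add: \<theta>_def exp_add algebra_simps)
    also have "\<dots> \<le> exp X * exp (\<theta> B)"
      by (intro mult_left_mono) auto
    also have "\<dots> = exp (t * real (card A) + (\<Sum>C\<in>BB. \<theta> C * cross_count E A C))"
      using crossing_step_cross_count[OF bf e(2,3) E'(3,2), of \<theta>] unfolding E'(1)[symmetric]
      by (simp add: X_def exp_add)
    finally show ?thesis by (simp add: \<theta>_def)
  qed
qed

text \<open>Exponential Markov inequality. Bounding the candidates by \<open>card A * card B\<close>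
  turns the initial potential into at most \<open>s * card A\<close>, so the ratio of
  \<open>s\<close> to \<open>t\<close> is the growth factor.\<close>

lemma reach_upper_tail:
  assumes r: "0 \<le> r" "r \<le> 1" and t: "0 \<le> t" and s: "0 \<le> s"
    and E: "finite E" and bf: "block_family A BB"
    and cond: "t + (\<Sum>B\<in>BB. real (card B) * (r * (exp (s * real (card B)) - 1))) \<le> s"
  shows "measure_pmf.prob (random_edge_subset r E) {S. x \<le> real (card (reach BB S A))}
    \<le> exp (s * real (card A) - t * x)"
proof -
  let ?\<theta> = "\<lambda>B. r * (exp (s * real (card B)) - 1)"
  have "(\<Sum>B\<in>BB. ?\<theta> B * cross_count E A B) \<le> (\<Sum>B\<in>BB. ?\<theta> B * (real (card A) * real (card B)))"
    using bf r s by (intro sum_mono mult_left_mono cross_count_le) (auto simp: block_family_def)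
  also have "\<dots> = real (card A) * (\<Sum>B\<in>BB. real (card B) * ?\<theta> B)"
    by (simp add: sum_distrib_left mult_ac)
  finally have le: "t * real (card A) + (\<Sum>B\<in>BB. ?\<theta> B * cross_count E A B) \<le> s * real (card A)"
    using mult_left_mono[OF cond, of "real (card A)"] by (simp add: algebra_simps)
  have "measure_pmf.prob (random_edge_subset r E) {S. x \<le> real (card (reach BB S A))} \<le>
     measure_pmf.expectation (random_edge_subset r E) (\<lambda>S. exp (t * real (card (reach BB S A)))) / exp (t * x)"
    by (rule prob_le_expectation_finite[OF finite_random_edge_subset[OF E]])
       (auto intro: mult_left_mono t)
  also have "\<dots> \<le> exp (t * real (card A) + (\<Sum>B\<in>BB. ?\<theta> B * cross_count E A B)) / exp (t * x)"
    by (intro divide_right_mono reach_exp_moment_aux assms) auto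
  also have "\<dots> \<le> exp (s * real (card A)) / exp (t * x)"
    using le by (intro divide_right_mono) auto
  finally show ?thesis by (simp add: exp_diff)
qed

text \<open>The same potential with \<open>- s\<close> in place of \<open>s\<close>. Explored blocks and the pairs in \<open>T\<close> reduce the
  drift; the restriction to explorations of size at most \<open>x\<close> bounds the former, and the last
  summand of the exponent pays in advance for the latter.\<close>

lemma reach_lower_moment_aux:
  assumes r: "0 \<le> r" "r \<le> 1" and t: "0 \<le> t" and s: "0 \<le> s" and T: "finite T"
    and \<theta>_def: "\<And>B. \<theta> B = r * (1 - exp (- s * real (card B)))"
    and E: "finite E" and bf: "block_family A BB"
    and \<theta>m: "\<And>B. B \<in> BB \<Longrightarrow> \<theta> B \<le> \<theta>m" "0 \<le> \<theta>m"
    and cov: "\<And>B C b c. B \<in> BB \<Longrightarrow> C \<in> BB \<Longrightarrow> B \<noteq> C \<Longrightarrow> b \<in> B \<Longrightarrow> c \<in> C \<Longrightarrow> {b, c} \<in> E \<union> T"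
    and cond: "s + 2 * x * \<theta>m \<le> t + (\<Sum>B\<in>BB. real (card B) * \<theta> B) + real (card A) * \<theta>m"
  shows "measure_pmf.expectation (random_edge_subset r E)
      (\<lambda>S. if real (card (reach BB S A)) \<le> x then exp (- t * real (card (reach BB S A))) else 0)
    \<le> exp (- (t * real (card A) + (\<Sum>B\<in>BB. \<theta> B * cross_count E A B) - \<theta>m * real (card {e \<in> T. e \<subseteq> \<Union>BB})))"
  using E bf \<theta>m(1) cov cond
proof (induction E arbitrary: A BB rule: finite_psubset_induct)
  case (psubset E)
  let ?g = "\<lambda>BB S A. if real (card (reach BB S A)) \<le> x then exp (- t * real (card (reach BB S A))) else 0"
  have \<theta>: "0 \<le> \<theta> B" for B using r s by (simp add: \<theta>_def)
  note bf = psubset.prems(1) and \<theta>m' = psubset.prems(2) and cov = psubset.prems(3) and cond = psubset.prems(4)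
  have finBB: "finite BB" using bf by (simp add: block_family_def)
  have finB: "finite B" if "B \<in> BB" for B using bf that by (simp add: block_family_def)
  have card_reach: "card A \<le> card (reach BB S A)" if "block_family A BB" for S A BB
    using finite_reach[OF that] reach_superset by (rule card_mono)
  show ?case
  proof (cases "x < real (card A)")
    case True
    have "measure_pmf.expectation (random_edge_subset r E) (\<lambda>S. ?g BB S A) = measure_pmf.expectation (random_edge_subset r E) (\<lambda>S. 0)"
    proof (rule expectation_cong_pmf)
      fix S
      show "?g BB S A = 0" using card_reach[OF bf, of S] True by auto
    qed
    then show ?thesis by simp
  next
    case Ax: False
    show ?thesis
    proof (cases "\<exists>e\<in>E. \<exists>B\<in>BB. crossing e A B")
      case False
      have "measure_pmf.expectation (random_edge_subset r E) (\<lambda>S. ?g BB S A)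
        \<le> measure_pmf.expectation (random_edge_subset r E) (\<lambda>S. exp (- t * real (card A)))"
      proof (rule expectation_mono_finite[OF finite_random_edge_subset[OF psubset(1)]])
        fix S assume "S \<in> set_pmf (random_edge_subset r E)"
        then have "S \<subseteq> E" by (rule set_random_edge_subset)
        then have "reach BB S A = A" using False by (intro reach_no_crossing) auto
        then show "?g BB S A \<le> exp (- t * real (card A))" by simp
      qed
      also have "\<dots> \<le> exp (- (t * real (card A) + (\<Sum>B\<in>BB. \<theta> B * cross_count E A B) - \<theta>m * real (card {e \<in> T. e \<subseteq> \<Union>BB})))"
      proof -
        have "cross_count E A B = 0" if "B \<in> BB" for B
        proof -
          have "{e \<in> E. crossing e A B} = {}" using False that by auto
          from arg_cong[OF this, of card] show ?thesis by (simp only: cross_count_def card.empty of_nat_0)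
        qed
        then have "(\<Sum>B\<in>BB. \<theta> B * cross_count E A B) = 0" by (intro sum.neutral) simp
        then show ?thesis using \<theta>m(2) by simp
      qed
      finally show ?thesis .
    next
      case True
      then obtain e B where e: "e \<in> E" "B \<in> BB" "crossing e A B" by auto
      define E' where "E' = E - {e}"
      have E': "E = insert e E'" "e \<notin> E'" "finite E'" "E' \<subset> E"
        using e psubset(1) by (auto simp: E'_def)
      let ?\<tau> = "\<lambda>BB. real (card {e \<in> T. e \<subseteq> \<Union>BB})"
      define X where "X = t * real (card A) + (\<Sum>C\<in>BB. \<theta> C * cross_count E' A C) - \<theta>m * ?\<tau> BB"
      have cov': "{b, c} \<in> E' \<union> T" if "C \<in> BB" "D \<in> BB" "C \<noteq> D" "b \<in> C" "c \<in> D" for C D b c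
      proof -
        obtain a' b' where ab: "a' \<in> A" "e = {a', b'}" using e(3) by (auto simp: crossing_def)
        have "b \<notin> A" "c \<notin> A" using bf that by (auto simp: block_family_def)
        then have "{b, c} \<noteq> e" using ab by auto
        then show ?thesis using cov[OF that] E'(1) by auto
      qed
      have miss: "measure_pmf.expectation (random_edge_subset r E') (\<lambda>S. ?g BB S A) \<le> exp (- X)"
        using psubset.IH[OF E'(4) bf \<theta>m' cov' cond] by (simp add: X_def)
      have bf': "block_family (A \<union> B) (BB - {B})" by (rule block_family_merge[OF bf e(2)])
      have bfB: "block_family B (BB - {B})" using bf e(2) by (auto simp: block_family_def)
      have UB: "B \<union> \<Union>(BB - {B}) = \<Union>BB" using e(2) by auto
      note cm = block_family_card_merge[OF bf e(2)]
      have sumB: "(\<Sum>C\<in>BB. f C) = f B + (\<Sum>C\<in>BB - {B}. f C)" for f :: "nat set \<Rightarrow> real"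
        using sum.remove[OF finBB e(2)] .
      have hit: "measure_pmf.expectation (random_edge_subset r E') (\<lambda>S. ?g BB (insert e S) A) \<le> exp (- (X + s * real (card B)))"
      proof -
        have eq: "measure_pmf.expectation (random_edge_subset r E') (\<lambda>S. ?g BB (insert e S) A) =
          measure_pmf.expectation (random_edge_subset r E') (\<lambda>S. ?g (BB - {B}) S (A \<union> B))"
        proof (rule expectation_cong_pmf)
          fix S assume "S \<in> set_pmf (random_edge_subset r E')"
          then have "e \<notin> S" using set_random_edge_subset E'(2) by blast
          from reach_crossing[OF bf e(2,3) this]
          show "?g BB (insert e S) A = ?g (BB - {B}) S (A \<union> B)" by simp
        qed
        show ?thesis
        proof (cases "x < real (card (A \<union> B))")
          case True
          have "measure_pmf.expectation (random_edge_subset r E') (\<lambda>S. ?g (BB - {B}) S (A \<union> B)) =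
            measure_pmf.expectation (random_edge_subset r E') (\<lambda>S. 0)"
          proof (rule expectation_cong_pmf)
            fix S
            show "?g (BB - {B}) S (A \<union> B) = 0" using card_reach[OF bf', of S] True by auto
          qed
          then show ?thesis unfolding eq by simp
        next
          case False
          have B\<theta>: "real (card B) * \<theta> B \<le> real (card B) * \<theta>m"
            using \<theta>m' e(2) by (intro mult_left_mono) auto
          \<comment> \<open>The term \<open>card A * \<theta>m\<close> makes the condition
            self-reproducing: the sum loses at most \<open>card B * \<theta>m\<close> with
            \<open>B\<close>, and the absorbed set gains exactly that.\<close>
          have cond': "s + 2 * x * \<theta>m \<le> t + (\<Sum>C\<in>BB - {B}. real (card C) * \<theta> C) + real (card (A \<union> B)) * \<theta>m"
            using cond B\<theta> unfolding sumB[of "\<lambda>C. real (card C) * \<theta> C"] cm by (simp add: distrib_right)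
          have "measure_pmf.expectation (random_edge_subset r E') (\<lambda>S. ?g (BB - {B}) S (A \<union> B)) \<le>
            exp (- (t * real (card (A \<union> B)) + (\<Sum>C\<in>BB - {B}. \<theta> C * cross_count E' (A \<union> B) C) - \<theta>m * ?\<tau> (BB - {B})))"
          proof (rule psubset.IH[OF E'(4) bf' _ _ cond'])
            show "\<theta> C \<le> \<theta>m" if "C \<in> BB - {B}" for C using that by (intro \<theta>m') auto
            show "{b, c} \<in> E' \<union> T" if "C \<in> BB - {B}" "D \<in> BB - {B}" "C \<noteq> D" "b \<in> C" "c \<in> D" for C D b c
              using that by (intro cov'[of C D]) auto
          qed
          also have "\<dots> \<le> exp (- (X + s * real (card B)))"
          proof -
            have 1: "(\<Sum>C\<in>BB - {B}. \<theta> C * cross_count E' (A \<union> B) C) \<ge>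
              (\<Sum>C\<in>BB - {B}. \<theta> C * cross_count E' A C + real (card B) * (real (card C) * \<theta> C) - \<theta>m * cross_count T B C)"
            proof (rule sum_mono)
              fix C assume C: "C \<in> BB - {B}"
              have d: "A \<inter> B = {}" "A \<inter> C = {}" "B \<inter> C = {}"
                using block_family_disjoint(1)[OF bf e(2)] block_family_disjoint(1)[OF bf, of C]
                  block_family_disjoint(2)[OF bf e(2), of C] C by auto
              have "real (card B) * real (card C) \<le> cross_count E' B C + cross_count T B C"
                using C finB e(2) cov'[of B C] by (intro cross_count_cover E' T d) auto
              from mult_left_mono[OF this \<theta>[of C]]
              have "real (card B) * (real (card C) * \<theta> C) \<le> \<theta> C * cross_count E' B C + \<theta> C * cross_count T B C"
                by (simp add: algebra_simps)
              also have "\<theta> C * cross_count T B C \<le> \<theta>m * cross_count T B C"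
                using \<theta>m' C by (intro mult_right_mono cross_count_nonneg) auto
              finally show "\<theta> C * cross_count E' A C + real (card B) * (real (card C) * \<theta> C) - \<theta>m * cross_count T B C
                \<le> \<theta> C * cross_count E' (A \<union> B) C"
                unfolding cross_count_Un[OF E'(3) d] by (simp add: distrib_left)
            qed
            have 2: "\<theta>m * ((\<Sum>C\<in>BB - {B}. cross_count T B C) + ?\<tau> (BB - {B})) \<le> \<theta>m * ?\<tau> BB"
              using cross_count_inside[OF bfB T] unfolding UB by (intro mult_left_mono \<theta>m(2))
            \<comment> \<open>Further candidates between \<open>A\<close> and \<open>B\<close> leave
              the potential when \<open>B\<close> is absorbed. This loss and the one from blocks
              already explored each cost at most \<open>x * \<theta>m\<close> per vertex of
              \<open>B\<close>, hence the \<open>2 * x * \<theta>m\<close> in the condition.\<close>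
            have 3: "\<theta> B * cross_count E' A B \<le> \<theta>m * (real (card A) * real (card B))"
              using \<theta>m' e(2) bf finB \<theta>m(2) cross_count_nonneg
              by (intro mult_mono cross_count_le) (auto simp: block_family_def)
            define Q where "Q = (\<Sum>C\<in>BB - {B}. real (card C) * \<theta> C)"
            have 4: "0 \<le> real (card B) * (t + Q - \<theta>m * real (card A) - s)"
            proof (rule mult_nonneg_nonneg)
              have "(real (card A) + real (card B)) * \<theta>m \<le> x * \<theta>m"
                using False cm \<theta>m(2) by (intro mult_right_mono) auto
              moreover have "0 \<le> real (card B) * \<theta>m" using \<theta>m(2) by simp
              ultimately show "0 \<le> t + Q - \<theta>m * real (card A) - s"
                using cond' unfolding Q_def[symmetric] cm of_nat_add distrib_right mult.commute[of \<theta>m] mult.assoc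
                by linarith
            qed simp
            have 5: "(\<Sum>C\<in>BB - {B}. \<theta> C * cross_count E' A C + real (card B) * (real (card C) * \<theta> C) - \<theta>m * cross_count T B C)
              = (\<Sum>C\<in>BB - {B}. \<theta> C * cross_count E' A C) + real (card B) * Q - \<theta>m * (\<Sum>C\<in>BB - {B}. cross_count T B C)"
              unfolding Q_def by (simp add: sum.distrib sum_subtractf sum_distrib_left)
            have "X + s * real (card B) \<le> t * real (card (A \<union> B)) + (\<Sum>C\<in>BB - {B}. \<theta> C * cross_count E' (A \<union> B) C) - \<theta>m * ?\<tau> (BB - {B})"
              using 1 2 3 4 unfolding 5 X_def cm sumB[of "\<lambda>C. \<theta> C * cross_count E' A C"]
              by (simp add: algebra_simps)
            then show ?thesis by simp
          qed
          finally show ?thesis unfolding eq .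
        qed
      qed
      have "measure_pmf.expectation (random_edge_subset r E) (\<lambda>S. ?g BB S A)
        \<le> r * exp (- (X + s * real (card B))) + (1 - r) * exp (- X)"
        unfolding E'(1) expectation_random_edge_subset_insert[OF E'(3,2) r]
        using hit miss r by (intro add_mono mult_left_mono) auto
      also have "\<dots> = exp (- X) * (1 + - \<theta> B)"
        by (simp add: \<theta>_def exp_add exp_diff exp_minus field_simps)
      also have "\<dots> \<le> exp (- X) * exp (- \<theta> B)"
        by (intro mult_left_mono exp_ge_add_one_self) auto
      also have "\<dots> = exp (- (t * real (card A) + (\<Sum>C\<in>BB. \<theta> C * cross_count E A C) - \<theta>m * ?\<tau> BB))"
        using crossing_step_cross_count[OF bf e(2,3) E'(3,2), of \<theta>] unfolding E'(1)[symmetric]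
        by (simp add: X_def exp_add[symmetric])
      finally show ?thesis .
    qed
  qed
qed

text \<open>\<open>T\<close> is the set of pairs that are not available as random edges.\<close>

lemma reach_lower_tail:
  assumes r: "0 \<le> r" "r \<le> 1" and t: "0 \<le> t" and s: "0 \<le> s" and T: "finite T"
    and E: "finite E" and bf: "block_family A BB"
    and \<theta>m: "\<And>B. B \<in> BB \<Longrightarrow> r * (1 - exp (- s * real (card B))) \<le> \<theta>m" "0 \<le> \<theta>m"
    and cov: "\<And>b c. b \<in> A \<union> \<Union>BB \<Longrightarrow> c \<in> A \<union> \<Union>BB \<Longrightarrow> b \<noteq> c \<Longrightarrow> {b, c} \<in> E \<union> T"
    and cond: "s + 2 * x * \<theta>m \<le> t + (\<Sum>B\<in>BB. real (card B) * (r * (1 - exp (- s * real (card B)))))"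
  shows "measure_pmf.prob (random_edge_subset r E) {S. real (card (reach BB S A)) \<le> x}
    \<le> exp (t * x - s * real (card A) + \<theta>m * real (card T))"
proof -
  define \<theta> where "\<theta> B = r * (1 - exp (- s * real (card B)))" for B :: "nat set"
  have \<theta>: "0 \<le> \<theta> B" for B using r s by (simp add: \<theta>_def)
  have finBB: "finite BB" using bf by (simp add: block_family_def)
  have "card A \<le> card (reach BB S A)" for S
    using finite_reach[OF bf] reach_superset by (rule card_mono)
  have "measure_pmf.prob (random_edge_subset r E) {S. real (card (reach BB S A)) \<le> x} \<le>
     measure_pmf.expectation (random_edge_subset r E) (\<lambda>S. if real (card (reach BB S A)) \<le> x then exp (- t * real (card (reach BB S A))) else 0)
     / exp (- t * x)"
    by (rule prob_le_expectation_finite[OF finite_random_edge_subset[OF E]])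
       (auto intro: mult_left_mono t)
  also have "\<dots> \<le> exp (- (t * real (card A) + (\<Sum>B\<in>BB. \<theta> B * cross_count E A B) - \<theta>m * real (card {e \<in> T. e \<subseteq> \<Union>BB}))) / exp (- t * x)"
  proof (intro divide_right_mono reach_lower_moment_aux[OF r t s T \<theta>_def E bf])
    show "s + 2 * x * \<theta>m \<le> t + (\<Sum>B\<in>BB. real (card B) * \<theta> B) + real (card A) * \<theta>m"
      using cond \<theta>m(2) by (simp add: \<theta>_def add_increasing2)
    show "{b, c} \<in> E \<union> T" if "B \<in> BB" "C \<in> BB" "B \<noteq> C" "b \<in> B" "c \<in> C" for B C b c
    proof -
      have "B \<inter> C = {}" using bf that by (simp add: block_family_def)
      then have "b \<noteq> c" using that by auto
      then show ?thesis using that by (intro cov) auto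
    qed
  qed (use \<theta>m in \<open>auto simp: \<theta>_def\<close>)
  also have "\<dots> \<le> exp (- (s * real (card A) - \<theta>m * real (card T))) / exp (- t * x)"
    if Ax: "real (card A) \<le> x"
  proof -
    have "(\<Sum>B\<in>BB. \<theta> B * cross_count E A B) \<ge> (\<Sum>B\<in>BB. real (card A) * (real (card B) * \<theta> B) - \<theta>m * cross_count T A B)"
    proof (rule sum_mono)
      fix B assume B: "B \<in> BB"
      have d: "A \<inter> B = {}" using bf B by (auto simp: block_family_def)
      have "{a, b} \<in> E \<union> T" if "a \<in> A" "b \<in> B" for a b
      proof -
        have "a \<noteq> b" using d that by auto
        then show ?thesis using that B by (intro cov) auto
      qed
      then have "real (card A) * real (card B) \<le> cross_count E A B + cross_count T A B"
        using bf B by (intro cross_count_cover E T d) (auto simp: block_family_def)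
      from mult_left_mono[OF this \<theta>[of B]]
      have "real (card A) * (real (card B) * \<theta> B) \<le> \<theta> B * cross_count E A B + \<theta> B * cross_count T A B"
        by (simp add: algebra_simps)
      also have "\<theta> B * cross_count T A B \<le> \<theta>m * cross_count T A B"
        using \<theta>m(1)[OF B] by (intro mult_right_mono cross_count_nonneg) (auto simp: \<theta>_def)
      finally show "real (card A) * (real (card B) * \<theta> B) - \<theta>m * cross_count T A B \<le> \<theta> B * cross_count E A B"
        by simp
    qed
    then have 1: "(\<Sum>B\<in>BB. \<theta> B * cross_count E A B) \<ge>
      real (card A) * (\<Sum>B\<in>BB. real (card B) * \<theta> B) - \<theta>m * (\<Sum>B\<in>BB. cross_count T A B)"
      by (simp add: sum_subtractf sum_distrib_left)
    have "(\<Sum>B\<in>BB. cross_count T A B) + real (card {e \<in> T. e \<subseteq> \<Union>BB}) \<le> real (card {e \<in> T. e \<subseteq> A \<union> \<Union>BB})"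
      by (rule cross_count_inside[OF bf T])
    also have "\<dots> \<le> real (card T)"
      using T by (simp add: card_mono)
    finally have 2: "\<theta>m * ((\<Sum>B\<in>BB. cross_count T A B) + real (card {e \<in> T. e \<subseteq> \<Union>BB})) \<le> \<theta>m * real (card T)"
      using \<theta>m(2) by (rule mult_left_mono)
    have "0 \<le> x * \<theta>m" using Ax \<theta>m(2) by (intro mult_nonneg_nonneg) auto
    then have "s \<le> t + (\<Sum>B\<in>BB. real (card B) * \<theta> B)"
      using cond by (simp add: \<theta>_def)
    then have 3: "real (card A) * s \<le> real (card A) * (t + (\<Sum>B\<in>BB. real (card B) * \<theta> B))"
      by (intro mult_left_mono) auto
    have "s * real (card A) - \<theta>m * real (card T) \<le>
      t * real (card A) + (\<Sum>B\<in>BB. \<theta> B * cross_count E A B) - \<theta>m * real (card {e \<in> T. e \<subseteq> \<Union>BB})"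
      using 1 2 3 by (simp add: algebra_simps)
    then show ?thesis by (intro divide_right_mono) auto
  qed
  also have "exp (- (s * real (card A) - \<theta>m * real (card T))) / exp (- t * x) = exp (t * x - s * real (card A) + \<theta>m * real (card T))"
    by (simp add: exp_diff[symmetric])
  finally have main: "real (card A) \<le> x \<Longrightarrow> ?thesis" .
  show ?thesis
  proof (cases "real (card A) \<le> x")
    case False
    then have "{S. real (card (reach BB S A)) \<le> x} = {}"
      using \<open>\<And>S. card A \<le> card (reach BB S A)\<close> by (smt (verit) Collect_empty_eq of_nat_le_iff)
    then show ?thesis by simp
  qed (rule main)
qed

section \<open>The limiting blob size law\<close>

text \<open>With the Beta function written by Gamma functions, \<open>q p k * k powr z\<close> is up
  to a constant the sequence \<open>Gamma_series' z k\<close>, whose limit is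
  \<open>Gamma z\<close>, for \<open>z = 1 + 1 / p\<close>.\<close>

lemma q_asymptotics:
  assumes "0 < p"
  shows "(\<lambda>k. q p k * real k powr (1 + 1 / p)) \<longlonglongrightarrow> (1 - p) / p * Gamma (1 + 1 / p)"
proof -
  define z where "z = 1 + 1 / p"
  have z: "z > 0" using assms by (simp add: z_def add_pos_pos)
  then have zn: "z \<notin> \<int>\<^sub>\<le>\<^sub>0" by (auto elim!: nonpos_Ints_cases)
  have "(\<lambda>k. (1 - p) / p * Gamma_series' z k) \<longlonglongrightarrow> (1 - p) / p * Gamma z"
    by (intro tendsto_intros Gamma_series'_LIMSEQ)
  moreover have "\<forall>\<^sub>F k in sequentially. (1 - p) / p * Gamma_series' z k = q p k * real k powr z"
    using eventually_ge_at_top[of 1]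
  proof eventually_elim
    case (elim k)
    have "Gamma (real k) = fact (k - 1)"
      using Gamma_fact[of "k - 1", where 'a = real] elim by (simp add: of_nat_diff)
    moreover have "pochhammer z k = Gamma (z + real k) / Gamma z"
      using pochhammer_Gamma[OF zn] .
    moreover have "exp (z * ln (real k)) = real k powr z"
      using elim by (simp add: powr_def)
    ultimately show ?case
      by (simp add: Gamma_series'_def q_def Beta_def z_def add.commute)
  qed
  ultimately have "(\<lambda>k. q p k * real k powr z) \<longlonglongrightarrow> (1 - p) / p * Gamma z"
    by (rule Lim_transform_eventually)
  then show ?thesis unfolding z_def .
qed

text \<open>The decay exponent \<open>1 + 1 / p\<close> exceeds 3 for \<open>p < 1 / 2\<close>. This
  disposes of the boundary terms of the telescoping sums below.\<close>

lemma q_cubic_decay: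
  assumes "0 < p" "p < 1 / 2"
  shows "(\<lambda>k. q p k * real k ^ 3) \<longlonglongrightarrow> 0"
proof -
  have p2: "1 / p > 2" using assms by (simp add: field_simps)
  have "(\<lambda>k. real k powr (- (1 / p - 2))) \<longlonglongrightarrow> 0"
    by (intro tendsto_neg_powr filterlim_real_sequentially) (use p2 in simp)
  from tendsto_mult[OF q_asymptotics[OF assms(1)] this]
  have "(\<lambda>k. q p k * real k powr (1 + 1 / p) * real k powr (- (1 / p - 2))) \<longlonglongrightarrow> 0" by simp
  moreover have "\<forall>\<^sub>F k in sequentially. q p k * real k powr (1 + 1 / p) * real k powr (- (1 / p - 2)) = q p k * real k ^ 3"
    using eventually_gt_at_top[of 0]
  proof eventually_elim
    case (elim k)
    have "real k powr (1 + 1 / p) * real k powr (- (1 / p - 2)) = real k powr (real 3)"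
      by (simp add: powr_add[symmetric])
    also have "\<dots> = real k ^ 3" using elim by (intro powr_realpow) simp
    finally show ?case by (simp add: mult.assoc)
  qed
  ultimately show ?thesis by (rule Lim_transform_eventually)
qed

text \<open>The sums over \<open>q p k\<close> have explicit antidifferences, namely
  \<open>q p k * (1 + p * k)\<close> times a polynomial in \<open>k\<close>, because
  \<open>q_Suc\<close> expresses the shifted term through \<open>q p k\<close> itself.\<close>

lemma telescoping_has_sum:
  fixes U f :: "nat \<Rightarrow> real"
  assumes "U \<longlonglongrightarrow> 0" "\<And>k. k \<ge> n \<Longrightarrow> U k - U (Suc k) = f k" "\<And>k. k \<ge> n \<Longrightarrow> 0 \<le> f k"
  shows "(f has_sum U n) {n..}"
proof -
  have "(\<lambda>i. U (n + i)) \<longlonglongrightarrow> 0"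
    using LIMSEQ_ignore_initial_segment[OF assms(1), of n] by (simp add: add.commute)
  from telescope_sums'[OF this] have "(\<lambda>i. f (n + i)) sums U n"
    using assms(2) by simp
  then have "((\<lambda>i. f (n + i)) has_sum U n) UNIV"
    using assms(3) by (intro sums_nonneg_imp_has_sum) auto
  moreover have "{n..} = (\<lambda>i. n + i) ` UNIV"
    by (auto simp: image_iff) (metis le_iff_add)
  ultimately show ?thesis
    by (subst \<open>{n..} = _\<close>, subst has_sum_reindex) (auto simp: inj_on_def o_def)
qed

lemma moment_sums:
  assumes "(f has_sum c) {1..}" "f 0 = (0::real)"
  shows "f sums c"
proof -
  have "(f has_sum c) UNIV"
    using assms by (subst has_sum_cong_neutral[where T = "{1..}" and g = f]) (auto simp: not_le)
  then show ?thesis by (rule has_sum_imp_sums)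
qed

definition limit_blob_size :: "real \<Rightarrow> nat pmf" where
  "limit_blob_size p = embed_pmf (\<lambda>k. real k * q p k)"

lemma cubic_bound_tendsto_0:
  assumes p: "0 < p" "p < 1 / 2" and U: "\<And>k. k \<ge> 1 \<Longrightarrow> 0 \<le> U k \<and> U k \<le> C * (q p k * real k ^ 3)"
  shows "U \<longlonglongrightarrow> 0"
proof (rule tendsto_sandwich)
  show "\<forall>\<^sub>F k in sequentially. 0 \<le> U k" "\<forall>\<^sub>F k in sequentially. U k \<le> C * (q p k * real k ^ 3)"
    using U by (auto intro!: eventually_sequentiallyI[of 1])
  show "(\<lambda>k. C * (q p k * real k ^ 3)) \<longlonglongrightarrow> 0"
    using tendsto_mult_left[OF q_cubic_decay[OF p], of C] by simp
qed simp

context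
  fixes p :: real
  assumes p: "0 < p" "p < 1 / 2"
begin

lemma q_pos: "1 \<le> k \<Longrightarrow> 0 < q p k"
  using q_bounds[of p k] p by simp

lemma q_tail_has_sum:
  assumes "1 \<le> n"
  shows "(q p has_sum (q p n * (1 + p * real n))) {n..}"
proof (rule telescoping_has_sum[of "\<lambda>k. q p k * (1 + p * real k)"])
  show "q p k * (1 + p * real k) - q p (Suc k) * (1 + p * real (Suc k)) = q p k" if "n \<le> k" for k
    using q_Suc[of p k] p that assms by (simp add: algebra_simps)
  show "0 \<le> q p k" if "n \<le> k" for k using q_pos[of k] that assms by simp
  show "(\<lambda>k. q p k * (1 + p * real k)) \<longlonglongrightarrow> 0"
  proof (rule cubic_bound_tendsto_0[OF p, where C = 2])
    fix k :: nat assume k: "1 \<le> k"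
    have "p * real k \<le> 1 * real k ^ 3" using p k by (intro mult_mono self_le_power) auto
    moreover have "1 \<le> real k ^ 3" using k by simp
    ultimately have "1 + p * real k \<le> 2 * real k ^ 3" by simp
    from mult_left_mono[OF this less_imp_le[OF q_pos[OF k]]]
    show "0 \<le> q p k * (1 + p * real k) \<and> q p k * (1 + p * real k) \<le> 2 * (q p k * real k ^ 3)"
      using q_pos[OF k] p by simp
  qed
qed

lemma q_tail_asymptotics:
  "(\<lambda>k::nat. \<Sum>\<^sub>\<infinity>l\<in>{k..}. q p l) \<sim>[at_top] (\<lambda>k. (1 - p) * Gamma (1 + 1 / p) * real k powr (- 1 / p))"
proof -
  define G where "G = (1 - p) * Gamma (1 + 1 / p)"
  have G: "G > 0" using p by (simp add: G_def Gamma_real_pos add_pos_pos)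
  have "(\<lambda>k. q p k * real k powr (1 + 1 / p) * (1 / real k + p)) \<longlonglongrightarrow> (1 - p) / p * Gamma (1 + 1 / p) * (0 + p)"
    using p by (intro tendsto_mult q_asymptotics tendsto_add lim_1_over_n) auto
  moreover have "(1 - p) / p * Gamma (1 + 1 / p) * (0 + p) = G" using p by (simp add: G_def)
  ultimately have "(\<lambda>k. q p k * real k powr (1 + 1 / p) * (1 / real k + p)) \<longlonglongrightarrow> G" by simp
  then have "(\<lambda>k. q p k * real k powr (1 + 1 / p) * (1 / real k + p) / G) \<longlonglongrightarrow> G / G"
    using G by (intro tendsto_divide) auto
  moreover have "\<forall>\<^sub>F k in sequentially. q p k * real k powr (1 + 1 / p) * (1 / real k + p) / G =
      (\<Sum>\<^sub>\<infinity>l\<in>{k..}. q p l) / (G * real k powr (- 1 / p))"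
    using eventually_ge_at_top[of 1]
  proof eventually_elim
    case (elim k)
    have "(\<Sum>\<^sub>\<infinity>l\<in>{k..}. q p l) = q p k * (1 + p * real k)"
      using q_tail_has_sum[OF elim] by (rule infsumI)
    moreover have "real k powr (- 1 / p) = inverse (real k powr (1 / p))"
      by (simp add: powr_minus)
    ultimately show ?case using elim G by (simp add: powr_add field_simps)
  qed
  ultimately have "(\<lambda>k. (\<Sum>\<^sub>\<infinity>l\<in>{k..}. q p l) / (G * real k powr (- 1 / p))) \<longlonglongrightarrow> G / G"
    by (rule Lim_transform_eventually)
  then show ?thesis
    unfolding G_def[symmetric] using G by (intro asymp_equivI') simp
qed

lemma q_first_moment: "((\<lambda>k. real k * q p k) has_sum 1) {1..}"
proof -
  have 1: "1 * q p 1 * (1 + p * 1) / (1 - p) = 1"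
    using q_1[of p] p by simp
  have "((\<lambda>k. real k * q p k) has_sum (real 1 * q p 1 * (1 + p * real 1) / (1 - p))) {1..}"
  proof (rule telescoping_has_sum[of "\<lambda>k. real k * q p k * (1 + p * real k) / (1 - p)"])
    show "real k * q p k * (1 + p * real k) / (1 - p) - real (Suc k) * q p (Suc k) * (1 + p * real (Suc k)) / (1 - p) = real k * q p k"
      if "1 \<le> k" for k
    proof -
      have e: "real (Suc k) * q p (Suc k) * (1 + p * real (Suc k)) = real (Suc k) * (p * real k * q p k)"
        using q_Suc[of p k] p that by (simp only: mult.assoc)
      have d: "real k * q p k * (1 + p * real k) - real (Suc k) * (p * real k * q p k) = real k * q p k * (1 - p)"
        by (simp add: algebra_simps)
      show ?thesis unfolding diff_divide_distrib[symmetric] e d using p by simp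
    qed
    show "0 \<le> real k * q p k" if "1 \<le> k" for k using q_pos[OF that] by simp
    show "(\<lambda>k. real k * q p k * (1 + p * real k) / (1 - p)) \<longlonglongrightarrow> 0"
    proof (rule cubic_bound_tendsto_0[OF p, where C = "2 / (1 - p)"])
      fix k :: nat assume k: "1 \<le> k"
      have "p * real k \<le> 1 * real k" "1 \<le> real k" using p k by (auto intro!: mult_right_mono)
      then have "1 + p * real k \<le> 2 * real k" by linarith
      then have "real k * (1 + p * real k) \<le> real k * (2 * real k)" by (intro mult_left_mono) auto
      also have "\<dots> = 2 * real k ^ 2" by (simp add: power2_eq_square)
      also have "\<dots> \<le> 2 * real k ^ 3" using k by (simp add: power_increasing)
      finally have "q p k * (real k * (1 + p * real k)) \<le> q p k * (2 * real k ^ 3)"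
        using q_pos[OF k] by (intro mult_left_mono) auto
      then have "real k * q p k * (1 + p * real k) \<le> 2 * (q p k * real k ^ 3)"
        by (simp only: mult_ac)
      then show "0 \<le> real k * q p k * (1 + p * real k) / (1 - p) \<and>
        real k * q p k * (1 + p * real k) / (1 - p) \<le> 2 / (1 - p) * (q p k * real k ^ 3)"
        using q_pos[OF k] p by (simp add: divide_right_mono)
    qed
  qed
  then show ?thesis unfolding of_nat_1 1 .
qed

lemma q_second_moment: "((\<lambda>k. real k ^ 2 * q p k) has_sum (1 / (1 - 2 * p))) {1..}"
proof -
  \<comment> \<open>The antidifference is sought as
    \<open>k * q p k * (1 + p * k) * (a * k + b)\<close>; comparing coefficients gives
    \<open>a * (1 - 2 * p) = 1\<close> and \<open>b * (1 - p) = p * a\<close>.\<close>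
  define a where "a = 1 / (1 - 2 * p)"
  define b where "b = p * a / (1 - p)"
  have ab: "a > 0" "b > 0" using p by (auto simp: a_def b_def)
  have a: "a - 2 * p * a = 1" using p by (simp add: a_def field_simps)
  have b: "b - p * (a + b) = 0" using p by (simp add: b_def field_simps)
  have "q p 1 * (1 + p) * (a + b) = a"
  proof -
    have "(1 - p) * b = p * a" using p by (simp add: b_def)
    then have "(1 - p) * (a + b) = a" by (simp add: algebra_simps)
    then show ?thesis using q_1[OF p(1)] by simp
  qed
  then have 1: "1 * q p 1 * (1 + p * 1) * (a * 1 + b) = a" by simp
  have "((\<lambda>k. real k ^ 2 * q p k) has_sum (real 1 * q p 1 * (1 + p * real 1) * (a * real 1 + b))) {1..}"
  proof (rule telescoping_has_sum[of "\<lambda>k. real k * q p k * (1 + p * real k) * (a * real k + b)"])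
    show "real k * q p k * (1 + p * real k) * (a * real k + b) -
      real (Suc k) * q p (Suc k) * (1 + p * real (Suc k)) * (a * real (Suc k) + b) = real k ^ 2 * q p k"
      if "1 \<le> k" for k
    proof -
      have e: "real (Suc k) * q p (Suc k) * (1 + p * real (Suc k)) = real (Suc k) * (p * real k * q p k)"
        using q_Suc[of p k] p that by (simp only: mult.assoc)
      have "real k * q p k * (1 + p * real k) * (a * real k + b) -
        real (Suc k) * (p * real k * q p k) * (a * real (Suc k) + b) =
        real k * q p k * (real k * (a - 2 * p * a) + (b - p * (a + b)))"
        by (simp add: algebra_simps)
      then show ?thesis unfolding e a b by (simp add: power2_eq_square)
    qed
    show "0 \<le> real k ^ 2 * q p k" if "1 \<le> k" for k using q_pos[OF that] by simp
    show "(\<lambda>k. real k * q p k * (1 + p * real k) * (a * real k + b)) \<longlonglongrightarrow> 0"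
    proof (rule cubic_bound_tendsto_0[OF p, where C = "2 * (a + b)"])
      fix k :: nat assume k: "1 \<le> k"
      have "p * real k \<le> 1 * real k" "1 \<le> real k" using p k by (auto intro!: mult_right_mono)
      then have 1: "1 + p * real k \<le> 2 * real k" by linarith
      have 2: "a * real k + b \<le> (a + b) * real k" using k ab by (simp add: distrib_right)
      have "real k * ((1 + p * real k) * (a * real k + b)) \<le> real k * ((2 * real k) * ((a + b) * real k))"
        using 1 2 ab p by (intro mult_left_mono mult_mono) auto
      then have "q p k * (real k * ((1 + p * real k) * (a * real k + b))) \<le> q p k * (real k * ((2 * real k) * ((a + b) * real k)))"
        by (rule mult_left_mono) (use q_pos[OF k] in simp)
      also have "\<dots> = 2 * (a + b) * (q p k * real k ^ 3)" by (simp add: eval_nat_numeral)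
      finally have "real k * q p k * (1 + p * real k) * (a * real k + b) \<le> 2 * (a + b) * (q p k * real k ^ 3)"
        by (simp only: mult_ac)
      then show "0 \<le> real k * q p k * (1 + p * real k) * (a * real k + b) \<and>
        real k * q p k * (1 + p * real k) * (a * real k + b) \<le> 2 * (a + b) * (q p k * real k ^ 3)"
        using q_pos[OF k] p ab by simp
    qed
  qed
  then have "((\<lambda>k. real k ^ 2 * q p k) has_sum a) {1..}" unfolding of_nat_1 1 .
  then show ?thesis unfolding a_def .
qed

lemma q_weight_nonneg: "0 \<le> real k * q p k"
  using q_pos[of k] by (cases "k = 0") auto

lemma pmf_limit_blob_size: "pmf (limit_blob_size p) k = real k * q p k"
  unfolding limit_blob_size_def
proof (rule pmf_embed_pmf)
  have "(\<integral>\<^sup>+ k. ennreal (real k * q p k) \<partial>count_space UNIV) = (\<Sum>k. ennreal (real k * q p k))"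
    by (rule nn_integral_count_space_nat)
  also have "\<dots> = ennreal 1"
    by (intro suminf_ennreal_eq q_weight_nonneg moment_sums q_first_moment) simp
  finally show "(\<integral>\<^sup>+ k. ennreal (real k * q p k) \<partial>count_space UNIV) = 1" by simp
qed (rule q_weight_nonneg)

lemma limit_blob_size_mean:
  "integrable (measure_pmf (limit_blob_size p)) real"
  "measure_pmf.expectation (limit_blob_size p) real = 1 / (1 - 2 * p)"
proof -
  have "(\<integral>\<^sup>+ k. ennreal (real k) \<partial>measure_pmf (limit_blob_size p)) =
    (\<integral>\<^sup>+ k. ennreal (pmf (limit_blob_size p) k) * ennreal (real k) \<partial>count_space UNIV)"
    by (rule nn_integral_measure_pmf)
  also have "\<dots> = (\<integral>\<^sup>+ k. ennreal (real k ^ 2 * q p k) \<partial>count_space UNIV)"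
    by (intro nn_integral_cong)
       (simp add: pmf_limit_blob_size ennreal_mult[symmetric] q_weight_nonneg power2_eq_square mult_ac)
  also have "\<dots> = (\<Sum>k. ennreal (real k ^ 2 * q p k))"
    by (rule nn_integral_count_space_nat)
  also have "\<dots> = ennreal (1 / (1 - 2 * p))"
  proof (intro suminf_ennreal_eq moment_sums q_second_moment)
    show "0 \<le> real k ^ 2 * q p k" for k
      using q_weight_nonneg[of k] by (cases "k = 0") (auto simp: zero_le_mult_iff)
  qed simp
  finally have "has_bochner_integral (measure_pmf (limit_blob_size p)) real (1 / (1 - 2 * p))"
    using p by (intro has_bochner_integral_nn_integral) auto
  then show "integrable (measure_pmf (limit_blob_size p)) real"
    "measure_pmf.expectation (limit_blob_size p) real = 1 / (1 - 2 * p)"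
    by (auto simp: has_bochner_integral_iff)
qed

end

section \<open>Full components as explorations\<close>

lemma prob_bind_finite:
  assumes "finite (set_pmf M)" "\<And>x. x \<in> set_pmf M \<Longrightarrow> finite (set_pmf (f x))"
  shows "measure_pmf.prob (bind_pmf M f) A = measure_pmf.expectation M (\<lambda>x. measure_pmf.prob (f x) A)"
  by (simp add: expectation_bind_finite[OF assms, where h = "indicator A", simplified])

lemma random_shortcuts_disjoint:
  assumes "(T, F) \<in> set_pmf (perc_tree p n)" "S \<in> set_pmf (random_edge_subset r (vertex_pairs n - T))"
  shows "(F \<union> S) \<inter> T = F"
  using perc_tree_support(4)[OF assms(1)] set_random_edge_subset[OF assms(2)] by auto

context
  fixes p lam :: real and n :: nat
  assumes p: "0 \<le> p" "p \<le> 1" and lam: "0 \<le> lam" "lam \<le> real n" and n: "n \<ge> 1"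
begin

text \<open>Conditioning on the tree and its percolation: by thinning, the retained shortcuts
  outside \<open>T\<close> form a fresh independent edge set, so an event about blobs and components
  becomes an average of probabilities over shortcuts alone.\<close>

lemma prob_percolation_model:
  "measure_pmf.prob (percolation_model lam p n) {\<omega>. Q (retained_tree_edges \<omega>) (retained_edges \<omega>)} =
   measure_pmf.expectation (perc_tree p n) (\<lambda>(T, F).
     measure_pmf.prob (random_edge_subset (p * (lam / real n)) (vertex_pairs n - T)) {S. Q F (F \<union> S)})"
proof -
  let ?r = "p * (lam / real n)"
  let ?sc = "\<lambda>T. random_edge_subset ?r (vertex_pairs n - T)"
  have "{\<omega>. Q (retained_tree_edges \<omega>) (retained_edges \<omega>)} = (\<lambda>(T, H, R). (T, R)) -` {(T, R). Q (R \<inter> T) R}"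
    by (auto simp: retained_tree_edges_def retained_edges_def)
  then have "measure_pmf.prob (percolation_model lam p n) {\<omega>. Q (retained_tree_edges \<omega>) (retained_edges \<omega>)} =
    measure_pmf.prob (map_pmf (\<lambda>(T, H, R). (T, R)) (percolation_model lam p n)) {(T, R). Q (R \<inter> T) R}"
    by simp
  also have "map_pmf (\<lambda>(T, H, R). (T, R)) (percolation_model lam p n) =
    bind_pmf (perc_tree p n) (\<lambda>x. map_pmf (\<lambda>S. (fst x, snd x \<union> S)) (?sc (fst x)))"
    unfolding percolation_model_decomposition[OF p lam n]
    by (simp add: case_prod_beta' map_pmf_def)
  also have "measure_pmf.prob \<dots> {(T, R). Q (R \<inter> T) R} = measure_pmf.expectation (perc_tree p n)
    (\<lambda>x. measure_pmf.prob (map_pmf (\<lambda>S. (fst x, snd x \<union> S)) (?sc (fst x))) {(T, R). Q (R \<inter> T) R})"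
  proof (rule prob_bind_finite[OF finite_perc_tree])
    have "finite (set_pmf (?sc T))" for T
      by (intro finite_random_edge_subset finite_Diff finite_vertex_pairs)
    then show "finite (set_pmf (map_pmf (\<lambda>S. (fst x, snd x \<union> S)) (?sc (fst x))))" for x
      by (simp only: set_map_pmf finite_imageI)
  qed
  also have "\<dots> = measure_pmf.expectation (perc_tree p n) (\<lambda>(T, F). measure_pmf.prob (?sc T) {S. Q F (F \<union> S)})"
  proof (rule expectation_cong_pmf, clarify)
    fix T F assume TF: "(T, F) \<in> set_pmf (perc_tree p n)"
    have "measure_pmf.prob (?sc T) {S. Q ((F \<union> S) \<inter> T) (F \<union> S)} = measure_pmf.prob (?sc T) {S. Q F (F \<union> S)}"
      by (rule measure_pmf.finite_measure_eq_AE)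
         (auto simp: AE_measure_pmf_iff random_shortcuts_disjoint[OF TF])
    then show "measure_pmf.prob (map_pmf (\<lambda>S. (fst (T, F), snd (T, F) \<union> S)) (?sc (fst (T, F)))) {(T, R). Q (R \<inter> T) R} =
      measure_pmf.prob (?sc T) {S. Q F (F \<union> S)}"
      by (simp add: vimage_def)
  qed
  finally show ?thesis .
qed

lemma prob_percolation_model_blobs:
  "measure_pmf.prob (percolation_model lam p n) {\<omega>. Q (blobs n \<omega>)} = measure_pmf.prob (blob_pmf p n) {P. Q P}"
proof -
  have "measure_pmf.prob (percolation_model lam p n) {\<omega>. Q (blobs n \<omega>)} =
    measure_pmf.expectation (perc_tree p n) (\<lambda>(T, F). measure_pmf.prob
      (random_edge_subset (p * (lam / real n)) (vertex_pairs n - T)) {S. Q (graph_components {1..n} F)})"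
    unfolding blobs_def by (rule prob_percolation_model)
  also have "\<dots> = measure_pmf.expectation (perc_tree p n) (indicator {(T, F). Q (graph_components {1..n} F)})"
    by (intro expectation_cong_pmf) (auto simp: indicator_def)
  also have "\<dots> = measure_pmf.prob (blob_pmf p n) {P. Q P}"
    by (simp add: blob_pmf_def vimage_def case_prod_beta')
  finally show ?thesis .
qed

text \<open>Reduces high-probability statements to bounds over the shortcuts that are uniform in all
  blob partitions satisfying \<open>G\<close>.\<close>

lemma prob_percolation_model_le:
  assumes good: "\<And>T F. (T, F) \<in> set_pmf (perc_tree p n) \<Longrightarrow> G (graph_components {1..n} F) \<Longrightarrow>
      measure_pmf.prob (random_edge_subset (p * (lam / real n)) (vertex_pairs n - T)) {S. Q F (F \<union> S)} \<le> \<beta>"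
    and "0 \<le> \<beta>"
  shows "measure_pmf.prob (percolation_model lam p n) {\<omega>. Q (retained_tree_edges \<omega>) (retained_edges \<omega>)}
    \<le> measure_pmf.prob (blob_pmf p n) {P. \<not> G P} + \<beta>"
proof -
  have "measure_pmf.prob (percolation_model lam p n) {\<omega>. Q (retained_tree_edges \<omega>) (retained_edges \<omega>)} \<le>
    measure_pmf.expectation (perc_tree p n) (\<lambda>x. indicator {(T, F). \<not> G (graph_components {1..n} F)} x + \<beta>)"
    unfolding prob_percolation_model
  proof (rule expectation_mono_finite[OF finite_perc_tree], clarify)
    fix T F assume TF: "(T, F) \<in> set_pmf (perc_tree p n)"
    show "measure_pmf.prob (random_edge_subset (p * (lam / real n)) (vertex_pairs n - T)) {S. Q F (F \<union> S)}
      \<le> indicator {(T, F). \<not> G (graph_components {1..n} F)} (T, F) + \<beta>"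
      using good[OF TF] \<open>0 \<le> \<beta>\<close> measure_pmf.prob_le_1
      by (cases "G (graph_components {1..n} F)") (auto intro: add_increasing2)
  qed
  also have "\<dots> = measure_pmf.expectation (perc_tree p n) (indicator {(T, F). \<not> G (graph_components {1..n} F)}) + \<beta>"
    by (subst Bochner_Integration.integral_add) (auto intro: integrable_measure_pmf_finite finite_perc_tree)
  also have "measure_pmf.expectation (perc_tree p n) (indicator {(T, F). \<not> G (graph_components {1..n} F)} :: _ \<Rightarrow> real) =
    measure_pmf.prob (blob_pmf p n) {P. \<not> G P}"
    by (simp add: blob_pmf_def vimage_def case_prod_beta')
  finally show ?thesis .
qed

end

lemma reach_block_closed:
  assumes bf: "block_family A BB" and x: "x \<in> reach BB S A" "x \<in> B" "B \<in> BB"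
  shows "B \<subseteq> reach BB S A"
  using x(1)
proof cases
  case base
  then show ?thesis using block_family_disjoint(1)[OF bf x(3)] x(2) by auto
next
  case (step u y C)
  then have "C = B" using block_family_disjoint(2)[OF bf x(3), of C] x(2) by auto
  then show ?thesis using step by (auto intro: reach.step)
qed

lemma block_family_of_partition:
  assumes P: "partition_on {1..n} P" and A: "A \<in> P"
  shows "block_family A (P - {A})"
proof -
  note f = partition_upto_facts[OF P]
  have "B \<inter> C = {}" if "B \<in> P" "C \<in> P" "B \<noteq> C" for B C
    using partition_on_disjointD[OF P that(1,2)] that(3) by auto
  then show ?thesis using f A by (auto simp: block_family_def)
qed

lemma block_family_mono:
  assumes "block_family A BB" "CC \<subseteq> BB"
  shows "block_family A CC"
proof -
  have "finite CC"
    by (rule finite_subset[OF assms(2)]) (use assms(1) in \<open>simp add: block_family_def\<close>)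
  moreover have "finite B \<and> B \<inter> A = {}" if "B \<in> CC" for B
    using assms(1) subsetD[OF assms(2) that] by (simp add: block_family_def)
  moreover have "B \<inter> C = {}" if "B \<in> CC" "C \<in> CC" "B \<noteq> C" for B C
    using assms(1) subsetD[OF assms(2) that(1)] subsetD[OF assms(2) that(2)] that(3)
    by (simp add: block_family_def)
  ultimately show ?thesis using assms(1) by (simp add: block_family_def)
qed

text \<open>Retained tree edges never leave a blob, so passing to another blob takes a shortcut, and
  the blob entered is connected as a whole. This identifies full components with
  explorations.\<close>

lemma reach_eq_component:
  assumes F: "\<Union>F \<subseteq> {1..n}" and S: "\<Union>S \<subseteq> {1..n}"
    and A: "A \<in> graph_components {1..n} F" and v: "v \<in> A"
  shows "reach (graph_components {1..n} F - {A}) S A = component_of {1..n} (F \<union> S) v"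
proof
  let ?P = "graph_components {1..n} F" and ?R = "edge_rel (F \<union> S)"
  have P: "partition_on {1..n} ?P" by (rule partition_on_graph_components)
  note bf = block_family_of_partition[OF P A]
  have conn: "(x, y) \<in> ?R\<^sup>*" if "B \<in> ?P" "x \<in> B" "y \<in> B" for B x y
    using graph_components_connected[OF that] by (rule edge_rel_rtrancl_mono[rotated]) simp
  have vA: "v \<in> {1..n}" using graph_component_subset[OF A] v by auto
  show "reach (?P - {A}) S A \<subseteq> component_of {1..n} (F \<union> S) v"
  proof
    fix x assume "x \<in> reach (?P - {A}) S A"
    then have "(v, x) \<in> ?R\<^sup>* \<and> x \<in> {1..n}"
    proof induction
      case (base a)
      then show ?case using conn[OF A v] graph_component_subset[OF A] by auto
    next
      case (step x y B z)
      have "(v, x) \<in> ?R\<^sup>*" using step.IH by simp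
      also have "(x, y) \<in> ?R" using step.hyps by simp
      also have "(y, z) \<in> ?R\<^sup>*" using conn[of B y z] step.hyps by simp
      finally show ?case using graph_component_subset[of B "{1..n}" F] step.hyps by auto
    qed
    then show "x \<in> component_of {1..n} (F \<union> S) v" by (simp add: component_of_def)
  qed
  show "component_of {1..n} (F \<union> S) v \<subseteq> reach (?P - {A}) S A"
  proof
    fix x assume "x \<in> component_of {1..n} (F \<union> S) v"
    then have "(v, x) \<in> ?R\<^sup>*" by (simp add: component_of_def)
    then show "x \<in> reach (?P - {A}) S A"
    proof (induction rule: rtrancl_induct)
      case base
      show ?case using v by (rule reach.base)
    next
      case (step u w)
      have uw: "{u, w} \<in> F \<union> S" using step(2) by simp
      have "{u, w} \<subseteq> {1..n}" using uw F S by auto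
      then have w: "w \<in> {1..n}" and u: "u \<in> {1..n}" by auto
      show ?case
      proof (cases "{u, w} \<in> F")
        case True
        have B: "component_of {1..n} F u \<in> ?P" "u \<in> component_of {1..n} F u"
          using component_in_graph_components[OF u] component_of_self[OF u] by auto
        have wB: "w \<in> component_of {1..n} F u"
          by (rule graph_components_closed[OF F B True])
        show ?thesis
        proof (cases "component_of {1..n} F u = A")
          case True
          then show ?thesis using wB by (auto intro: reach.base)
        next
          case False
          then have "component_of {1..n} F u \<in> ?P - {A}" using B(1) by simp
          from reach_block_closed[OF bf step(3) B(2) this] wB show ?thesis by auto
        qed
      next
        case False
        then have S: "{u, w} \<in> S" using uw by simp
        have B: "component_of {1..n} F w \<in> ?P" "w \<in> component_of {1..n} F w"
          using component_in_graph_components[OF w] component_of_self[OF w] by auto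
        show ?thesis
        proof (cases "component_of {1..n} F w = A")
          case True
          then show ?thesis using B(2) by (auto intro: reach.base)
        next
          case False
          then have "component_of {1..n} F w \<in> ?P - {A}" using B(1) by simp
          from reach.step[OF step(3) S B(2) this B(2)] show ?thesis .
        qed
      qed
    qed
  qed
qed

text \<open>A block that is absorbed lies in the explored set, so deleting blocks that do not lie in
  it loses nothing. For a component without large blobs this confines the exploration to the small
  ones.\<close>

lemma reach_restrict:
  assumes "\<And>B. B \<in> BB \<Longrightarrow> B \<subseteq> reach BB S A \<Longrightarrow> B \<in> CC"
  shows "reach BB S A \<subseteq> reach CC S A"
proof
  fix x assume "x \<in> reach BB S A"
  then show "x \<in> reach CC S A"
  proof induction
    case (step x y B z)
    have "B \<subseteq> reach BB S A" using step by (auto intro: reach.step)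
    then show ?case using step assms by (auto intro: reach.step)
  qed (rule reach.base)
qed

section \<open>Drift conditions of the exponential bounds\<close>

lemma exp_quadratic_upper:
  fixes x :: real
  assumes "0 \<le> x"
  shows "exp x - 1 \<le> x + x\<^sup>2 * exp x"
proof -
  have "(1 - x) * exp x \<le> exp (- x) * exp x"
    using exp_ge_add_one_self[of "- x"] by (intro mult_right_mono) auto
  then have 1: "exp x - 1 \<le> x * exp x" by (simp add: exp_minus algebra_simps)
  then have "x * (exp x - 1) \<le> x * (x * exp x)" using assms by (intro mult_left_mono)
  with 1 show ?thesis by (simp add: power2_eq_square algebra_simps)
qed

lemma exp_quadratic_lower:
  fixes x :: real
  assumes "0 \<le> x"
  shows "x - x\<^sup>2 \<le> 1 - exp (- x)"
proof -
  have "(1 + x) * exp (- x) \<le> exp x * exp (- x)"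
    by (intro mult_right_mono) auto
  then have "exp (- x) * (1 + x) \<le> 1" by (simp add: exp_minus mult.commute)
  then have "exp (- x) \<le> 1 / (1 + x)" using assms by (simp add: pos_le_divide_eq)
  also have "1 / (1 + x) \<le> 1 - x + x\<^sup>2"
  proof -
    have "1 \<le> (1 - x + x\<^sup>2) * (1 + x)" using assms by (simp add: power2_eq_square algebra_simps)
    then show ?thesis using assms by (simp add: pos_divide_le_eq)
  qed
  finally show ?thesis by simp
qed

lemma ln_powr_tendsto_0:
  assumes "0 < \<gamma>"
  shows "(\<lambda>n. ln (real n) * real n powr (- \<gamma>)) \<longlonglongrightarrow> 0"
  using lim_ln_over_power[OF assms] by (simp add: powr_minus divide_inverse)

lemma powr_minus_tendsto_0:
  assumes "0 < \<gamma>"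
  shows "(\<lambda>n. real n powr (- \<gamma>)) \<longlonglongrightarrow> 0"
  by (intro tendsto_neg_powr filterlim_real_sequentially) (use assms in simp)

text \<open>The exponents in the exponential moment bounds: \<open>a ln n / n\<^sup>p\<close> for the upper and
  \<open>n\<^sup>-\<^sup>p\<^sup>/\<^sup>2\<close> for the lower tail.\<close>

lemma eventually_upper_condition:
  fixes c \<xi> \<kappa> a m \<epsilon> p :: real
  assumes c: "0 \<le> c" and \<kappa>: "0 < \<kappa>" and a: "0 < a" and m: "0 \<le> m" "a * m < \<epsilon>" and p: "0 < p"
  shows "\<forall>\<^sub>F n in sequentially. \<forall>P BB. finite P \<longrightarrow> BB \<subseteq> P \<longrightarrow>
    (\<Sum>B\<in>P. real (card B) ^ 2) \<le> (\<xi> + \<kappa>) * real n \<longrightarrow>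
    (\<Sum>B\<in>P. real (card B) ^ 3) \<le> real n powr (1 + p - \<epsilon>) \<longrightarrow>
    (\<forall>B\<in>BB. real (card B) \<le> m * real n powr p) \<longrightarrow>
    a * ln (real n) / real n powr p * (1 - c * \<xi> - 2 * (c * \<kappa>)) +
      (\<Sum>B\<in>BB. real (card B) * (c / real n * (exp (a * ln (real n) / real n powr p * real (card B)) - 1)))
      \<le> a * ln (real n) / real n powr p"
proof -
  have "(\<lambda>n. a * (ln (real n) * real n powr (- (\<epsilon> - a * m)))) \<longlonglongrightarrow> a * 0"
    using m by (intro tendsto_mult tendsto_const ln_powr_tendsto_0) auto
  then have "\<forall>\<^sub>F n in sequentially. a * (ln (real n) * real n powr (- (\<epsilon> - a * m))) < \<kappa>"
    using \<kappa> by (intro order_tendstoD(2)[of _ 0]) auto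
  then show ?thesis
    using eventually_ge_at_top[of 1]
  proof eventually_elim
    case (elim n)
    define s where "s = a * ln (real n) / real n powr p"
    have n: "0 < real n" using elim by simp
    have s: "0 \<le> s" using a elim by (simp add: s_def)
    show ?case
      unfolding s_def[symmetric]
    proof (intro allI impI)
      fix P BB :: "'a set set"
      assume P: "finite P" "BB \<subseteq> P" and sq: "(\<Sum>B\<in>P. real (card B) ^ 2) \<le> (\<xi> + \<kappa>) * real n"
        and cb: "(\<Sum>B\<in>P. real (card B) ^ 3) \<le> real n powr (1 + p - \<epsilon>)"
        and mx: "\<forall>B\<in>BB. real (card B) \<le> m * real n powr p"
      \<comment> \<open>\<open>Y\<close> bounds \<open>exp (s * card B)\<close> for blocks up to
        \<open>m * n powr p\<close>. The quadratic remainder then costs, relative to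
        \<open>s\<close>, a multiple of \<open>s * Y * n powr (p - \<epsilon>)\<close>, which tends
        to 0 because \<open>a * m < \<epsilon>\<close>.\<close>
      define Y where "Y = real n powr (a * m)"
      have trm: "real (card B) * (c / real n * (exp (s * real (card B)) - 1)) \<le>
         c / real n * (s * real (card B) ^ 2 + s\<^sup>2 * Y * real (card B) ^ 3)" if B: "B \<in> BB" for B
      proof -
        have "s * real (card B) \<le> s * (m * real n powr p)" using mx B s by (intro mult_left_mono) auto
        also have "\<dots> = a * m * ln (real n)" using n by (simp add: s_def)
        finally have "exp (s * real (card B)) \<le> Y" using n by (simp add: Y_def powr_def)
        then have "s * real (card B) + (s * real (card B))\<^sup>2 * exp (s * real (card B)) \<le>
            s * real (card B) + (s * real (card B))\<^sup>2 * Y"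
          by (intro add_left_mono mult_left_mono) auto
        with exp_quadratic_upper[of "s * real (card B)"] s
        have "exp (s * real (card B)) - 1 \<le> s * real (card B) + (s * real (card B))\<^sup>2 * Y" by simp
        then have "c / real n * real (card B) * (exp (s * real (card B)) - 1) \<le>
           c / real n * real (card B) * (s * real (card B) + (s * real (card B))\<^sup>2 * Y)"
          using c n by (intro mult_left_mono) auto
        also have "\<dots> = c / real n * (s * real (card B) ^ 2 + s\<^sup>2 * Y * real (card B) ^ 3)"
          by (simp add: eval_nat_numeral algebra_simps)
        finally show ?thesis by (simp add: mult_ac)
      qed
      have "(\<Sum>B\<in>BB. real (card B) * (c / real n * (exp (s * real (card B)) - 1))) \<le>
        (\<Sum>B\<in>BB. c / real n * (s * real (card B) ^ 2 + s\<^sup>2 * Y * real (card B) ^ 3))"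
        by (intro sum_mono trm)
      also have "\<dots> \<le> (\<Sum>B\<in>P. c / real n * (s * real (card B) ^ 2 + s\<^sup>2 * Y * real (card B) ^ 3))"
        using P c n s by (intro sum_mono2) (auto simp: Y_def)
      also have "\<dots> = c / real n * (s * (\<Sum>B\<in>P. real (card B) ^ 2) + s\<^sup>2 * Y * (\<Sum>B\<in>P. real (card B) ^ 3))"
        by (simp only: sum_distrib_left[symmetric] sum.distrib)
      also have "\<dots> \<le> c / real n * (s * ((\<xi> + \<kappa>) * real n) + s\<^sup>2 * Y * real n powr (1 + p - \<epsilon>))"
        using sq cb c n s by (intro mult_left_mono add_mono) (auto simp: Y_def)
      also have "\<dots> = s * (c * (\<xi> + \<kappa>) + c * (s * (Y * real n powr (p - \<epsilon>))))"
        using n by (simp add: powr_add powr_diff power2_eq_square field_simps)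
      also have "s * (Y * real n powr (p - \<epsilon>)) = a * (ln (real n) * real n powr (- (\<epsilon> - a * m)))"
        using n by (simp add: s_def Y_def powr_add powr_diff powr_minus field_simps)
      also have "s * (c * (\<xi> + \<kappa>) + c * \<dots>) \<le> s * (c * (\<xi> + \<kappa>) + c * \<kappa>)"
        using elim c s by (intro mult_left_mono add_left_mono) auto
      finally show "s * (1 - c * \<xi> - 2 * (c * \<kappa>)) +
        (\<Sum>B\<in>BB. real (card B) * (c / real n * (exp (s * real (card B)) - 1))) \<le> s"
        by (simp add: algebra_simps)
    qed
  qed
qed

text \<open>For blocks bounded by \<open>L\<close> the remainder of the exponential is, relative to
  \<open>s\<close>, of order \<open>s * L\<close>, and the depletion term is of order
  \<open>n powr (p - 1)\<close>. Both fit into the slack \<open>3 * c * \<kappa>\<close>, a third of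
  which is spent on the error of the susceptibility.\<close>

lemma eventually_lower_condition:
  fixes c \<xi> \<kappa> X L p :: real
  assumes c: "0 < c" and \<kappa>: "0 < \<kappa>" "\<kappa> < \<xi>" and X: "0 \<le> X" and L: "0 \<le> L" and p: "0 < p" "p < 1"
  shows "\<forall>\<^sub>F n in sequentially. \<forall>BB x. finite BB \<longrightarrow> x \<le> X * real n powr p \<longrightarrow>
    (\<xi> - \<kappa>) * real n \<le> (\<Sum>B\<in>BB. real (card B) ^ 2) \<longrightarrow> (\<forall>B\<in>BB. real (card B) \<le> L) \<longrightarrow>
    real n powr (- (p / 2)) + 2 * x * (c / real n * (real n powr (- (p / 2)) * L)) \<le>
      real n powr (- (p / 2)) * (1 - c * \<xi> + 3 * (c * \<kappa>)) +
      (\<Sum>B\<in>BB. real (card B) * (c / real n * (1 - exp (- (real n powr (- (p / 2))) * real (card B)))))"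
proof -
  have "(\<lambda>n. 2 * X * c * L * real n powr (- (1 - p)) + c * \<xi> * L * real n powr (- (p / 2)))
    \<longlonglongrightarrow> 2 * X * c * L * 0 + c * \<xi> * L * 0"
    using p by (intro tendsto_add tendsto_mult tendsto_const powr_minus_tendsto_0) auto
  then have "\<forall>\<^sub>F n in sequentially. 2 * X * c * L * real n powr (- (1 - p)) + c * \<xi> * L * real n powr (- (p / 2)) < 2 * (c * \<kappa>)"
    using \<kappa> c by (intro order_tendstoD(2)[of _ 0]) auto
  then show ?thesis
    using eventually_ge_at_top[of 1]
  proof eventually_elim
    case (elim n)
    define s where "s = real n powr (- (p / 2))"
    have n: "0 < real n" using elim by simp
    have s: "0 < s" using n by (simp add: s_def)
    show ?case
      unfolding s_def[symmetric]
    proof (intro allI impI)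
      fix BB :: "'a set set" and x :: real
      assume fin: "finite BB" and x: "x \<le> X * real n powr p"
        and low: "(\<xi> - \<kappa>) * real n \<le> (\<Sum>B\<in>BB. real (card B) ^ 2)" and L': "\<forall>B\<in>BB. real (card B) \<le> L"
      have trm: "c / real n * (s * (1 - s * L) * real (card B) ^ 2) \<le>
          real (card B) * (c / real n * (1 - exp (- s * real (card B))))" if B: "B \<in> BB" for B
      proof -
        have "s * (1 - s * L) * real (card B) ^ 2 \<le> s * (1 - s * real (card B)) * real (card B) ^ 2"
          using L' B s by (intro mult_right_mono mult_left_mono) auto
        also have "\<dots> = real (card B) * (s * real (card B) - (s * real (card B))\<^sup>2)"
          by (simp add: power2_eq_square algebra_simps)
        also have "\<dots> \<le> real (card B) * (1 - exp (- (s * real (card B))))"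
          using s by (intro mult_left_mono exp_quadratic_lower) auto
        finally have "c / real n * (s * (1 - s * L) * real (card B) ^ 2) \<le>
            c / real n * (real (card B) * (1 - exp (- (s * real (card B)))))"
          using c n by (intro mult_left_mono) auto
        then show ?thesis by (simp add: mult_ac)
      qed
      have small: "2 * X * c * L * real n powr (- (1 - p)) + c * \<xi> * L * s < 2 * (c * \<kappa>)"
        using elim(1) by (simp add: s_def)
      have "(1 - s * L) * (c * (\<xi> - \<kappa>)) \<ge> c * (\<xi> - \<kappa>) - s * L * (c * \<xi>)"
      proof -
        have "s * L * (c * \<kappa>) \<ge> 0" using s L c \<kappa> by simp
        then show ?thesis by (simp add: algebra_simps)
      qed
      have 1: "s * (c * (\<xi> - \<kappa>) - s * L * (c * \<xi>)) \<le> (\<Sum>B\<in>BB. real (card B) * (c / real n * (1 - exp (- s * real (card B)))))"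
      \<comment> \<open>The lower bound on the square sum may be multiplied by
        \<open>1 - s * L\<close> only if this factor is nonnegative; otherwise the left side is
        already nonpositive.\<close>
      proof (cases "s * L \<le> 1")
        case True
        have "s * (c * (\<xi> - \<kappa>) - s * L * (c * \<xi>)) \<le> s * ((1 - s * L) * (c * (\<xi> - \<kappa>)))"
          using \<open>(1 - s * L) * (c * (\<xi> - \<kappa>)) \<ge> c * (\<xi> - \<kappa>) - s * L * (c * \<xi>)\<close> s by (intro mult_left_mono) auto
        also have "\<dots> = c / real n * (s * (1 - s * L) * ((\<xi> - \<kappa>) * real n))" using n by simp
        also have "\<dots> \<le> c / real n * (s * (1 - s * L) * (\<Sum>B\<in>BB. real (card B) ^ 2))"
          using low c n s True by (intro mult_left_mono) auto
        also have "\<dots> = (\<Sum>B\<in>BB. c / real n * (s * (1 - s * L) * real (card B) ^ 2))"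
          by (simp add: sum_distrib_left)
        also have "\<dots> \<le> (\<Sum>B\<in>BB. real (card B) * (c / real n * (1 - exp (- s * real (card B)))))"
          by (intro sum_mono trm)
        finally show ?thesis .
      next
        case False
        have "c * (\<xi> - \<kappa>) \<le> 1 * (c * \<xi>)" using c \<kappa> by simp
        also have "\<dots> \<le> s * L * (c * \<xi>)" using False c \<kappa> by (intro mult_right_mono) auto
        finally have "s * (c * (\<xi> - \<kappa>) - s * L * (c * \<xi>)) \<le> 0" using s by (simp add: mult_le_0_iff)
        also have "0 \<le> (\<Sum>B\<in>BB. real (card B) * (c / real n * (1 - exp (- s * real (card B)))))"
          using c n s by (intro sum_nonneg mult_nonneg_nonneg) auto
        finally show ?thesis .
      qed
      have "x * (2 * c / real n * (s * L)) \<le> X * real n powr p * (2 * c / real n * (s * L))"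
        using x c n s L by (intro mult_right_mono) auto
      also have "\<dots> = s * (2 * X * c * L * real n powr (- (1 - p)))"
        using n by (simp add: powr_diff powr_minus field_simps)
      finally have 2: "2 * x * (c / real n * (s * L)) \<le> s * (2 * X * c * L * real n powr (- (1 - p)))"
        by (simp add: mult_ac)
      have "s * (2 * X * c * L * real n powr (- (1 - p)) + c * \<xi> * L * s) \<le> s * (2 * (c * \<kappa>))"
        using small s by (intro mult_left_mono) auto
      then have "s * (2 * X * c * L * real n powr (- (1 - p))) \<le>
          s * (1 - c * \<xi> + 3 * (c * \<kappa>)) - s + s * (c * (\<xi> - \<kappa>) - s * L * (c * \<xi>))"
        by (simp add: algebra_simps)
      with 1 2 show "s + 2 * x * (c / real n * (s * L)) \<le>
        s * (1 - c * \<xi> + 3 * (c * \<kappa>)) + (\<Sum>B\<in>BB. real (card B) * (c / real n * (1 - exp (- s * real (card B)))))"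
        by linarith
    qed
  qed
qed

section \<open>Typical blob configurations\<close>

lemma prob_mono_pmf:
  assumes "\<And>x. x \<in> set_pmf M \<Longrightarrow> A x \<Longrightarrow> B x"
  shows "measure_pmf.prob M {x. A x} \<le> measure_pmf.prob M {x. B x}"
  using assms by (intro measure_pmf.finite_measure_mono_AE) (auto simp: AE_measure_pmf_iff)

lemma prob_disj_le:
  "measure_pmf.prob M {x. A x \<or> B x} \<le> measure_pmf.prob M {x. A x} + measure_pmf.prob M {x. B x}"
  unfolding Collect_disj_eq by (rule measure_Un_le) auto

lemma prob_Bex_le:
  assumes "finite I"
  shows "measure_pmf.prob M {x. \<exists>i\<in>I. A i x} \<le> (\<Sum>i\<in>I. measure_pmf.prob M {x. A i x})"
proof -
  have "{x. \<exists>i\<in>I. A i x} = (\<Union>i\<in>I. {x. A i x})" by auto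
  then show ?thesis by (simp add: measure_UNION_le[OF assms])
qed

lemma power_le_pochhammer:
  fixes w :: real
  assumes "0 \<le> w"
  shows "w ^ r \<le> pochhammer w r"
proof (induction r)
  case (Suc r)
  have "0 \<le> pochhammer w r" using Suc zero_le_power[OF assms, of r] by linarith
  then have "w ^ r * w \<le> pochhammer w r * (w + real r)"
    using Suc assms by (intro mult_mono) auto
  then show ?case by (simp add: pochhammer_Suc mult.commute)
qed simp

lemma power_moment_prob:
  assumes "0 < c"
  shows "measure_pmf.prob (blob_pmf p n) {P. c < (\<Sum>B\<in>P. real (card B) ^ r)} \<le> late_moment p r 0 n / c"
  unfolding late_moment_def
proof (rule prob_le_expectation_finite[OF finite_blob_pmf _ _ assms])
  fix P :: "nat set set"
  have le: "(\<Sum>B\<in>P. real (card B) ^ r) \<le> (\<Sum>B\<in>P. if B \<inter> {1..0} = {} then pochhammer (real (card B)) r else 0)"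
    by (intro sum_mono) (simp add: power_le_pochhammer)
  have "0 \<le> (\<Sum>B\<in>P. real (card B) ^ r)" by (intro sum_nonneg) simp
  with le show "0 \<le> (\<Sum>B\<in>P. if B \<inter> {1..0} = {} then pochhammer (real (card B)) r else 0)" by simp
  show "c \<le> (\<Sum>B\<in>P. if B \<inter> {1..0} = {} then pochhammer (real (card B)) r else 0)"
    if "P \<in> {P. c < (\<Sum>B\<in>P. real (card B) ^ r)}"
    using that le by simp
qed

lemma late_block_prob:
  assumes x: "0 < x"
  shows "measure_pmf.prob (blob_pmf p n) {P. \<exists>B\<in>P. B \<inter> {1..k} = {} \<and> x \<le> real (card B)}
    \<le> late_moment p r k n / x ^ r"
  unfolding late_moment_def
proof (rule prob_le_expectation_finite[OF finite_blob_pmf])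
  fix P :: "nat set set"
  assume P: "P \<in> set_pmf (blob_pmf p n)"
  have nn: "0 \<le> (if B \<inter> {1..k} = {} then pochhammer (real (card B)) r else 0)" for B
  proof -
    have "0 \<le> real (card B) ^ r" by simp
    also have "\<dots> \<le> pochhammer (real (card B)) r" by (rule power_le_pochhammer) simp
    finally show ?thesis by simp
  qed
  then show "0 \<le> (\<Sum>B\<in>P. if B \<inter> {1..k} = {} then pochhammer (real (card B)) r else 0)"
    by (intro sum_nonneg)
  assume "P \<in> {P. \<exists>B\<in>P. B \<inter> {1..k} = {} \<and> x \<le> real (card B)}"
  then obtain B where B: "B \<in> P" "B \<inter> {1..k} = {}" "x \<le> real (card B)" by auto
  have "x ^ r \<le> real (card B) ^ r" using B x by (intro power_mono) auto
  also have "\<dots> \<le> pochhammer (real (card B)) r" by (rule power_le_pochhammer) simp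
  also have "\<dots> = (if B \<inter> {1..k} = {} then pochhammer (real (card B)) r else 0)" using B by simp
  also have "\<dots> \<le> (\<Sum>B\<in>P. if B \<inter> {1..k} = {} then pochhammer (real (card B)) r else 0)"
    using B partition_upto_facts(1)[OF blob_pmf_partition[OF P]] nn by (intro member_le_sum) auto
  finally show "x ^ r \<le> (\<Sum>B\<in>P. if B \<inter> {1..k} = {} then pochhammer (real (card B)) r else 0)" .
qed (use x in simp)

text \<open>Applied with \<open>y = n powr p\<close>, this bounds the number of large blobs
  independently of \<open>n\<close>, which keeps the union over them harmless.\<close>

lemma large_blocks_count:
  fixes y :: real
  assumes P: "finite P" and s: "(\<Sum>B\<in>P. real (card B) ^ r) \<le> Y * y ^ r" and y: "0 < y" and d: "0 < d"
  shows "real (card {B \<in> P. d * y < real (card B)}) \<le> Y / d ^ r"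
proof -
  have "real (card {B \<in> P. d * y < real (card B)}) * (d * y) ^ r = (\<Sum>B\<in>{B \<in> P. d * y < real (card B)}. (d * y) ^ r)"
    by simp
  also have "\<dots> \<le> (\<Sum>B\<in>{B \<in> P. d * y < real (card B)}. real (card B) ^ r)"
    using y d by (intro sum_mono power_mono) auto
  also have "\<dots> \<le> (\<Sum>B\<in>P. real (card B) ^ r)"
    using P by (intro sum_mono2) auto
  also note s
  finally have "real (card {B \<in> P. d * y < real (card B)}) * d ^ r * y ^ r \<le> Y * y ^ r"
    by (simp add: power_mult_distrib mult_ac)
  then have "real (card {B \<in> P. d * y < real (card B)}) * d ^ r \<le> Y" using y by simp
  then show ?thesis using d by (simp add: pos_le_divide_eq)
qed

lemma block_size_bound:
  fixes y :: real
  assumes P: "finite P" and s: "(\<Sum>B\<in>P. real (card B) ^ r) \<le> Y * y ^ r" and y: "0 < y" and Y: "1 \<le> Y"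
    and r: "1 \<le> r" and B: "B \<in> P"
  shows "real (card B) \<le> Y * y"
proof (rule ccontr)
  assume "\<not> real (card B) \<le> Y * y"
  then have "(Y * y) ^ r < real (card B) ^ r" using Y y r by (intro power_strict_mono) auto
  also have "\<dots> \<le> (\<Sum>B\<in>P. real (card B) ^ r)" using P B by (intro member_le_sum) auto
  also note s
  finally have "Y ^ r < Y" using y by (simp add: power_mult_distrib)
  moreover have "Y \<le> Y ^ r" using Y r by (intro self_le_power) auto
  ultimately show False by simp
qed

lemma powr_real_power: "1 \<le> n \<Longrightarrow> real n powr (real r * p) = (real n powr p) ^ r"
  by (simp add: powr_realpow[symmetric] powr_powr mult.commute)

lemma small_blocks_square_sum:
  assumes P: "finite P" "\<And>B. B \<in> P \<Longrightarrow> 1 \<le> card B"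
  shows "(\<Sum>B\<in>{B \<in> P. card B \<le> L}. real (card B) ^ 2) = (\<Sum>k\<in>{1..L}. real k ^ 2 * size_count k P)"
proof -
  have "(\<Sum>B\<in>{B \<in> P. card B \<le> L}. real (card B) ^ 2) = (\<Sum>B\<in>P. \<Sum>k\<in>{1..L}. real k ^ 2 * of_bool (card B = k))"
  proof -
    have "(\<Sum>k\<in>{1..L}. real k ^ 2 * of_bool (card B = k)) = (if card B \<le> L then real (card B) ^ 2 else 0)" if "B \<in> P" for B
      using P(2)[OF that] by (simp add: of_bool_def if_distrib[of "\<lambda>x. _ * x"] sum.delta' cong: if_cong)
    then have "(\<Sum>B\<in>P. \<Sum>k\<in>{1..L}. real k ^ 2 * of_bool (card B = k)) = (\<Sum>B\<in>P. if card B \<le> L then real (card B) ^ 2 else 0)"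
      by (intro sum.cong refl)
    also have "\<dots> = (\<Sum>B\<in>{B \<in> P. card B \<le> L}. real (card B) ^ 2)"
      using P(1) by (simp add: sum.inter_filter)
    finally show ?thesis by simp
  qed
  also have "\<dots> = (\<Sum>k\<in>{1..L}. real k ^ 2 * size_count k P)"
    unfolding size_count_def sum_distrib_left by (rule sum.swap)
  finally show ?thesis .
qed

text \<open>What the exploration needs from the blobs: the susceptibility from above for the drift,
  the third moment for the remainder, the moment of order \<open>r\<close> for number and size of
  large blobs, and the susceptibility of blobs up to \<open>L\<close> for the lower bound. The
  exponent in the second condition is halfway between the growth exponent of the third moment and
  \<open>1 + p\<close>.\<close>

definition good_blobs :: "real \<Rightarrow> nat \<Rightarrow> real \<Rightarrow> real \<Rightarrow> nat \<Rightarrow> nat \<Rightarrow> nat set set \<Rightarrow> bool" where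
  "good_blobs p r Y \<kappa> L n P \<longleftrightarrow>
     (\<Sum>B\<in>P. real (card B) ^ 2) \<le> (1 / (1 - 2 * p) + \<kappa>) * real n \<and>
     (\<Sum>B\<in>P. real (card B) ^ 3) \<le> real n powr (1 + p - (1 + p - max 1 (1 / 2 + 2 * p)) / 2) \<and>
     (\<Sum>B\<in>P. real (card B) ^ r) \<le> Y * (real n powr p) ^ r \<and>
     (1 / (1 - 2 * p) - \<kappa>) * real n \<le> (\<Sum>B\<in>{B \<in> P. card B \<le> L}. real (card B) ^ 2)"

text \<open>The second block in the gap condition is arbitrary, so a large blob is also separated
  from blobs below the threshold.\<close>

definition separated_tops :: "real \<Rightarrow> real \<Rightarrow> real \<Rightarrow> nat \<Rightarrow> nat \<Rightarrow> nat set set \<Rightarrow> bool" where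
  "separated_tops p d g K n P \<longleftrightarrow> K \<le> card {B \<in> P. d * real n powr p < real (card B)} \<and>
     (\<forall>A\<in>P. \<forall>B\<in>P. A \<noteq> B \<longrightarrow> d * real n powr p \<le> real (card A) \<longrightarrow>
        g * real n powr p < \<bar>real (card A) - real (card B)\<bar>)"

context
  fixes p :: real
  assumes p: "0 < p" "p < 1 / 2"
begin

lemma power_moment_tight:
  assumes r: "real r * p > 1" and e: "0 < e"
  shows "\<exists>Y\<ge>1. \<forall>n\<ge>1. measure_pmf.prob (blob_pmf p n) {P. Y * (real n powr p) ^ r < (\<Sum>B\<in>P. real (card B) ^ r)} \<le> e"
proof -
  define C where "C = (fact r + fact r / (real r * p - 1) :: real)"
  have C: "0 \<le> C" using r by (simp add: C_def)
  define Y where "Y = max 1 (C / e)"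
  have Y: "1 \<le> Y" "C / Y \<le> e"
  proof -
    have "C / e \<le> Y" by (simp add: Y_def)
    then have "C \<le> e * Y" using e by (simp add: pos_divide_le_eq mult.commute)
    moreover show "1 \<le> Y" by (simp add: Y_def)
    ultimately show "C / Y \<le> e" by (simp add: pos_divide_le_eq)
  qed
  have "measure_pmf.prob (blob_pmf p n) {P. Y * (real n powr p) ^ r < (\<Sum>B\<in>P. real (card B) ^ r)} \<le> e" if n: "n \<ge> 1" for n
  proof -
    have pos: "0 < (real n powr p) ^ r" using n by simp
    have "measure_pmf.prob (blob_pmf p n) {P. Y * (real n powr p) ^ r < (\<Sum>B\<in>P. real (card B) ^ r)}
      \<le> late_moment p r 0 n / (Y * (real n powr p) ^ r)"
      using Y pos by (intro power_moment_prob) auto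
    also have "\<dots> \<le> C * (real n powr p) ^ r / (Y * (real n powr p) ^ r)"
      using moment_bound[of p r n] p r n Y pos unfolding C_def[symmetric] powr_real_power[OF n]
      by (intro divide_right_mono) auto
    also have "\<dots> = C / Y"
      by (rule mult_divide_mult_cancel_right) (use pos in linarith)
    finally show ?thesis using Y(2) by simp
  qed
  then show ?thesis using Y(1) by blast
qed

lemma third_moment_small:
  assumes e: "0 < e"
  defines "e1 \<equiv> (1 + p - max 1 (1 / 2 + 2 * p)) / 2"
  shows "\<forall>\<^sub>F n in sequentially. measure_pmf.prob (blob_pmf p n)
    {P. real n powr (1 + p - e1) < (\<Sum>B\<in>P. real (card B) ^ 3)} \<le> e"
proof -
  define \<beta> where "\<beta> = max 1 (1 / 2 + 2 * p)"
  have e1: "0 < e1" using p by (auto simp: e1_def max_def)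
  have eq: "1 + p - e1 = \<beta> + e1" by (simp add: e1_def \<beta>_def field_simps)
  obtain C where C: "C \<ge> 0" "\<And>n. n \<ge> 1 \<Longrightarrow> late_moment p 3 0 n \<le> C * real n powr \<beta>"
    using third_moment_bound[OF p] unfolding \<beta>_def by blast
  have "(\<lambda>n. C * real n powr (- e1)) \<longlonglongrightarrow> C * 0"
    by (intro tendsto_mult tendsto_const powr_minus_tendsto_0 e1)
  then have "\<forall>\<^sub>F n in sequentially. C * real n powr (- e1) < e"
    using e by (intro order_tendstoD(2)[of _ 0]) auto
  then show ?thesis
    using eventually_ge_at_top[of 1]
  proof eventually_elim
    case (elim n)
    have n: "0 < real n" using elim by simp
    have "measure_pmf.prob (blob_pmf p n) {P. real n powr (1 + p - e1) < (\<Sum>B\<in>P. real (card B) ^ 3)}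
      \<le> late_moment p 3 0 n / real n powr (1 + p - e1)"
      using n by (intro power_moment_prob) simp
    also have "\<dots> \<le> C * real n powr \<beta> / real n powr (1 + p - e1)"
      using C elim by (intro divide_right_mono) auto
    also have "\<dots> = C * real n powr (- e1)"
      unfolding eq using n by (simp add: powr_add powr_minus field_simps)
    finally show ?case using elim by simp
  qed
qed

text \<open>A partial sum of the series for \<open>1 / (1 - 2 * p)\<close> comes within
  \<open>\<kappa> / 2\<close> of it, and the finitely many counts involved concentrate. The cutoff
  \<open>L\<close> depends on \<kappa> only, not on the error probability.\<close>

lemma small_blocks_susceptibility:
  assumes \<kappa>: "0 < \<kappa>"
  shows "\<exists>L. \<forall>e>0. \<forall>\<^sub>F n in sequentially. measure_pmf.prob (blob_pmf p n)
    {P. (\<Sum>B\<in>{B \<in> P. card B \<le> L}. real (card B) ^ 2) < (1 / (1 - 2 * p) - \<kappa>) * real n} \<le> e"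
proof -
  define \<xi> where "\<xi> = 1 / (1 - 2 * p)"
  have p1: "p < 1" using p by simp
  have "(\<lambda>k. real k ^ 2 * q p k) sums \<xi>"
    unfolding \<xi>_def by (rule moment_sums[OF q_second_moment[OF p]]) simp
  then have "(\<lambda>n. \<Sum>k<n. real k ^ 2 * q p k) \<longlonglongrightarrow> \<xi>" by (simp add: sums_def)
  then have "\<forall>\<^sub>F n in sequentially. \<xi> - \<kappa> / 2 < (\<Sum>k<n. real k ^ 2 * q p k)"
    using \<kappa> by (intro order_tendstoD(1)) auto
  then obtain N where N: "\<xi> - \<kappa> / 2 < (\<Sum>k<N. real k ^ 2 * q p k)"
    by (auto simp: eventually_sequentially)
  define L where "L = N"
  have L: "\<xi> - \<kappa> / 2 < (\<Sum>k\<in>{1..L}. real k ^ 2 * q p k)"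
  proof -
    have "(\<Sum>k<N. real k ^ 2 * q p k) = (\<Sum>k\<in>{1..<N}. real k ^ 2 * q p k)"
      by (intro sum.mono_neutral_right) auto
    also have "\<dots> \<le> (\<Sum>k\<in>{1..L}. real k ^ 2 * q p k)"
      unfolding L_def using q_bounds(1)[OF p(1) p1] by (intro sum_mono2) (auto simp: less_imp_le)
    finally show ?thesis using N by simp
  qed
  \<comment> \<open>With \<open>d = \<kappa> / (2 * D)\<close>, errors of size \<open>d\<close> in
    the single counts add up to at most \<open>\<kappa> / 2\<close>; the \<open>+ 1\<close> keeps
    \<open>D\<close> positive for an empty range.\<close>
  define D where "D = (\<Sum>k\<in>{1..L}. real k ^ 2) + 1"
  have D: "0 < D" by (auto simp: D_def intro!: add_nonneg_pos sum_nonneg)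
  define d where "d = \<kappa> / (2 * D)"
  have d: "0 < d" using \<kappa> D by (simp add: d_def)
  have dD: "d * (\<Sum>k\<in>{1..L}. real k ^ 2) \<le> \<kappa> / 2"
  proof -
    have "d * (\<Sum>k\<in>{1..L}. real k ^ 2) \<le> d * D" using d by (intro mult_left_mono) (auto simp: D_def)
    also have "\<dots> = \<kappa> / 2" using D by (simp add: d_def)
    finally show ?thesis .
  qed
  have "\<forall>\<^sub>F n in sequentially. measure_pmf.prob (blob_pmf p n)
    {P. (\<Sum>B\<in>{B \<in> P. card B \<le> L}. real (card B) ^ 2) < (\<xi> - \<kappa>) * real n} \<le> e" if e: "0 < e" for e
  proof -
    have "(\<lambda>n. (\<Sum>k\<in>{1..L}. 4 * real k / d\<^sup>2) * (1 / real n)) \<longlonglongrightarrow> (\<Sum>k\<in>{1..L}. 4 * real k / d\<^sup>2) * 0"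
      by (intro tendsto_mult tendsto_const lim_1_over_n)
    then have "\<forall>\<^sub>F n in sequentially. (\<Sum>k\<in>{1..L}. 4 * real k / d\<^sup>2) * (1 / real n) < e"
      using e by (intro order_tendstoD(2)[of _ 0]) auto
    then show ?thesis
      using eventually_ge_at_top[of "max 1 L"]
    proof eventually_elim
      case (elim n)
      have n: "1 \<le> n" "L \<le> n" "0 < real n" using elim by auto
      have "measure_pmf.prob (blob_pmf p n)
        {P. (\<Sum>B\<in>{B \<in> P. card B \<le> L}. real (card B) ^ 2) < (\<xi> - \<kappa>) * real n} \<le>
        measure_pmf.prob (blob_pmf p n) {P. \<exists>k\<in>{1..L}. d < \<bar>size_count k P / real n - q p k\<bar>}"
      proof (rule prob_mono_pmf, rule ccontr)
        fix P assume "P \<in> set_pmf (blob_pmf p n)"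
        then have P: "partition_on {1..n} P" by (rule blob_pmf_partition)
        note f = partition_upto_facts(1,6)[OF P]
        assume lt: "(\<Sum>B\<in>{B \<in> P. card B \<le> L}. real (card B) ^ 2) < (\<xi> - \<kappa>) * real n"
          and close: "\<not> (\<exists>k\<in>{1..L}. d < \<bar>size_count k P / real n - q p k\<bar>)"
        have "q p k - d \<le> size_count k P / real n" if k: "k \<in> {1..L}" for k
        proof -
          have "\<not> d < \<bar>size_count k P / real n - q p k\<bar>" using close k by blast
          then show ?thesis by linarith
        qed
        then have "(q p k - d) * real n \<le> size_count k P" if "k \<in> {1..L}" for k
          using that n(3) by (simp add: pos_le_divide_eq)
        then have "(\<Sum>k\<in>{1..L}. real k ^ 2 * ((q p k - d) * real n)) \<le> (\<Sum>k\<in>{1..L}. real k ^ 2 * size_count k P)"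
          by (intro sum_mono mult_left_mono) auto
        also have "\<dots> = (\<Sum>B\<in>{B \<in> P. card B \<le> L}. real (card B) ^ 2)"
          by (rule small_blocks_square_sum[symmetric]) (use f in auto)
        also have "(\<Sum>k\<in>{1..L}. real k ^ 2 * ((q p k - d) * real n)) =
          ((\<Sum>k\<in>{1..L}. real k ^ 2 * q p k) - d * (\<Sum>k\<in>{1..L}. real k ^ 2)) * real n"
          unfolding sum_distrib_left sum_distrib_right sum_subtractf[symmetric]
          by (intro sum.cong refl) (simp add: algebra_simps)
        finally have "((\<Sum>k\<in>{1..L}. real k ^ 2 * q p k) - d * (\<Sum>k\<in>{1..L}. real k ^ 2)) * real n < (\<xi> - \<kappa>) * real n"
          using lt by simp
        then have "(\<Sum>k\<in>{1..L}. real k ^ 2 * q p k) - d * (\<Sum>k\<in>{1..L}. real k ^ 2) < \<xi> - \<kappa>"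
          using n(3) by simp
        then show False using L dD by linarith
      qed
      also have "\<dots> \<le> (\<Sum>k\<in>{1..L}. measure_pmf.prob (blob_pmf p n) {P. d < \<bar>size_count k P / real n - q p k\<bar>})"
        by (rule prob_Bex_le) simp
      also have "\<dots> \<le> (\<Sum>k\<in>{1..L}. 4 * real k / (d\<^sup>2 * real n))"
        using n d by (intro sum_mono size_count_concentration p(1) p1) auto
      also have "\<dots> = (\<Sum>k\<in>{1..L}. 4 * real k / d\<^sup>2) * (1 / real n)"
        unfolding sum_distrib_right by (intro sum.cong refl) simp
      finally show ?case using elim(1) by simp
    qed
  qed
  then show ?thesis unfolding \<xi>_def by blast
qed

text \<open>\<open>w * (w + 1)\<close> exceeds \<open>w ^ 2\<close> by \<open>w\<close>, and the
  sizes add up to \<open>n\<close>, so the sharp constant of the second rising moment gives the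
  exact limit of the susceptibility as a bound.\<close>

lemma expectation_square_sum:
  assumes "1 \<le> n"
  shows "measure_pmf.expectation (blob_pmf p n) (\<lambda>P. \<Sum>B\<in>P. real (card B) ^ 2) \<le> real n / (1 - 2 * p)"
proof -
  have "late_moment p 2 0 n = measure_pmf.expectation (blob_pmf p n) (\<lambda>P. (\<Sum>B\<in>P. real (card B) ^ 2) + real n)"
    unfolding late_moment_def
  proof (rule expectation_cong_pmf)
    fix P assume "P \<in> set_pmf (blob_pmf p n)"
    then have P: "partition_on {1..n} P" by (rule blob_pmf_partition)
    have "(\<Sum>B\<in>P. if B \<inter> {1..0} = {} then pochhammer (real (card B)) 2 else 0) = (\<Sum>B\<in>P. real (card B) ^ 2 + real (card B))"
      by (intro sum.cong refl) (simp add: eval_nat_numeral pochhammer_Suc algebra_simps)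
    then show "(\<Sum>B\<in>P. if B \<inter> {1..0} = {} then pochhammer (real (card B)) 2 else 0) = (\<Sum>B\<in>P. real (card B) ^ 2) + real n"
      by (simp add: sum.distrib partition_upto_facts(7)[OF P])
  qed
  also have "\<dots> = measure_pmf.expectation (blob_pmf p n) (\<lambda>P. \<Sum>B\<in>P. real (card B) ^ 2) + real n"
    by (subst Bochner_Integration.integral_add) (auto intro: integrable_measure_pmf_finite finite_blob_pmf)
  finally have "measure_pmf.expectation (blob_pmf p n) (\<lambda>P. \<Sum>B\<in>P. real (card B) ^ 2) \<le>
      2 * (1 - p) / (1 - 2 * p) * real n - real n"
    using second_moment_bound[of p n] p assms by simp
  also have "\<dots> = real n / (1 - 2 * p)" using p by (simp add: field_simps)
  finally show ?thesis .
qed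

text \<open>The expected susceptibility is at most its limit and the small blobs already account for
  almost all of it, so large upward deviations are unlikely.\<close>

lemma susceptibility_upper:
  assumes \<kappa>: "0 < \<kappa>" and e: "0 < e"
  shows "\<forall>\<^sub>F n in sequentially. measure_pmf.prob (blob_pmf p n)
    {P. (1 / (1 - 2 * p) + \<kappa>) * real n < (\<Sum>B\<in>P. real (card B) ^ 2)} \<le> e"
proof -
  define \<xi> where "\<xi> = 1 / (1 - 2 * p)"
  have \<xi>: "1 < \<xi>" using p by (simp add: \<xi>_def field_simps)
  define \<kappa>1 where "\<kappa>1 = min (e * \<kappa> / 2) 1"
  have \<kappa>1: "0 < \<kappa>1" "\<kappa>1 \<le> e * \<kappa> / 2" "\<kappa>1 \<le> 1" using \<kappa> e by (auto simp: \<kappa>1_def)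
  obtain L where L: "\<And>e. 0 < e \<Longrightarrow> \<forall>\<^sub>F n in sequentially. measure_pmf.prob (blob_pmf p n)
    {P. (\<Sum>B\<in>{B \<in> P. card B \<le> L}. real (card B) ^ 2) < (\<xi> - \<kappa>1) * real n} \<le> e"
    using small_blocks_susceptibility[OF \<kappa>1(1)] unfolding \<xi>_def by blast
  have "0 < e * \<kappa> / (2 * \<xi>)" using e \<kappa> \<xi> by simp
  from L[OF this] show ?thesis
    using eventually_ge_at_top[of 1]
  proof eventually_elim
    case (elim n)
    have n: "0 < real n" using elim by simp
    define low where "low P \<longleftrightarrow> (\<Sum>B\<in>{B \<in> P. card B \<le> L}. real (card B) ^ 2) < (\<xi> - \<kappa>1) * real n" for P :: "nat set set"
    let ?S = "\<lambda>P. \<Sum>B\<in>P. real (card B) ^ 2"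
    \<comment> \<open>Markov's inequality is applied to \<open>g\<close>. It is nonnegative: off the
      event \<open>low\<close> the susceptibility is at least \<open>\<xi> - \<kappa>1\<close>, and
      on it the summand \<xi> compensates. Its mean is at most \<open>e * \<kappa>\<close>.\<close>
    define g where "g P = (?S P / real n - (\<xi> - \<kappa>1)) + \<xi> * indicator {P. low P} P" for P :: "nat set set"
    have "measure_pmf.prob (blob_pmf p n) {P. (\<xi> + \<kappa>) * real n < ?S P} \<le> measure_pmf.expectation (blob_pmf p n) g / \<kappa>"
    proof (rule prob_le_expectation_finite[OF finite_blob_pmf _ _ \<kappa>])
      fix P assume "P \<in> set_pmf (blob_pmf p n)"
      then have P: "partition_on {1..n} P" by (rule blob_pmf_partition)
      have S0: "0 \<le> ?S P" by (intro sum_nonneg) simp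
      show "0 \<le> g P"
      proof (cases "low P")
        case True
        then show ?thesis using S0 n \<kappa>1 by (simp add: g_def)
      next
        case False
        then have "(\<xi> - \<kappa>1) * real n \<le> (\<Sum>B\<in>{B \<in> P. card B \<le> L}. real (card B) ^ 2)" by (simp add: low_def)
        also have "\<dots> \<le> ?S P" using partition_upto_facts(1)[OF P] by (intro sum_mono2) auto
        finally have "\<xi> - \<kappa>1 \<le> ?S P / real n" using n by (simp add: pos_le_divide_eq)
        then show ?thesis using False by (simp add: g_def)
      qed
      assume "P \<in> {P. (\<xi> + \<kappa>) * real n < ?S P}"
      then have "\<xi> + \<kappa> < ?S P / real n" using n by (simp add: pos_less_divide_eq)
      then show "\<kappa> \<le> g P" using \<kappa>1 \<xi> by (simp add: g_def indicator_def)
    qed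
    also have "measure_pmf.expectation (blob_pmf p n) g =
       (measure_pmf.expectation (blob_pmf p n) ?S / real n - (\<xi> - \<kappa>1)) + \<xi> * measure_pmf.prob (blob_pmf p n) {P. low P}"
      unfolding g_def
      by (simp add: integrable_measure_pmf_finite finite_blob_pmf Bochner_Integration.integral_add Bochner_Integration.integral_diff)
    also have "\<dots> \<le> \<kappa>1 + \<xi> * (e * \<kappa> / (2 * \<xi>))"
    proof (intro add_mono mult_left_mono)
      have "measure_pmf.expectation (blob_pmf p n) ?S / real n \<le> real n / (1 - 2 * p) / real n"
        using expectation_square_sum[of n] elim n by (intro divide_right_mono) auto
      also have "\<dots> = \<xi>" using n by (simp add: \<xi>_def)
      finally show "measure_pmf.expectation (blob_pmf p n) ?S / real n - (\<xi> - \<kappa>1) \<le> \<kappa>1" by simp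
      show "measure_pmf.prob (blob_pmf p n) {P. low P} \<le> e * \<kappa> / (2 * \<xi>)"
        using elim(1) by (simp add: low_def)
    qed (use \<xi> in simp)
    also have "\<dots> \<le> e * \<kappa>" using \<kappa>1 \<xi> by simp
    finally have "measure_pmf.prob (blob_pmf p n) {P. (\<xi> + \<kappa>) * real n < ?S P} \<le> e * \<kappa> / \<kappa>"
      using \<kappa> by (simp add: divide_right_mono)
    then show ?case using \<kappa> by (simp add: \<xi>_def)
  qed
qed

text \<open>The order of quantifiers matters: \<open>Y\<close> is fixed before \<kappa>, because the
  accuracy \<kappa> required later depends on \<open>Y\<close>, and \<open>L\<close> comes last, as
  it depends on \<kappa>.\<close>

lemma good_blobs_prob:
  assumes r: "real r * p > 1" and e: "0 < e"
  shows "\<exists>Y\<ge>1. \<forall>\<kappa>>0. \<exists>L. \<forall>\<^sub>F n in sequentially.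
    measure_pmf.prob (blob_pmf p n) {P. \<not> good_blobs p r Y \<kappa> L n P} \<le> e"
proof -
  have e4: "0 < e / 4" using e by simp
  obtain Y where Y: "Y \<ge> 1" "\<And>n. n \<ge> 1 \<Longrightarrow> measure_pmf.prob (blob_pmf p n)
      {P. Y * (real n powr p) ^ r < (\<Sum>B\<in>P. real (card B) ^ r)} \<le> e / 4"
    using power_moment_tight[OF r e4] by blast
  have "\<exists>L. \<forall>\<^sub>F n in sequentially. measure_pmf.prob (blob_pmf p n) {P. \<not> good_blobs p r Y \<kappa> L n P} \<le> e"
    if \<kappa>: "0 < \<kappa>" for \<kappa>
  proof -
    obtain L where L: "\<forall>\<^sub>F n in sequentially. measure_pmf.prob (blob_pmf p n)
      {P. (\<Sum>B\<in>{B \<in> P. card B \<le> L}. real (card B) ^ 2) < (1 / (1 - 2 * p) - \<kappa>) * real n} \<le> e / 4"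
      using small_blocks_susceptibility[OF \<kappa>] e4 by blast
    have "\<forall>\<^sub>F n in sequentially. measure_pmf.prob (blob_pmf p n) {P. \<not> good_blobs p r Y \<kappa> L n P} \<le> e"
      using L susceptibility_upper[OF \<kappa> e4] third_moment_small[OF e4] eventually_ge_at_top[of 1]
    proof eventually_elim
      case (elim n)
      let ?A1 = "\<lambda>P. (\<Sum>B\<in>{B \<in> P. card B \<le> L}. real (card B) ^ 2) < (1 / (1 - 2 * p) - \<kappa>) * real n"
      let ?A2 = "\<lambda>P. (1 / (1 - 2 * p) + \<kappa>) * real n < (\<Sum>B\<in>P. real (card B) ^ 2)"
      let ?A3 = "\<lambda>P. real n powr (1 + p - (1 + p - max 1 (1 / 2 + 2 * p)) / 2) < (\<Sum>B\<in>P. real (card B) ^ 3)"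
      let ?A4 = "\<lambda>P. Y * (real n powr p) ^ r < (\<Sum>B\<in>P. real (card B) ^ r)"
      have "measure_pmf.prob (blob_pmf p n) {P. \<not> good_blobs p r Y \<kappa> L n P} \<le>
        measure_pmf.prob (blob_pmf p n) {P. ?A1 P \<or> ?A2 P \<or> ?A3 P \<or> ?A4 P}"
        by (rule prob_mono_pmf) (auto simp: good_blobs_def not_le)
      also have "\<dots> \<le> measure_pmf.prob (blob_pmf p n) {P. ?A1 P} + (measure_pmf.prob (blob_pmf p n) {P. ?A2 P}
        + (measure_pmf.prob (blob_pmf p n) {P. ?A3 P} + measure_pmf.prob (blob_pmf p n) {P. ?A4 P}))"
        by (intro order_trans[OF prob_disj_le] add_left_mono order_refl)
      also have "\<dots> \<le> e / 4 + (e / 4 + (e / 4 + e / 4))"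
        using elim Y(2)[of n] by (intro add_mono) auto
      finally show ?case by simp
    qed
    then show ?thesis by blast
  qed
  then show ?thesis using Y(1) by blast
qed

text \<open>For \<open>r * p > 1\<close> the late moment carries the factor
  \<open>k powr (1 - r * p)\<close>, which beats the constant \<open>1 / d ^ r\<close> once
  \<open>k\<close> is large.\<close>

lemma late_blocks_small:
  assumes d: "0 < d" and e: "0 < e"
  shows "\<exists>k\<ge>1. \<forall>n\<ge>k. measure_pmf.prob (blob_pmf p n)
    {P. \<exists>B\<in>P. B \<inter> {1..k} = {} \<and> d * real n powr p \<le> real (card B)} \<le> e"
proof -
  obtain r :: nat where "1 / p < real r" using reals_Archimedean2 by blast
  then have r: "real r * p > 1" using p by (simp add: field_simps)
  define C where "C = fact r / (real r * p - 1) / d ^ r"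
  have "(\<lambda>k. C * real k powr (- (real r * p - 1))) \<longlonglongrightarrow> C * 0"
    using r by (intro tendsto_mult tendsto_const powr_minus_tendsto_0) auto
  then have "\<forall>\<^sub>F k in sequentially. C * real k powr (- (real r * p - 1)) < e"
    using e by (intro order_tendstoD(2)[of _ 0]) auto
  then obtain k0 where k0: "\<And>k. k \<ge> k0 \<Longrightarrow> C * real k powr (- (real r * p - 1)) < e"
    by (auto simp: eventually_sequentially)
  define k where "k = max 1 k0"
  have k: "1 \<le> k" "C * real k powr (1 - real r * p) < e"
    using k0[of k] by (auto simp: k_def)
  have "measure_pmf.prob (blob_pmf p n)
    {P. \<exists>B\<in>P. B \<inter> {1..k} = {} \<and> d * real n powr p \<le> real (card B)} \<le> e" if n: "k \<le> n" for n
  proof -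
    have n0: "0 < real n" using k n by simp
    have "measure_pmf.prob (blob_pmf p n)
      {P. \<exists>B\<in>P. B \<inter> {1..k} = {} \<and> d * real n powr p \<le> real (card B)} \<le> late_moment p r k n / (d * real n powr p) ^ r"
      using d n0 by (intro late_block_prob) simp
    also have "\<dots> \<le> (fact r / (real r * p - 1) * real k powr (1 - real r * p) * (real n powr p) ^ r) / (d * real n powr p) ^ r"
      using late_moment_bound[of p r k n] p r k n d powr_real_power[of n r] by (intro divide_right_mono) auto
    also have "\<dots> = C * real k powr (1 - real r * p)"
    proof -
      define w where "w = (real n powr p) ^ r"
      have "w \<noteq> 0" using n0 by (simp add: w_def)
      then show ?thesis
        unfolding C_def power_mult_distrib w_def[symmetric] mult_divide_mult_cancel_right by simp
    qed
    finally show ?thesis using k by simp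
  qed
  then show ?thesis using k(1) by blast
qed

lemma near_tie_prob:
  assumes k: "1 \<le> k" "k \<le> n" and y: "1 < y" and z: "0 \<le> z"
  shows "measure_pmf.prob (blob_pmf p n)
    {P. \<exists>a\<in>{1..k}. \<exists>b\<in>{1..k}. block_at P a \<noteq> block_at P b \<and>
       y \<le> real (card (block_at P a)) + real (card (block_at P b)) \<and>
       \<bar>real (card (block_at P a)) - real (card (block_at P b))\<bar> \<le> z}
    \<le> real k ^ 3 * (z + 1) / (y - 1)"
proof -
  let ?h = "\<lambda>j l. of_bool (y \<le> real j + real l \<and> \<bar>real j - real l\<bar> \<le> z) :: real"
  define bad where "bad a b P \<longleftrightarrow> block_at P a \<noteq> block_at P b \<and>
       y \<le> real (card (block_at P a)) + real (card (block_at P b)) \<and>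
       \<bar>real (card (block_at P a)) - real (card (block_at P b))\<bar> \<le> z" for a b P
  have one: "measure_pmf.prob (blob_pmf p n) {P. bad a b P} \<le> real k * (z + 1) / (y - 1)"
    if a: "a \<in> {1..k}" and b: "b \<in> {1..k}" for a b
  proof -
    have "measure_pmf.prob (blob_pmf p n) {P. bad a b P} \<le> measure_pmf.expectation (blob_pmf p n) (pair_test a b ?h) / 1"
      by (rule prob_le_expectation_finite[OF finite_blob_pmf]) (auto simp: pair_test_def bad_def)
    also have "\<dots> \<le> real (max a b) * (z + 1) / (y - 1)"
      using near_tie_expectation[of p a b n y z] p a b k y z by simp
    also have "\<dots> \<le> real k * (z + 1) / (y - 1)"
      using a b y z by (intro divide_right_mono mult_right_mono) auto
    finally show ?thesis .
  qed
  have "measure_pmf.prob (blob_pmf p n) {P. \<exists>a\<in>{1..k}. \<exists>b\<in>{1..k}. bad a b P} \<le>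
    (\<Sum>a\<in>{1..k}. measure_pmf.prob (blob_pmf p n) {P. \<exists>b\<in>{1..k}. bad a b P})"
    by (rule prob_Bex_le) simp
  also have "\<dots> \<le> (\<Sum>a\<in>{1..k}. \<Sum>b\<in>{1..k}. measure_pmf.prob (blob_pmf p n) {P. bad a b P})"
    by (intro sum_mono prob_Bex_le) simp
  also have "\<dots> \<le> (\<Sum>a\<in>{1..k}. \<Sum>b\<in>{1..k}. real k * (z + 1) / (y - 1))"
    by (intro sum_mono one)
  also have "\<dots> = real k ^ 3 * (z + 1) / (y - 1)"
    by (simp add: eval_nat_numeral)
  finally show ?thesis unfolding bad_def .
qed

text \<open>Four quantities are fixed in turn: \<open>k\<close> so that at least \<open>K\<close>
  blobs meet the first \<open>k\<close> vertices; \<open>d\<close> so that all of these exceed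
  \<open>d * n powr p\<close>; \<open>k'\<close> so that blobs of size at least
  \<open>d / 2 * n powr p\<close> meet the first \<open>k'\<close> vertices; and \<open>g\<close> so
  that near ties between such blobs are unlikely.\<close>

lemma separated_tops_prob:
  assumes e: "0 < e"
  shows "\<exists>d>0. \<exists>g>0. \<forall>\<^sub>F n in sequentially. measure_pmf.prob (blob_pmf p n) {P. \<not> separated_tops p d g K n P} \<le> e"
proof -
  have p1: "p < 1" using p by simp
  have e4: "0 < e / 4" using e by simp
  obtain k where k: "1 \<le> k" "\<And>n. k \<le> n \<Longrightarrow> measure_pmf.prob (blob_pmf p n) {P. card (early_blocks k P) < K} \<le> e / 4"
    using many_early_blocks[OF p(1) p1 e4] by blast
  define Q where "Q = real k * (2 * real k powr (p / 2))"
  have Q: "0 < Q" using k by (simp add: Q_def)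
  \<comment> \<open>The union over \<open>k\<close> vertices of the bound
    \<open>2 * sqrt d * k powr (p / 2)\<close> is \<open>Q * sqrt d\<close>; this choice makes it
    \<open>e / 4\<close>.\<close>
  define d where "d = (e / 4 / Q)\<^sup>2"
  have d: "0 < d" "Q * sqrt d = e / 4" using e Q by (auto simp: d_def)
  have d2: "0 < d / 2" using d by simp
  obtain k' where k': "1 \<le> k'" "\<And>n. k' \<le> n \<Longrightarrow> measure_pmf.prob (blob_pmf p n)
    {P. \<exists>B\<in>P. B \<inter> {1..k'} = {} \<and> d / 2 * real n powr p \<le> real (card B)} \<le> e / 4"
    using late_blocks_small[OF d2 e4] by blast
  \<comment> \<open>The entry \<open>d / 2\<close> forces the partner in a near tie with a blob of
    size at least \<open>d * n powr p\<close> to have at least half that threshold, hence to be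
    early as well. The other entry makes the tie probability at most \<open>e / 8\<close>.\<close>
  define g where "g = min (d / 2) (e * d / (32 * real k' ^ 3))"
  have g: "0 < g" "g \<le> d / 2" "real k' ^ 3 * (4 * g / d) \<le> e / 8"
  proof -
    have "g \<le> e * d / (32 * real k' ^ 3)" by (simp add: g_def)
    then have "g * (32 * real k' ^ 3) \<le> e * d" using k' by (simp add: pos_le_divide_eq)
    then show "real k' ^ 3 * (4 * g / d) \<le> e / 8" using d by (simp add: field_simps)
  qed (use d e k' in \<open>auto simp: g_def\<close>)
  have lim: "filterlim (\<lambda>n. real n powr p) at_top sequentially"
    by (rule filterlim_compose[OF real_powr_at_top[OF p(1)] filterlim_real_sequentially])
  then have ev: "\<forall>\<^sub>F n in sequentially. max (2 / d) (1 / g) \<le> real n powr p"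
    unfolding filterlim_at_top by blast
  have "\<forall>\<^sub>F n in sequentially. measure_pmf.prob (blob_pmf p n) {P. \<not> separated_tops p d g K n P} \<le> e"
    using ev eventually_ge_at_top[of k] eventually_ge_at_top[of k']
  proof eventually_elim
    case (elim n)
    define y where "y = d * real n powr p"
    define z where "z = g * real n powr p"
    have "2 / d \<le> real n powr p" "1 / g \<le> real n powr p" using elim(1) by auto
    then have yz: "2 \<le> y" "1 \<le> z"
      using d g by (auto simp: y_def z_def pos_divide_le_eq mult.commute)
    let ?A1 = "\<lambda>P. card (early_blocks k P) < K"
    let ?A2 = "\<lambda>P. \<exists>a\<in>{1..k}. real (card (block_at P a)) \<le> d * real n powr p"
    let ?A3 = "\<lambda>P. \<exists>B\<in>P. B \<inter> {1..k'} = {} \<and> d / 2 * real n powr p \<le> real (card B)"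
    let ?A4 = "\<lambda>P. \<exists>a\<in>{1..k'}. \<exists>b\<in>{1..k'}. block_at P a \<noteq> block_at P b \<and>
       y \<le> real (card (block_at P a)) + real (card (block_at P b)) \<and>
       \<bar>real (card (block_at P a)) - real (card (block_at P b))\<bar> \<le> z"
    have "measure_pmf.prob (blob_pmf p n) {P. \<not> separated_tops p d g K n P} \<le>
      measure_pmf.prob (blob_pmf p n) {P. ?A1 P \<or> ?A2 P \<or> ?A3 P \<or> ?A4 P}"
    proof (rule prob_mono_pmf, rule ccontr)
      fix P assume "P \<in> set_pmf (blob_pmf p n)"
      then have P: "partition_on {1..n} P" by (rule blob_pmf_partition)
      note f = partition_upto_facts[OF P]
      assume "\<not> separated_tops p d g K n P" and no: "\<not> (?A1 P \<or> ?A2 P \<or> ?A3 P \<or> ?A4 P)"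
      moreover have "K \<le> card {B \<in> P. d * real n powr p < real (card B)}"
      proof -
        have "early_blocks k P \<subseteq> {B \<in> P. d * real n powr p < real (card B)}"
        proof
          fix B assume B: "B \<in> early_blocks k P"
          then obtain a where a: "a \<in> B" "a \<in> {1..k}" "B \<in> P" unfolding early_blocks_def by blast
          then have "block_at P a = B" by (intro block_at_eq[OF P])
          moreover have "\<not> real (card (block_at P a)) \<le> d * real n powr p" using no a(2) by blast
          ultimately show "B \<in> {B \<in> P. d * real n powr p < real (card B)}" using a(3) by simp
        qed
        then have "card (early_blocks k P) \<le> card {B \<in> P. d * real n powr p < real (card B)}"
          using f(1) by (intro card_mono) auto
        then show ?thesis using no by simp
      qed
      moreover have "g * real n powr p < \<bar>real (card A) - real (card B)\<bar>"
        if AB: "A \<in> P" "B \<in> P" "A \<noteq> B" "d * real n powr p \<le> real (card A)" for A B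
      proof (rule ccontr)
        assume *: "\<not> g * real n powr p < \<bar>real (card A) - real (card B)\<bar>"
        have "g * real n powr p \<le> d / 2 * real n powr p" using g by (intro mult_right_mono) auto
        then have cB: "d / 2 * real n powr p \<le> real (card B)" using * AB(4) by (simp add: field_simps)
        have "0 \<le> d * real n powr p" using d by simp
        then have cA: "d / 2 * real n powr p \<le> real (card A)" using AB(4) by linarith
        have "\<not> ?A3 P" using no by blast
        then have "A \<inter> {1..k'} \<noteq> {}" "B \<inter> {1..k'} \<noteq> {}" using AB(1,2) cA cB by blast+
        then obtain a b where ab: "a \<in> A" "a \<in> {1..k'}" "b \<in> B" "b \<in> {1..k'}" by blast
        have "block_at P a = A" by (rule block_at_eq[OF P AB(1) ab(1)])
        moreover have "block_at P b = B" by (rule block_at_eq[OF P AB(2) ab(3)])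
        moreover have "y \<le> real (card A) + real (card B)" using AB(4) by (simp add: y_def)
        ultimately have "?A4 P"
          using ab AB(3) * by (intro bexI[of _ a] bexI[of _ b]) (auto simp: z_def)
        then show False using no by blast
      qed
      ultimately show False unfolding separated_tops_def by blast
    qed
    also have "\<dots> \<le> measure_pmf.prob (blob_pmf p n) {P. ?A1 P} + (measure_pmf.prob (blob_pmf p n) {P. ?A2 P}
        + (measure_pmf.prob (blob_pmf p n) {P. ?A3 P} + measure_pmf.prob (blob_pmf p n) {P. ?A4 P}))"
      by (intro order_trans[OF prob_disj_le] add_left_mono order_refl)
    also have "\<dots> \<le> e / 4 + (e / 4 + (e / 4 + e / 4))"
    proof (intro add_mono)
      show "measure_pmf.prob (blob_pmf p n) {P. ?A1 P} \<le> e / 4" using k elim by simp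
      show "measure_pmf.prob (blob_pmf p n) {P. ?A3 P} \<le> e / 4" using k' elim by simp
      have "measure_pmf.prob (blob_pmf p n) {P. ?A2 P} \<le>
        (\<Sum>a\<in>{1..k}. measure_pmf.prob (blob_pmf p n) {P. real (card (block_at P a)) \<le> d * real n powr p})"
        by (rule prob_Bex_le) simp
      also have "\<dots> \<le> (\<Sum>a\<in>{1..k}. 2 * sqrt d * real k powr (p / 2))"
      proof (rule sum_mono)
        fix a assume a: "a \<in> {1..k}"
        have "measure_pmf.prob (blob_pmf p n) {P. real (card (block_at P a)) \<le> d * real n powr p} \<le> 2 * sqrt d * real a powr (p / 2)"
          using a elim d by (intro block_small_prob p(1) p1) auto
        also have "\<dots> \<le> 2 * sqrt d * real k powr (p / 2)"
          using a d p by (intro mult_left_mono powr_mono2) auto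
        finally show "measure_pmf.prob (blob_pmf p n) {P. real (card (block_at P a)) \<le> d * real n powr p} \<le> 2 * sqrt d * real k powr (p / 2)" .
      qed
      also have "\<dots> = Q * sqrt d" by (simp add: Q_def)
      finally show "measure_pmf.prob (blob_pmf p n) {P. ?A2 P} \<le> e / 4" using d by simp
      have "measure_pmf.prob (blob_pmf p n) {P. ?A4 P} \<le> real k' ^ 3 * (z + 1) / (y - 1)"
        using k' elim yz by (intro near_tie_prob) auto
      also have "\<dots> \<le> real k' ^ 3 * (2 * z) / (y / 2)"
        using yz by (intro frac_le mult_left_mono) auto
      also have "\<dots> = real k' ^ 3 * (4 * g / d)"
        using yz d k(1) elim(2) by (auto simp: y_def z_def field_simps)
      finally show "measure_pmf.prob (blob_pmf p n) {P. ?A4 P} \<le> e / 4" using g(3) e by simp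
    qed
    finally show ?case by simp
  qed
  then show ?thesis using d(1) g(1) by blast
qed

end

section \<open>The root blob and the blob size law\<close>

lemma map_pmf_blobs:
  assumes "0 \<le> p" "p \<le> 1" "0 \<le> lam" "lam \<le> real n" "n \<ge> 1"
  shows "map_pmf (blobs n) (percolation_model lam p n) = blob_pmf p n"
proof (rule pmf_eqI)
  fix P
  have "pmf (map_pmf (blobs n) (percolation_model lam p n)) P =
    measure_pmf.prob (percolation_model lam p n) {\<omega>. blobs n \<omega> = P}"
    by (simp add: pmf_map vimage_def)
  also have "\<dots> = measure_pmf.prob (blob_pmf p n) {Q. Q = P}"
    by (rule prob_percolation_model_blobs[OF assms])
  finally show "pmf (map_pmf (blobs n) (percolation_model lam p n)) P = pmf (blob_pmf p n) P"
    by (simp add: pmf.rep_eq)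
qed

text \<open>The variables are integer valued, so a distribution function is a finite sum of point
  masses and convergence of each mass suffices.\<close>

lemma conv_in_distr_pmfI:
  assumes "\<And>k. (\<lambda>n. pmf (M n) k) \<longlonglongrightarrow> pmf W k"
  shows "conv_in_distr M W"
proof -
  have cdf: "cdf (distr (measure_pmf V) borel real) x = (\<Sum>k\<in>{k. real k \<le> x}. pmf V k)" for V :: "nat pmf" and x
  proof -
    have fin: "finite {k. real k \<le> x}"
      by (rule finite_subset[of _ "{..nat \<lfloor>x\<rfloor>}"]) (auto simp: le_nat_floor)
    have "cdf (distr (measure_pmf V) borel real) x = measure_pmf.prob V (real -` {..x})"
      by (simp add: cdf_def measure_distr)
    also have "real -` {..x} = {k. real k \<le> x}" by auto
    finally show ?thesis using measure_measure_pmf_finite[OF fin] by simp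
  qed
  show ?thesis
    unfolding conv_in_distr_def weak_conv_m_def weak_conv_def cdf
    by (intro allI impI tendsto_sum assms)
qed

lemma tendsto_0_if_eventually_le:
  fixes f :: "nat \<Rightarrow> real"
  assumes "\<And>n. 0 \<le> f n" "\<And>e. 0 < e \<Longrightarrow> \<forall>\<^sub>F n in sequentially. f n \<le> e"
  shows "f \<longlonglongrightarrow> 0"
proof (rule order_tendstoI)
  show "\<forall>\<^sub>F n in sequentially. a < f n" if "a < 0" for a
    by (intro always_eventually allI less_le_trans[OF that assms(1)])
  show "\<forall>\<^sub>F n in sequentially. f n < a" if "0 < a" for a
  proof -
    have "0 < a / 2" using that by simp
    from assms(2)[OF this] show ?thesis
      by eventually_elim (use that in simp)
  qed
qed

lemma eventually_lam_le: "\<forall>\<^sub>F n in sequentially. lam \<le> real n"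
proof -
  obtain N where "lam \<le> real N" using real_arch_simple by blast
  then show ?thesis by (intro eventually_sequentiallyI[of N]) (meson of_nat_mono order_trans)
qed

context
  fixes p lam :: real
  assumes p: "0 < p" "p < 1 / 2" and lam: "0 < lam"
begin

lemma blob_count_tendsto:
  assumes k: "1 \<le> k"
  shows "tendsto_in_prob (percolation_model lam p) (\<lambda>n \<omega>. real (blob_count n k \<omega>) / real n) (q p k)"
  unfolding tendsto_in_prob_def
proof (intro allI impI, rule tendsto_0_if_eventually_le)
  fix d e :: real assume d: "0 < d" and e: "0 < e"
  have p1: "p < 1" using p by simp
  have "(\<lambda>n. 4 * real k / d\<^sup>2 * (1 / real n)) \<longlonglongrightarrow> 4 * real k / d\<^sup>2 * 0"
    by (intro tendsto_mult tendsto_const lim_1_over_n)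
  then have "\<forall>\<^sub>F n in sequentially. 4 * real k / d\<^sup>2 * (1 / real n) < e"
    using e by (intro order_tendstoD(2)[of _ 0]) auto
  then show "\<forall>\<^sub>F n in sequentially. measure_pmf.prob (percolation_model lam p n)
      {\<omega>. d < \<bar>real (blob_count n k \<omega>) / real n - q p k\<bar>} \<le> e"
    using eventually_lam_le[of lam] eventually_ge_at_top[of k]
  proof eventually_elim
    case (elim n)
    have "measure_pmf.prob (percolation_model lam p n) {\<omega>. d < \<bar>real (blob_count n k \<omega>) / real n - q p k\<bar>} =
      measure_pmf.prob (blob_pmf p n) {P. d < \<bar>real (card {B \<in> P. card B = k}) / real n - q p k\<bar>}"
      unfolding blob_count_def
      by (rule prob_percolation_model_blobs) (use p lam elim k in auto)
    also have "\<dots> \<le> measure_pmf.prob (blob_pmf p n) {P. d < \<bar>size_count k P / real n - q p k\<bar>}"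
      by (rule prob_mono_pmf) (simp add: size_count_eq_card partition_upto_facts(1)[OF blob_pmf_partition])
    also have "\<dots> \<le> 4 * real k / (d\<^sup>2 * real n)"
      by (rule size_count_concentration[OF p(1) p1 k elim(3) d])
    also have "\<dots> = 4 * real k / d\<^sup>2 * (1 / real n)" by simp
    finally show ?case using elim(1) by simp
  qed
qed simp

text \<open>The law of the blob of a uniform vertex is an average over partitions, so convergence of
  means is required. It follows from the second moment of the deviations through
  \<open>\<bar>x\<bar> \<le> x\<^sup>2 / s + s\<close> with \<open>s = sqrt n\<close>.\<close>

lemma expected_size_count_tendsto:
  assumes k: "1 \<le> k"
  shows "(\<lambda>n. measure_pmf.expectation (blob_pmf p n) (\<lambda>P. real k * size_count k P / real n)) \<longlonglongrightarrow> real k * q p k"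
proof -
  have p1: "p < 1" using p by simp
  let ?E = "\<lambda>n. measure_pmf.expectation (blob_pmf p n) (\<lambda>P. real k * size_count k P / real n)"
  have bound: "\<bar>?E n - real k * q p k\<bar> \<le> real k * (4 * real k + 1) * real n powr (- (1 / 2))" if n: "k \<le> n" for n
  proof -
    have n0: "0 < real n" using k n by simp
    define s where "s = sqrt (real n)"
    have s: "0 < s" "real n = s * s" using n0 by (simp_all add: s_def)
    let ?D = "count_deviation p k n"
    have D: "\<bar>x\<bar> \<le> x\<^sup>2 / s + s" for x :: real
    proof (cases "\<bar>x\<bar> \<le> s")
      case True
      have "0 \<le> x\<^sup>2 / s" using s by simp
      then show ?thesis using True by linarith
    next
      case False
      then have "\<bar>x\<bar> * s \<le> \<bar>x\<bar> * \<bar>x\<bar>" by (intro mult_left_mono) auto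
      also have "\<dots> = x\<^sup>2" by (simp add: power2_eq_square)
      finally have "\<bar>x\<bar> \<le> x\<^sup>2 / s" using s by (simp add: pos_le_divide_eq)
      then show ?thesis using s by linarith
    qed
    have "?E n - real k * q p k =
      measure_pmf.expectation (blob_pmf p n) (\<lambda>P. real k * size_count k P / real n - real k * q p k)"
      by (subst Bochner_Integration.integral_diff) (auto intro: integrable_measure_pmf_finite finite_blob_pmf)
    also have "\<dots> = measure_pmf.expectation (blob_pmf p n) (\<lambda>P. real k / real n * ?D P)"
      using n0 by (intro expectation_cong_pmf) (simp add: count_deviation_def field_simps)
    finally have "\<bar>?E n - real k * q p k\<bar> \<le>
      measure_pmf.expectation (blob_pmf p n) (\<lambda>P. \<bar>real k / real n * ?D P\<bar>)"
      using integral_abs_bound[of "measure_pmf (blob_pmf p n)" "\<lambda>P. real k / real n * ?D P"] by simp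
    also have "\<dots> \<le> measure_pmf.expectation (blob_pmf p n) (\<lambda>P. real k / real n * ((?D P)\<^sup>2 / s + s))"
    proof (rule expectation_mono_finite[OF finite_blob_pmf])
      fix P
      have "\<bar>real k / real n * ?D P\<bar> = real k / real n * \<bar>?D P\<bar>" by (simp add: abs_mult)
      also have "\<dots> \<le> real k / real n * ((?D P)\<^sup>2 / s + s)" by (intro mult_left_mono D) simp
      finally show "\<bar>real k / real n * ?D P\<bar> \<le> real k / real n * ((?D P)\<^sup>2 / s + s)" .
    qed
    also have "\<dots> = real k / real n * (measure_pmf.expectation (blob_pmf p n) (\<lambda>P. (?D P)\<^sup>2) / s + s)"
      by (simp add: integrable_measure_pmf_finite finite_blob_pmf)
    also have "\<dots> \<le> real k / real n * (4 * real k * real n / s + s)"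
      using count_deviation_second_moment[OF p(1) p1 k order_refl n] s n0
      by (intro mult_left_mono add_right_mono divide_right_mono) auto
    also have "\<dots> = real k * (4 * real k + 1) * inverse s"
      unfolding s(2) using s(1) by (simp add: field_simps)
    also have "inverse s = real n powr (- (1 / 2))"
      using n0 by (simp add: s_def powr_minus powr_half_sqrt)
    finally show ?thesis .
  qed
  have "(\<lambda>n. real k * (4 * real k + 1) * real n powr (- (1 / 2))) \<longlonglongrightarrow> real k * (4 * real k + 1) * 0"
    by (intro tendsto_mult tendsto_const powr_minus_tendsto_0) simp
  then have "(\<lambda>n. real k * (4 * real k + 1) * real n powr (- (1 / 2))) \<longlonglongrightarrow> 0" by simp
  moreover have "\<forall>\<^sub>F n in sequentially. norm (?E n - real k * q p k) \<le> real k * (4 * real k + 1) * real n powr (- (1 / 2))"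
    using eventually_ge_at_top[of k] by eventually_elim (use bound in simp)
  ultimately have "(\<lambda>n. ?E n - real k * q p k) \<longlonglongrightarrow> 0"
    by (rule Lim_null_comparison[rotated])
  then show ?thesis by (simp add: LIM_zero_iff)
qed

text \<open>A uniform vertex hits a given blob with probability proportional to its size, which
  produces the size-biased count.\<close>

lemma pmf_uniform_blob_size:
  assumes "lam \<le> real n" "1 \<le> n"
  shows "pmf (uniform_blob_size lam p n) k = measure_pmf.expectation (blob_pmf p n) (\<lambda>P. real k * size_count k P / real n)"
proof -
  let ?M = "percolation_model lam p n"
  have "uniform_blob_size lam p n = bind_pmf ?M (\<lambda>\<omega>. map_pmf (\<lambda>u. card (blob_of n u \<omega>)) (pmf_of_set {1..n}))"
    by (simp add: uniform_blob_size_def pair_pmf_def map_bind_pmf map_pmf_def bind_assoc_pmf bind_return_pmf)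
  also have "\<dots> = bind_pmf (map_pmf (blobs n) ?M) (\<lambda>P. map_pmf (\<lambda>u. card (block_at P u)) (pmf_of_set {1..n}))"
    unfolding bind_map_pmf
  proof (intro bind_pmf_cong refl map_pmf_cong)
    fix \<omega> u assume "u \<in> set_pmf (pmf_of_set {1..n})"
    then have u: "u \<in> {1..n}" using assms by (subst (asm) set_pmf_of_set) auto
    have "block_at (blobs n \<omega>) u = blob_of n u \<omega>"
      unfolding blobs_def blob_of_def
      by (rule block_at_eq[OF partition_on_graph_components component_in_graph_components[OF u] component_of_self[OF u]])
    then show "card (blob_of n u \<omega>) = card (block_at (blobs n \<omega>) u)" by simp
  qed
  also have "map_pmf (blobs n) ?M = blob_pmf p n"
    by (rule map_pmf_blobs) (use p lam assms in auto)
  finally have "pmf (uniform_blob_size lam p n) k =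
    measure_pmf.prob (bind_pmf (blob_pmf p n) (\<lambda>P. map_pmf (\<lambda>u. card (block_at P u)) (pmf_of_set {1..n}))) {k}"
    by (simp add: pmf.rep_eq)
  also have "\<dots> = measure_pmf.expectation (blob_pmf p n) (\<lambda>P. measure_pmf.prob (map_pmf (\<lambda>u. card (block_at P u)) (pmf_of_set {1..n})) {k})"
    by (rule prob_bind_finite[OF finite_blob_pmf]) (use assms in auto)
  also have "\<dots> = measure_pmf.expectation (blob_pmf p n) (\<lambda>P. real k * size_count k P / real n)"
  proof (rule expectation_cong_pmf)
    fix P assume "P \<in> set_pmf (blob_pmf p n)"
    then have P: "partition_on {1..n} P" by (rule blob_pmf_partition)
    have "measure_pmf.prob (map_pmf (\<lambda>u. card (block_at P u)) (pmf_of_set {1..n})) {k} =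
      real (card ({1..n} \<inter> {u. card (block_at P u) = k})) / real n"
      using assms by (simp add: measure_pmf_of_set vimage_def)
    also have "real (card ({1..n} \<inter> {u. card (block_at P u) = k})) = (\<Sum>u\<in>{1..n}. of_bool (card (block_at P u) = k))"
      by (simp add: of_bool_def sum.If_cases)
    also have "\<dots> = (\<Sum>B\<in>P. real (card B) * of_bool (card B = k))"
      using sum_over_partition[OF P, of "\<lambda>B. of_bool (card B = k)"] by simp
    also have "\<dots> = real k * size_count k P"
      by (rule size_count_weighted[OF partition_upto_facts(1)[OF P]])
    finally show "measure_pmf.prob (map_pmf (\<lambda>u. card (block_at P u)) (pmf_of_set {1..n})) {k} = real k * size_count k P / real n" .
  qed
  finally show ?thesis .
qed

lemma uniform_blob_size_conv: "conv_in_distr (uniform_blob_size lam p) (limit_blob_size p)"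
proof (rule conv_in_distr_pmfI)
  fix k
  have ev: "\<forall>\<^sub>F n in sequentially. measure_pmf.expectation (blob_pmf p n) (\<lambda>P. real k * size_count k P / real n) = pmf (uniform_blob_size lam p n) k"
    using eventually_lam_le[of lam] eventually_ge_at_top[of 1]
    by eventually_elim (simp add: pmf_uniform_blob_size)
  show "(\<lambda>n. pmf (uniform_blob_size lam p n) k) \<longlonglongrightarrow> pmf (limit_blob_size p) k"
  proof (cases "k = 0")
    case True
    have "(\<lambda>n. 0 :: real) \<longlonglongrightarrow> 0" by simp
    moreover have "\<forall>\<^sub>F n in sequentially. 0 = pmf (uniform_blob_size lam p n) k"
      using ev True by simp
    ultimately have "(\<lambda>n. pmf (uniform_blob_size lam p n) k) \<longlonglongrightarrow> 0"
      by (rule Lim_transform_eventually)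
    then show ?thesis using True by (simp add: pmf_limit_blob_size[OF p])
  next
    case False
    then show ?thesis
      using Lim_transform_eventually[OF expected_size_count_tendsto ev]
      by (simp add: pmf_limit_blob_size[OF p])
  qed
qed

text \<open>A rank above \<open>K\<close> requires many blobs at least as large as the root blob.
  With high probability the root blob exceeds \<open>d * n powr p\<close>, and at most
  \<open>Y / d ^ r\<close> blobs do so.\<close>

lemma root_rank_tight:
  assumes e: "0 < e"
  shows "\<exists>K::nat. limsup (\<lambda>n. ereal (measure_pmf.prob (percolation_model lam p n)
          {\<omega>. blob_rank n (blob_of n 1 \<omega>) \<omega> > K})) < ereal e"
proof -
  have p1: "p < 1" using p by simp
  \<comment> \<open>Two failure events at \<open>e / 3\<close> each leave room for the strict
    inequality after taking the limsup.\<close>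
  have e3: "0 < e / 3" using e by simp
  obtain r :: nat where "1 / p < real r" using reals_Archimedean2 by blast
  then have r: "real r * p > 1" using p by (simp add: field_simps)
  obtain Y where Y: "Y \<ge> 1" "\<And>n. n \<ge> 1 \<Longrightarrow> measure_pmf.prob (blob_pmf p n)
      {P. Y * (real n powr p) ^ r < (\<Sum>B\<in>P. real (card B) ^ r)} \<le> e / 3"
    using power_moment_tight[OF p r e3] by blast
  define d where "d = (e / 6)\<^sup>2"
  have d: "0 < d" "2 * sqrt d = e / 3" using e by (simp_all add: d_def)
  obtain K0 :: nat where K0: "Y / d ^ r \<le> real K0" using real_arch_simple by blast
  define K where "K = Suc K0"
  have ev: "\<forall>\<^sub>F n in sequentially. ereal (measure_pmf.prob (percolation_model lam p n)
          {\<omega>. blob_rank n (blob_of n 1 \<omega>) \<omega> > K}) \<le> ereal (2 * e / 3)"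
    using eventually_lam_le[of lam] eventually_ge_at_top[of 1]
  proof eventually_elim
    case (elim n)
    have n: "0 < real n powr p" "1 \<in> {1..n}" using elim by auto
    have "blob_of n 1 \<omega> = block_at (blobs n \<omega>) 1" for \<omega>
      unfolding blobs_def blob_of_def
      by (rule block_at_eq[OF partition_on_graph_components component_in_graph_components[OF n(2)] component_of_self[OF n(2)], symmetric])
    then have "measure_pmf.prob (percolation_model lam p n) {\<omega>. blob_rank n (blob_of n 1 \<omega>) \<omega> > K} =
      measure_pmf.prob (percolation_model lam p n) {\<omega>. Suc (card {D \<in> blobs n \<omega>. ranked_before D (block_at (blobs n \<omega>) 1)}) > K}"
      by (simp add: blob_rank_def component_rank_def blobs_def)
    also have "\<dots> = measure_pmf.prob (blob_pmf p n) {P. Suc (card {D \<in> P. ranked_before D (block_at P 1)}) > K}"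
      by (rule prob_percolation_model_blobs) (use p lam elim in auto)
    also have "\<dots> \<le> measure_pmf.prob (blob_pmf p n) {P. Y * (real n powr p) ^ r < (\<Sum>B\<in>P. real (card B) ^ r)
        \<or> real (card (block_at P 1)) \<le> d * real n powr p}"
    proof (rule prob_mono_pmf, rule ccontr)
      fix P assume "P \<in> set_pmf (blob_pmf p n)" and K: "K < Suc (card {D \<in> P. ranked_before D (block_at P 1)})"
        and no: "\<not> (Y * (real n powr p) ^ r < (\<Sum>B\<in>P. real (card B) ^ r) \<or> real (card (block_at P 1)) \<le> d * real n powr p)"
      then have P: "partition_on {1..n} P" by (intro blob_pmf_partition)
      note fin = partition_upto_facts(1)[OF P]
      have "{D \<in> P. ranked_before D (block_at P 1)} \<subseteq> {B \<in> P. d * real n powr p < real (card B)}"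
        using no by (auto simp: ranked_before_def)
      then have "card {D \<in> P. ranked_before D (block_at P 1)} \<le> card {B \<in> P. d * real n powr p < real (card B)}"
        using fin by (intro card_mono) auto
      moreover have "real (card {B \<in> P. d * real n powr p < real (card B)}) \<le> Y / d ^ r"
        using no by (intro large_blocks_count fin n d) auto
      ultimately have "real (card {D \<in> P. ranked_before D (block_at P 1)}) \<le> real K0" using K0 by linarith
      then show False using K by (simp add: K_def)
    qed
    also have "\<dots> \<le> measure_pmf.prob (blob_pmf p n) {P. Y * (real n powr p) ^ r < (\<Sum>B\<in>P. real (card B) ^ r)}
       + measure_pmf.prob (blob_pmf p n) {P. real (card (block_at P 1)) \<le> d * real n powr p}"
      by (rule prob_disj_le)
    also have "\<dots> \<le> e / 3 + 2 * sqrt d * real 1 powr (p / 2)"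
      using elim d by (intro add_mono Y block_small_prob p(1) p1) auto
    finally show ?case using d by simp
  qed
  have "limsup (\<lambda>n. ereal (measure_pmf.prob (percolation_model lam p n)
          {\<omega>. blob_rank n (blob_of n 1 \<omega>) \<omega> > K})) \<le> ereal (2 * e / 3)"
    by (rule Limsup_bounded[OF ev])
  also have "\<dots> < ereal e" using e by simp
  finally show ?thesis by blast
qed

end

section \<open>Concentration of the full components\<close>

text \<open>In use \<open>u\<close> is \<open>1 - rho p lam\<close> and \<open>N\<close> is
  \<open>n powr p\<close>. The first clause tests large blobs against the predicted growth factor;
  the second catches components that become large without containing a large blob.\<close>

definition bad_components :: "real \<Rightarrow> real \<Rightarrow> real \<Rightarrow> real \<Rightarrow> nat \<Rightarrow> real \<Rightarrow> nat set set \<Rightarrow> nat set set \<Rightarrow> bool" where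
  "bad_components u \<delta> \<eta> \<theta> n N F R \<longleftrightarrow>
    (\<exists>A\<in>graph_components {1..n} F. \<exists>v\<in>A. \<delta> * N < real (card A) \<and>
       \<eta> * N < \<bar>real (card (component_of {1..n} R v)) - real (card A) / u\<bar>) \<or>
    (\<exists>A\<in>graph_components {1..n} F. \<exists>v\<in>A. real (card A) \<le> \<delta> * N \<and>
       (\<forall>B\<in>graph_components {1..n} F. B \<subseteq> component_of {1..n} R v \<longrightarrow> real (card B) \<le> \<delta> * N) \<and>
       \<theta> * N \<le> real (card (component_of {1..n} R v)))"

text \<open>The exponent of the upper tail divided by \<open>s\<close>. For
  \<open>\<tau> = 0\<close> it equals \<open>- u * \<eta> * N\<close>; half of this is given away to
  the drift error, which is controlled through \<open>w \<le> Y * N\<close>.\<close>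

lemma upper_exponent_bound:
  fixes u \<tau> w Y N \<eta> :: real
  assumes "0 < u" "0 \<le> \<tau>" "w \<le> Y * N" "0 \<le> N" "2 * \<tau> * Y / u + 2 * \<tau> * \<eta> \<le> u * \<eta> / 2"
  shows "w - (u - 2 * \<tau>) * (w / u + \<eta> * N) \<le> - (u * \<eta> / 2) * N"
proof -
  have "w - (u - 2 * \<tau>) * (w / u + \<eta> * N) = 2 * \<tau> / u * w + (2 * \<tau> * \<eta> - u * \<eta>) * N"
    using assms(1) by (simp add: field_simps)
  also have "\<dots> \<le> 2 * \<tau> / u * (Y * N) + (2 * \<tau> * \<eta> - u * \<eta>) * N"
    using assms by (intro add_right_mono mult_left_mono) auto
  also have "\<dots> = (2 * \<tau> * Y / u + 2 * \<tau> * \<eta> - u * \<eta>) * N" by (simp add: algebra_simps)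
  also have "\<dots> \<le> (- (u * \<eta> / 2)) * N" using assms by (intro mult_right_mono) auto
  finally show ?thesis .
qed

lemma lower_exponent_bound:
  fixes u \<tau> w Y N \<eta> :: real
  assumes "0 < u" "0 \<le> \<tau>" "0 \<le> \<eta>" "w \<le> Y * N" "0 \<le> N" "3 * \<tau> * Y / u \<le> u * \<eta> / 2"
  shows "(u + 3 * \<tau>) * (w / u - \<eta> * N) - w \<le> - (u * \<eta> / 2) * N"
proof -
  have "(u + 3 * \<tau>) * (w / u - \<eta> * N) - w = 3 * \<tau> / u * w - (u * \<eta> + 3 * \<tau> * \<eta>) * N"
    using assms(1) by (simp add: field_simps)
  also have "\<dots> \<le> 3 * \<tau> / u * (Y * N) - (u * \<eta>) * N"
    using assms by (intro diff_mono mult_left_mono mult_right_mono) auto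
  also have "\<dots> = (3 * \<tau> * Y / u - u * \<eta>) * N" by (simp add: algebra_simps)
  also have "\<dots> \<le> (- (u * \<eta> / 2)) * N" using assms by (intro mult_right_mono) auto
  finally show ?thesis .
qed

lemma partition_card_le:
  assumes "partition_on {1..n} P"
  shows "card P \<le> n"
proof -
  note f = partition_upto_facts[OF assms]
  have "real (card P) = (\<Sum>B\<in>P. 1)" by simp
  also have "\<dots> \<le> (\<Sum>B\<in>P. real (card B))" using f(6) by (intro sum_mono) simp
  finally show ?thesis using f(7) by simp
qed

text \<open>Large blobs are boundedly many, so \<open>b1\<close> and \<open>b2\<close> need only
  tend to 0; small ones are counted by \<open>n\<close>, so \<open>b3\<close> must be of smaller
  order than \<open>1 / n\<close>. Lower bounds may ignore blobs above \<open>L\<close>, since this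
  only shrinks the explored set.\<close>

lemma bad_components_union_bound:
  fixes r :: real
  assumes TF: "(T, F) \<in> set_pmf (perc_tree p n)" and P_def: "P = graph_components {1..n} F"
    and L: "real L \<le> \<delta> * N"
    and K1: "real (card {A \<in> P. \<delta> * N < real (card A)}) \<le> K1"
    and up: "\<And>A. A \<in> P \<Longrightarrow> \<delta> * N < real (card A) \<Longrightarrow>
      measure_pmf.prob (random_edge_subset r (vertex_pairs n - T))
        {S. real (card A) / u + \<eta> * N \<le> real (card (reach (P - {A}) S A))} \<le> b1"
    and low: "\<And>A. A \<in> P \<Longrightarrow> \<delta> * N < real (card A) \<Longrightarrow>
      measure_pmf.prob (random_edge_subset r (vertex_pairs n - T))
        {S. real (card (reach {B \<in> P. card B \<le> L} S A)) \<le> real (card A) / u - \<eta> * N} \<le> b2"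
    and small: "\<And>A. A \<in> P \<Longrightarrow> real (card A) \<le> \<delta> * N \<Longrightarrow>
      measure_pmf.prob (random_edge_subset r (vertex_pairs n - T))
        {S. \<theta> * N \<le> real (card (reach ({B \<in> P. real (card B) \<le> \<delta> * N} - {A}) S A))} \<le> b3"
    and b: "0 \<le> b1" "0 \<le> b2" "0 \<le> b3"
  shows "measure_pmf.prob (random_edge_subset r (vertex_pairs n - T)) {S. bad_components u \<delta> \<eta> \<theta> n N F (F \<union> S)}
    \<le> K1 * (b1 + b2) + real n * b3"
proof -
  let ?M = "random_edge_subset r (vertex_pairs n - T)"
  have P: "partition_on {1..n} P" unfolding P_def by (rule partition_on_graph_components)
  note f = partition_upto_facts[OF P]
  define Big where "Big = {A \<in> P. \<delta> * N < real (card A)}"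
  define Small where "Small = {A \<in> P. real (card A) \<le> \<delta> * N}"
  have fin: "finite Big" "finite Small" using f(1) by (auto simp: Big_def Small_def)
  let ?up = "\<lambda>A S. real (card A) / u + \<eta> * N \<le> real (card (reach (P - {A}) S A))"
  let ?low = "\<lambda>A S. real (card (reach {B \<in> P. card B \<le> L} S A)) \<le> real (card A) / u - \<eta> * N"
  let ?sm = "\<lambda>A S. \<theta> * N \<le> real (card (reach (Small - {A}) S A))"
  have Fn: "\<Union>F \<subseteq> {1..n}" using perc_tree_support(1,4)[OF TF] by blast
  have "measure_pmf.prob ?M {S. bad_components u \<delta> \<eta> \<theta> n N F (F \<union> S)} \<le>
    measure_pmf.prob ?M {S. (\<exists>A\<in>Big. ?up A S \<or> ?low A S) \<or> (\<exists>A\<in>Small. ?sm A S)}"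
  proof (rule prob_mono_pmf)
    fix S assume "S \<in> set_pmf ?M"
    then have "S \<subseteq> vertex_pairs n - T" by (rule set_random_edge_subset)
    then have Sn: "\<Union>S \<subseteq> {1..n}" by auto
    have comp: "component_of {1..n} (F \<union> S) v = reach (P - {A}) S A" if "A \<in> P" "v \<in> A" for A v
      using reach_eq_component[OF Fn Sn, of A v] that by (simp add: P_def)
    assume "bad_components u \<delta> \<eta> \<theta> n N F (F \<union> S)"
    then consider
      (big) A v where "A \<in> P" "v \<in> A" "\<delta> * N < real (card A)"
        "\<eta> * N < \<bar>real (card (component_of {1..n} (F \<union> S) v)) - real (card A) / u\<bar>"
    | (sm) A v where "A \<in> P" "v \<in> A" "real (card A) \<le> \<delta> * N"
        "\<And>B. B \<in> P \<Longrightarrow> B \<subseteq> component_of {1..n} (F \<union> S) v \<Longrightarrow> real (card B) \<le> \<delta> * N"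
        "\<theta> * N \<le> real (card (component_of {1..n} (F \<union> S) v))"
      unfolding bad_components_def P_def by blast
    then show "(\<exists>A\<in>Big. ?up A S \<or> ?low A S) \<or> (\<exists>A\<in>Small. ?sm A S)"
    proof cases
      case big
      note bf = block_family_of_partition[OF P big(1)]
      have "{B \<in> P. card B \<le> L} \<subseteq> P - {A}" using big(3) L by auto
      then have "reach {B \<in> P. card B \<le> L} S A \<subseteq> reach (P - {A}) S A" by (rule reach_mono)
      then have "card (reach {B \<in> P. card B \<le> L} S A) \<le> card (reach (P - {A}) S A)"
        by (rule card_mono[OF finite_reach[OF bf]])
      then have "?up A S \<or> ?low A S"
        using big(4) unfolding comp[OF big(1,2)] by linarith
      then show ?thesis using big(1,3) by (auto simp: Big_def)
    next
      case sm
      have "reach (P - {A}) S A \<subseteq> reach (Small - {A}) S A"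
        by (rule reach_restrict) (use sm(4) comp[OF sm(1,2)] in \<open>auto simp: Small_def\<close>)
      moreover have "finite (reach (Small - {A}) S A)"
        by (rule finite_reach, rule block_family_mono[OF block_family_of_partition[OF P sm(1)]])
           (auto simp: Small_def)
      ultimately have "card (reach (P - {A}) S A) \<le> card (reach (Small - {A}) S A)" by (intro card_mono)
      then have "?sm A S" using sm(5) unfolding comp[OF sm(1,2)] by linarith
      then show ?thesis using sm(1,3) by (auto simp: Small_def)
    qed
  qed
  also have "\<dots> \<le> measure_pmf.prob ?M {S. \<exists>A\<in>Big. ?up A S \<or> ?low A S} + measure_pmf.prob ?M {S. \<exists>A\<in>Small. ?sm A S}"
    by (rule prob_disj_le)
  also have "\<dots> \<le> (\<Sum>A\<in>Big. measure_pmf.prob ?M {S. ?up A S \<or> ?low A S}) + (\<Sum>A\<in>Small. measure_pmf.prob ?M {S. ?sm A S})"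
    by (intro add_mono prob_Bex_le fin)
  also have "\<dots> \<le> (\<Sum>A\<in>Big. b1 + b2) + (\<Sum>A\<in>Small. b3)"
  proof (intro add_mono sum_mono)
    fix A assume "A \<in> Big"
    then have A: "A \<in> P" "\<delta> * N < real (card A)" by (auto simp: Big_def)
    show "measure_pmf.prob ?M {S. ?up A S \<or> ?low A S} \<le> b1 + b2"
      using prob_disj_le[of ?M "?up A" "?low A"] up[OF A] low[OF A] by linarith
  next
    fix A assume "A \<in> Small"
    then show "measure_pmf.prob ?M {S. ?sm A S} \<le> b3"
      using small[of A] unfolding Small_def by simp
  qed
  also have "\<dots> = real (card Big) * (b1 + b2) + real (card Small) * b3" by simp
  also have "\<dots> \<le> K1 * (b1 + b2) + real n * b3"
  proof (intro add_mono mult_right_mono)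
    show "real (card Big) \<le> K1" using K1 by (simp add: Big_def)
    have "card Small \<le> card P" using f(1) by (intro card_mono) (auto simp: Small_def)
    then show "real (card Small) \<le> real n" using partition_card_le[OF P] by simp
  qed (use b in auto)
  finally show ?thesis .
qed

context
  fixes p lam :: real
  assumes p: "0 < p" "p < 1 / 2" and lam: "0 < lam" and sub: "rho p lam < 1"
begin

lemma bad_components_rare:
  assumes e: "0 < e" and \<eta>: "0 < \<eta>" and \<theta>: "0 < \<theta>"
  shows "\<exists>\<delta>0>0. \<forall>\<delta>. 0 < \<delta> \<longrightarrow> \<delta> \<le> \<delta>0 \<longrightarrow>
    (\<exists>G \<beta>. (\<forall>\<^sub>F n in sequentially. measure_pmf.prob (blob_pmf p n) {P. \<not> G n P} \<le> e) \<and> \<beta> \<longlonglongrightarrow> 0 \<and>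
      (\<forall>\<^sub>F n in sequentially. \<forall>T F. (T, F) \<in> set_pmf (perc_tree p n) \<longrightarrow> G n (graph_components {1..n} F) \<longrightarrow>
        measure_pmf.prob (random_edge_subset (p * (lam / real n)) (vertex_pairs n - T))
          {S. bad_components (1 - rho p lam) \<delta> \<eta> \<theta> n (real n powr p) F (F \<union> S)} \<le> \<beta> n))"
proof -
  define c where "c = p * lam"
  define \<xi> where "\<xi> = 1 / (1 - 2 * p)"
  define u where "u = 1 - rho p lam"
  define e1 where "e1 = (1 + p - max 1 (1 / 2 + 2 * p)) / 2"
  have c: "0 < c" using p lam by (simp add: c_def)
  have \<xi>: "0 < \<xi>" using p by (simp add: \<xi>_def)
  have u: "0 < u" "u = 1 - c * \<xi>" using sub by (simp_all add: u_def rho_def c_def \<xi>_def)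
  have u1: "u < 1" using u c \<xi> by simp
  have e1: "0 < e1" using p by (auto simp: e1_def max_def)
  \<comment> \<open>For \<open>s = a' * ln n / N\<close> the target \<open>\<theta> * N\<close>
    yields \<open>n powr (- 3)\<close> at the guaranteed rate \<open>u / 2\<close>, and the starting
    blob costs at most a factor \<open>n\<close> since \<open>a' * \<delta> \<le> 1\<close>. The
    result \<open>n powr (- 2)\<close> survives the union over at most \<open>n\<close>
    blobs.\<close>
  define a' where "a' = 6 / (u * \<theta>)"
  have a': "0 < a'" "a' * (u / 2 * \<theta>) = 3" using u \<theta> by (simp_all add: a'_def)
  \<comment> \<open>The first entry gives \<open>a' * \<delta> \<le> 1\<close>; the second keeps
    \<open>a' * \<delta>\<close> below the margin \<open>e1\<close> left by the third
    moment.\<close>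
  define \<delta>0 where "\<delta>0 = min (1 / a') (e1 / (2 * a'))"
  have \<delta>0: "0 < \<delta>0" using a' e1 by (simp add: \<delta>0_def)
  obtain r :: nat where "1 / p < real r" using reals_Archimedean2 by blast
  then have r: "real r * p > 1" using p by (simp add: field_simps)
  then have r1: "1 \<le> r" by (cases r) auto
  obtain Y where Y: "Y \<ge> 1" "\<And>\<kappa>. 0 < \<kappa> \<Longrightarrow> \<exists>L. \<forall>\<^sub>F n in sequentially.
    measure_pmf.prob (blob_pmf p n) {P. \<not> good_blobs p r Y \<kappa> L n P} \<le> e"
    using good_blobs_prob[OF p r e] by blast
  \<comment> \<open>\<open>q0\<close> bundles the requirements on \<tau> into one inequality;
    \<open>lin\<close> unpacks it into those of the two exponent bounds and
    \<open>2 * \<tau> \<le> u / 2\<close>.\<close>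
  define q0 where "q0 = 4 * Y / u + 4 * \<eta> + 4"
  have q0: "0 < q0" using Y u \<eta> by (simp add: q0_def add_pos_pos)
  define \<kappa> where "\<kappa> = min (\<xi> / 2) (u * min \<eta> 1 / (2 * c * q0))"
  define \<tau> where "\<tau> = c * \<kappa>"
  have \<kappa>: "0 < \<kappa>" "\<kappa> < \<xi>" using \<xi> u \<eta> c q0 by (auto simp: \<kappa>_def min_less_iff_disj)
  have \<tau>: "0 < \<tau>" using c \<kappa> by (simp add: \<tau>_def)
  have \<tau>q: "\<tau> * q0 \<le> u * min \<eta> 1 / 2"
  proof -
    have "\<kappa> \<le> u * min \<eta> 1 / (2 * c * q0)" by (simp add: \<kappa>_def)
    then have "\<kappa> * (2 * c * q0) \<le> u * min \<eta> 1" using c q0 by (simp add: pos_le_divide_eq)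
    then show ?thesis by (simp add: \<tau>_def algebra_simps)
  qed
  have nn: "0 \<le> \<tau> * (Y / u)" "0 \<le> \<tau> * \<eta>" using \<tau> Y u \<eta> by auto
  have expand: "\<tau> * q0 = 4 * (\<tau> * (Y / u)) + 4 * (\<tau> * \<eta>) + 4 * \<tau>" by (simp add: q0_def algebra_simps)
  have m1: "u * min \<eta> 1 \<le> u * \<eta>" "u * min \<eta> 1 \<le> u * 1" using u by (intro mult_left_mono; simp)+
  have assoc: "2 * \<tau> * Y / u = 2 * (\<tau> * (Y / u))" "3 * \<tau> * Y / u = 3 * (\<tau> * (Y / u))" "2 * \<tau> * \<eta> = 2 * (\<tau> * \<eta>)"
    by simp_all
  have lin: "2 * x + 2 * y \<le> z / 2 \<and> 3 * x \<le> z / 2 \<and> 2 * t \<le> z' / 2"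
    if "4 * x + 4 * y + 4 * t \<le> m / 2" "0 \<le> x" "0 \<le> y" "0 < t" "m \<le> z" "m \<le> z'" for x y z z' t m :: real
    using that by linarith
  note lin' = lin[OF _ nn \<tau> m1, folded expand, OF \<tau>q]
  have \<tau>1: "2 * \<tau> * Y / u + 2 * \<tau> * \<eta> \<le> u * \<eta> / 2"
    unfolding assoc using lin' by blast
  have \<tau>2: "3 * \<tau> * Y / u \<le> u * \<eta> / 2"
    unfolding assoc using lin' by blast
  have \<tau>3: "u / 2 \<le> u - 2 * \<tau>"
    using lin' by simp
  obtain L where L: "\<forall>\<^sub>F n in sequentially. measure_pmf.prob (blob_pmf p n) {P. \<not> good_blobs p r Y \<kappa> L n P} \<le> e"
    using Y(2)[OF \<kappa>(1)] by blast
  \<comment> \<open>Large blobs have sizes up to \<open>Y * N\<close>, so only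
    \<open>a * Y < e1\<close> can be afforded; the upper tail is then
    \<open>n powr (- (a * h))\<close>.\<close>
  define a where "a = e1 / (2 * Y)"
  have a: "0 < a" "a * Y < e1" using e1 Y by (simp_all add: a_def)
  define h where "h = u * \<eta> / 2"
  have h: "0 < h" using u \<eta> by (simp add: h_def)
  show ?thesis
  proof (intro exI[of _ \<delta>0] conjI allI impI \<delta>0)
    fix \<delta> assume \<delta>: "0 < \<delta>" "\<delta> \<le> \<delta>0"
    have \<delta>a: "a' * \<delta> \<le> 1" "a' * \<delta> < e1"
    proof -
      have "\<delta> \<le> 1 / a'" "\<delta> \<le> e1 / (2 * a')" using \<delta> by (auto simp: \<delta>0_def)
      then have "a' * \<delta> \<le> 1" "a' * \<delta> \<le> e1 / 2" using a' by (simp_all add: field_simps)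
      then show "a' * \<delta> \<le> 1" "a' * \<delta> < e1" using e1 by auto
    qed
    define \<beta> where "\<beta> n = Y / \<delta> ^ r * (real n powr (- (a * h)) + exp (c * real L) * exp (- (h * real n powr (p / 2)))) + real n * real n powr (- 2)" for n
    let ?G = "\<lambda>n. good_blobs p r Y \<kappa> L n"
    have lim_half: "filterlim (\<lambda>n. real n powr (p / 2)) at_top sequentially"
      by (rule filterlim_compose[OF real_powr_at_top filterlim_real_sequentially]) (use p in simp)
    have lim_p: "filterlim (\<lambda>n. real n powr p) at_top sequentially"
      by (rule filterlim_compose[OF real_powr_at_top filterlim_real_sequentially]) (use p in simp)
    have \<beta>lim: "\<beta> \<longlonglongrightarrow> 0"
    proof -
      have "(\<lambda>n. exp (- (h * real n powr (p / 2)))) \<longlonglongrightarrow> 0"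
        by (rule filterlim_compose[OF exp_at_bot])
           (intro filterlim_uminus_at_bot_at_top[THEN filterlim_compose] filterlim_tendsto_pos_mult_at_top[OF tendsto_const h lim_half])
      moreover have "(\<lambda>n. real n * real n powr (- 2)) \<longlonglongrightarrow> 0"
      proof (rule Lim_transform_eventually)
        show "(\<lambda>n. real n powr (- 1)) \<longlonglongrightarrow> 0" by (intro powr_minus_tendsto_0) simp
        show "\<forall>\<^sub>F n in sequentially. real n powr (- 1) = real n * real n powr (- 2)"
          using eventually_gt_at_top[of 0]
        proof eventually_elim
          case (elim n)
          have "real n * real n powr (- 2) = real n powr 1 * real n powr (- 2)" using elim by simp
          also have "\<dots> = real n powr (- 1)" unfolding powr_add[symmetric] by simp
          finally show ?case by simp
        qed
      qed
      moreover have "(\<lambda>n. real n powr (- (a * h))) \<longlonglongrightarrow> 0"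
        using a h by (intro powr_minus_tendsto_0) simp
      ultimately have "\<beta> \<longlonglongrightarrow> Y / \<delta> ^ r * (0 + exp (c * real L) * 0) + 0"
        unfolding \<beta>_def by (intro tendsto_intros)
      then show ?thesis by simp
    qed
    have X0: "0 \<le> Y / u" and L0: "0 \<le> real L" using Y u by auto
    have ev: "\<forall>\<^sub>F n in sequentially. \<forall>T F. (T, F) \<in> set_pmf (perc_tree p n) \<longrightarrow> ?G n (graph_components {1..n} F) \<longrightarrow>
        measure_pmf.prob (random_edge_subset (p * (lam / real n)) (vertex_pairs n - T))
          {S. bad_components u \<delta> \<eta> \<theta> n (real n powr p) F (F \<union> S)} \<le> \<beta> n"
    proof -
      have cond1: "\<forall>\<^sub>F n in sequentially. \<forall>P BB. finite P \<longrightarrow> BB \<subseteq> P \<longrightarrow>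
        (\<Sum>B\<in>P. real (card B) ^ 2) \<le> (\<xi> + \<kappa>) * real n \<longrightarrow>
        (\<Sum>B\<in>P. real (card B) ^ 3) \<le> real n powr (1 + p - e1) \<longrightarrow>
        (\<forall>B\<in>BB. real (card B) \<le> Y * real n powr p) \<longrightarrow>
        a * ln (real n) / real n powr p * (1 - c * \<xi> - 2 * (c * \<kappa>)) +
          (\<Sum>B\<in>BB. real (card (B :: nat set)) * (c / real n * (exp (a * ln (real n) / real n powr p * real (card B)) - 1)))
          \<le> a * ln (real n) / real n powr p"
        using Y a by (intro eventually_upper_condition less_imp_le[OF c] \<kappa>(1) p(1)) auto
      have cond2: "\<forall>\<^sub>F n in sequentially. \<forall>P BB. finite P \<longrightarrow> BB \<subseteq> P \<longrightarrow>
        (\<Sum>B\<in>P. real (card B) ^ 2) \<le> (\<xi> + \<kappa>) * real n \<longrightarrow>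
        (\<Sum>B\<in>P. real (card B) ^ 3) \<le> real n powr (1 + p - e1) \<longrightarrow>
        (\<forall>B\<in>BB. real (card B) \<le> \<delta> * real n powr p) \<longrightarrow>
        a' * ln (real n) / real n powr p * (1 - c * \<xi> - 2 * (c * \<kappa>)) +
          (\<Sum>B\<in>BB. real (card (B :: nat set)) * (c / real n * (exp (a' * ln (real n) / real n powr p * real (card B)) - 1)))
          \<le> a' * ln (real n) / real n powr p"
        using \<delta> \<delta>a a' by (intro eventually_upper_condition less_imp_le[OF c] \<kappa>(1) p(1)) auto
      have cond3: "\<forall>\<^sub>F n in sequentially. \<forall>BB x. finite BB \<longrightarrow> x \<le> Y / u * real n powr p \<longrightarrow>
        (\<xi> - \<kappa>) * real n \<le> (\<Sum>B\<in>BB. real (card B) ^ 2) \<longrightarrow> (\<forall>B\<in>BB. real (card (B :: nat set)) \<le> real L) \<longrightarrow>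
        real n powr (- (p / 2)) + 2 * x * (c / real n * (real n powr (- (p / 2)) * real L)) \<le>
          real n powr (- (p / 2)) * (1 - c * \<xi> + 3 * (c * \<kappa>)) +
          (\<Sum>B\<in>BB. real (card B) * (c / real n * (1 - exp (- (real n powr (- (p / 2))) * real (card B)))))"
        using p by (intro eventually_lower_condition c \<kappa> X0 L0) auto
      have big: "\<forall>\<^sub>F n in sequentially. real L / \<delta> \<le> real n powr p"
        using lim_p unfolding filterlim_at_top by blast
      show ?thesis
        using cond1 cond2 cond3 big eventually_lam_le[of lam] eventually_ge_at_top[of 1]
      proof eventually_elim
        case (elim n)
        show ?case
        proof (intro allI impI)
          fix T F assume TF: "(T, F) \<in> set_pmf (perc_tree p n)" and G: "?G n (graph_components {1..n} F)"
          define P where "P = graph_components {1..n} F"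
          define N where "N = real n powr p"
          define rr where "rr = c / real n"
          have P: "partition_on {1..n} P" unfolding P_def by (rule partition_on_graph_components)
          note f = partition_upto_facts[OF P]
          have n: "0 < real n" and N: "0 < N" using elim by (auto simp: N_def)
          have rr_eq: "p * (lam / real n) = rr" by (simp add: rr_def c_def)
          have rr: "0 \<le> rr" "rr \<le> 1"
          proof -
            have "lam / real n \<le> 1" using elim(5) n by simp
            then have "p * (lam / real n) \<le> 1 * 1" using p lam n by (intro mult_mono) auto
            then show "rr \<le> 1" unfolding rr_eq by simp
            show "0 \<le> rr" using c n by (simp add: rr_def)
          qed
          have g1: "(\<Sum>B\<in>P. real (card B) ^ 2) \<le> (\<xi> + \<kappa>) * real n"
            and g2: "(\<Sum>B\<in>P. real (card B) ^ 3) \<le> real n powr (1 + p - e1)"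
            and g3: "(\<Sum>B\<in>P. real (card B) ^ r) \<le> Y * N ^ r"
            and g4: "(\<xi> - \<kappa>) * real n \<le> (\<Sum>B\<in>{B \<in> P. card B \<le> L}. real (card B) ^ 2)"
            using G unfolding good_blobs_def P_def N_def \<xi>_def e1_def by auto
          have size: "real (card B) \<le> Y * N" if "B \<in> P" for B
            by (rule block_size_bound[OF f(1) g3 N Y(1) r1 that])
          have finE: "finite (vertex_pairs n - T)" using finite_vertex_pairs by simp
          have LN: "real L \<le> \<delta> * N" using elim(4) \<delta> by (simp add: N_def pos_divide_le_eq mult.commute)
          have lnn: "0 \<le> ln (real n)" using elim(6) by simp
          let ?M = "random_edge_subset rr (vertex_pairs n - T)"
          have "measure_pmf.prob ?M {S. bad_components u \<delta> \<eta> \<theta> n N F (F \<union> S)} \<le>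
            Y / \<delta> ^ r * (real n powr (- (a * h)) + exp (c * real L) * exp (- (h * real n powr (p / 2)))) + real n * real n powr (- 2)"
          proof (rule bad_components_union_bound[OF TF P_def LN])
            show "real (card {A \<in> P. \<delta> * N < real (card A)}) \<le> Y / \<delta> ^ r"
              by (rule large_blocks_count[OF f(1) g3 N \<delta>(1)])
          next
            fix A assume A: "A \<in> P" "\<delta> * N < real (card A)"
            define s where "s = a * ln (real n) / N"
            have s: "0 \<le> s" "s * N = a * ln (real n)" using a lnn N by (simp_all add: s_def)
            have t0: "0 \<le> s * (u - 2 * \<tau>)"
              by (rule mult_nonneg_nonneg) (use \<tau>3 u(1) s(1) in linarith)+
            have cond: "s * (u - 2 * \<tau>) + (\<Sum>B\<in>P - {A}. real (card B) * (rr * (exp (s * real (card B)) - 1))) \<le> s"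
              using elim(1)[rule_format, of P "P - {A}"] f(1) g1 g2 size
              unfolding s_def N_def rr_def u(2) \<tau>_def by auto
            have "measure_pmf.prob ?M {S. real (card A) / u + \<eta> * N \<le> real (card (reach (P - {A}) S A))} \<le>
              exp (s * real (card A) - s * (u - 2 * \<tau>) * (real (card A) / u + \<eta> * N))"
              by (rule reach_upper_tail[OF rr t0 s(1) finE block_family_of_partition[OF P A(1)] cond])
            also have "\<dots> \<le> exp (- (a * h) * ln (real n))"
            proof -
              have "s * (real (card A) - (u - 2 * \<tau>) * (real (card A) / u + \<eta> * N)) \<le> s * (- h * N)"
                using upper_exponent_bound[OF u(1) less_imp_le[OF \<tau>] size[OF A(1)] less_imp_le[OF N] \<tau>1] s(1)
                unfolding h_def by (intro mult_left_mono) auto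
              also have "\<dots> = - (a * h) * ln (real n)" using s(2) by (simp add: algebra_simps)
              finally show ?thesis
                by (simp only: right_diff_distrib[of s "real (card A)"] mult.assoc exp_le_cancel_iff)
            qed
            also have "\<dots> = real n powr (- (a * h))" using n by (simp add: powr_def)
            finally show "measure_pmf.prob ?M {S. real (card A) / u + \<eta> * N \<le> real (card (reach (P - {A}) S A))} \<le> real n powr (- (a * h))" .
          next
            fix A assume A: "A \<in> P" "\<delta> * N < real (card A)"
            define s where "s = real n powr (- (p / 2))"
            define BB where "BB = {B \<in> P. card B \<le> L}"
            have s: "0 \<le> s" "s * N = real n powr (p / 2)"
              using n by (simp_all add: s_def N_def powr_add[symmetric])
            \<comment> \<open>With \<open>s \<le> 1\<close> the price
              \<open>\<theta>m * card T\<close> of the tree pairs is at most the constant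
              \<open>c * L\<close>, as the tree has at most \<open>n\<close> edges.\<close>
            have "s \<le> real n powr 0" unfolding s_def using p elim(6) by (intro powr_mono) auto
            then have s1: "s \<le> 1" using n by simp
            have BBA: "BB \<subseteq> P - {A}" using A(2) LN by (auto simp: BB_def)
            have bf: "block_family A BB" by (rule block_family_mono[OF block_family_of_partition[OF P A(1)] BBA])
            define x where "x = real (card A) / u - \<eta> * N"
            have xN: "x \<le> Y / u * real n powr p"
            proof -
              have "real (card A) / u \<le> Y * N / u" using size[OF A(1)] u by (intro divide_right_mono) auto
              moreover have "0 \<le> \<eta> * N" using \<eta> N by simp
              ultimately show ?thesis by (simp add: x_def N_def)
            qed
            define \<theta>m where "\<theta>m = rr * (s * real L)"
            have tail: "measure_pmf.prob ?M {S. real (card (reach BB S A)) \<le> x} \<le>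
              exp (s * (u + 3 * \<tau>) * x - s * real (card A) + \<theta>m * real (card T))"
            proof (rule reach_lower_tail[OF rr _ s(1) perc_tree_support(2)[OF TF] finE bf])
              show "0 \<le> s * (u + 3 * \<tau>)" using s u \<tau> by simp
              show "0 \<le> \<theta>m" using rr s by (simp add: \<theta>m_def)
              show "rr * (1 - exp (- s * real (card B))) \<le> \<theta>m" if B: "B \<in> BB" for B
              proof -
                have "1 - exp (- s * real (card B)) \<le> s * real (card B)"
                  using exp_ge_add_one_self[of "- s * real (card B)"] by simp
                also have "\<dots> \<le> s * real L" using B s by (intro mult_left_mono) (auto simp: BB_def)
                finally show ?thesis unfolding \<theta>m_def using rr by (intro mult_left_mono)
              qed
              show "{b, c'} \<in> vertex_pairs n - T \<union> T" if "b \<in> A \<union> \<Union>BB" "c' \<in> A \<union> \<Union>BB" "b \<noteq> c'" for b c'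
              proof -
                have "A \<union> \<Union>BB \<subseteq> {1..n}" using f(4) A(1) by (auto simp: BB_def)
                then show ?thesis using that by (auto simp: card_2_iff)
              qed
              show "s + 2 * x * \<theta>m \<le> s * (u + 3 * \<tau>) + (\<Sum>B\<in>BB. real (card B) * (rr * (1 - exp (- s * real (card B)))))"
                using elim(3)[rule_format, of BB x] f(1) xN g4
                unfolding s_def \<theta>m_def rr_def u(2) \<tau>_def BB_def by auto
            qed
            also have "\<dots> \<le> exp (c * real L + - (h * real n powr (p / 2)))"
            proof -
              have "\<theta>m * real (card T) \<le> \<theta>m * real n"
                using perc_tree_support(3)[OF TF] rr s by (intro mult_left_mono) (auto simp: \<theta>m_def)
              also have "\<dots> = s * (c * real L)" using n by (simp add: \<theta>m_def rr_def)
              also have "\<dots> \<le> 1 * (c * real L)" using s1 c by (intro mult_right_mono) auto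
              finally have 1: "\<theta>m * real (card T) \<le> c * real L" by simp
              have "s * ((u + 3 * \<tau>) * x - real (card A)) \<le> s * (- h * N)"
                using lower_exponent_bound[OF u(1) less_imp_le[OF \<tau>] less_imp_le[OF \<eta>] size[OF A(1)] less_imp_le[OF N] \<tau>2] s(1)
                unfolding h_def x_def by (intro mult_left_mono) auto
              also have "\<dots> = - (h * real n powr (p / 2))" using s(2) by (simp add: algebra_simps)
              finally have "s * (u + 3 * \<tau>) * x - s * real (card A) \<le> - (h * real n powr (p / 2))"
                by (simp only: right_diff_distrib[of s _ "real (card A)"] mult.assoc)
              with 1 show ?thesis by simp
            qed
            finally show "measure_pmf.prob ?M {S. real (card (reach {B \<in> P. card B \<le> L} S A)) \<le> real (card A) / u - \<eta> * N}
              \<le> exp (c * real L) * exp (- (h * real n powr (p / 2)))"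
              unfolding exp_add BB_def x_def .
          next
            fix A assume A: "A \<in> P" "real (card A) \<le> \<delta> * N"
            define s where "s = a' * ln (real n) / N"
            have s: "0 \<le> s" "s * N = a' * ln (real n)" using a' lnn N by (simp_all add: s_def)
            have t0: "0 \<le> s * (u - 2 * \<tau>)"
              by (rule mult_nonneg_nonneg) (use \<tau>3 u(1) s(1) in linarith)+
            define BB where "BB = {B \<in> P. real (card B) \<le> \<delta> * N} - {A}"
            have BB: "BB \<subseteq> P" "BB \<subseteq> P - {A}" by (auto simp: BB_def)
            have bf: "block_family A BB" by (rule block_family_mono[OF block_family_of_partition[OF P A(1)] BB(2)])
            have cond: "s * (u - 2 * \<tau>) + (\<Sum>B\<in>BB. real (card B) * (rr * (exp (s * real (card B)) - 1))) \<le> s"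
            proof -
              have "\<forall>B\<in>BB. real (card B) \<le> \<delta> * real n powr p" by (simp add: BB_def N_def)
              with elim(2)[THEN spec[of _ P], THEN spec[of _ BB]] f(1) BB(1) g1 g2
              show ?thesis unfolding s_def N_def rr_def u(2) \<tau>_def by blast
            qed
            have "measure_pmf.prob ?M {S. \<theta> * N \<le> real (card (reach BB S A))} \<le>
              exp (s * real (card A) - s * (u - 2 * \<tau>) * (\<theta> * N))"
              by (rule reach_upper_tail[OF rr t0 s(1) finE bf cond])
            also have "\<dots> \<le> exp (- 2 * ln (real n))"
            proof -
              have "s * real (card A) \<le> s * (\<delta> * N)" using A(2) s by (intro mult_left_mono) auto
              also have "\<dots> = (a' * \<delta>) * ln (real n)" using s(2) by (simp add: algebra_simps)
              also have "\<dots> \<le> 1 * ln (real n)" using \<delta>a lnn by (intro mult_right_mono) auto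
              finally have 1: "s * real (card A) \<le> ln (real n)" by simp
              have "3 * ln (real n) = a' * ln (real n) * (u / 2 * \<theta>)" using a'(2) by (simp add: algebra_simps)
              also have "\<dots> = s * (u / 2) * (\<theta> * N)" unfolding s(2)[symmetric] by simp
              also have "\<dots> \<le> s * (u - 2 * \<tau>) * (\<theta> * N)"
                using \<tau>3 s \<theta> N by (intro mult_right_mono mult_left_mono) auto
              finally show ?thesis using 1 by simp
            qed
            also have "\<dots> = real n powr (- 2)" using n by (simp add: powr_def)
            finally show "measure_pmf.prob ?M {S. \<theta> * N \<le> real (card (reach ({B \<in> P. real (card B) \<le> \<delta> * N} - {A}) S A))} \<le> real n powr (- 2)"
              unfolding BB_def .
          qed auto
          then show "measure_pmf.prob (random_edge_subset (p * (lam / real n)) (vertex_pairs n - T))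
            {S. bad_components u \<delta> \<eta> \<theta> n (real n powr p) F (F \<union> S)} \<le> \<beta> n"
            unfolding rr_eq N_def \<beta>_def .
        qed
      qed
    qed
    show "\<exists>G \<beta>. (\<forall>\<^sub>F n in sequentially. measure_pmf.prob (blob_pmf p n) {P. \<not> G n P} \<le> e) \<and> \<beta> \<longlonglongrightarrow> 0 \<and>
      (\<forall>\<^sub>F n in sequentially. \<forall>T F. (T, F) \<in> set_pmf (perc_tree p n) \<longrightarrow> G n (graph_components {1..n} F) \<longrightarrow>
        measure_pmf.prob (random_edge_subset (p * (lam / real n)) (vertex_pairs n - T))
          {S. bad_components (1 - rho p lam) \<delta> \<eta> \<theta> n (real n powr p) F (F \<union> S)} \<le> \<beta> n)"
      using L \<beta>lim ev unfolding u_def by blast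
  qed
qed

end

section \<open>Ranking the full components\<close>

lemma full_component_containing:
  assumes FR: "F \<subseteq> R" and A: "A \<in> graph_components {1..n} F" and v: "v \<in> A"
  shows "A \<subseteq> component_of {1..n} R v"
    and "(THE C. C \<in> graph_components {1..n} R \<and> A \<subseteq> C) = component_of {1..n} R v"
proof -
  have V: "A \<subseteq> {1..n}" by (rule graph_component_subset[OF A])
  show sub: "A \<subseteq> component_of {1..n} R v"
  proof
    fix x assume "x \<in> A"
    then have "(v, x) \<in> (edge_rel R)\<^sup>*"
      using edge_rel_rtrancl_mono[OF FR graph_components_connected[OF A v]] by blast
    then show "x \<in> component_of {1..n} R v" using V \<open>x \<in> A\<close> by (auto simp: component_of_def)
  qed
  have "component_of {1..n} R v \<in> graph_components {1..n} R"
    using V v by (intro component_in_graph_components) auto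
  moreover have "C = component_of {1..n} R v" if "C \<in> graph_components {1..n} R" "A \<subseteq> C" for C
    using graph_components_eq_component[OF that(1), of v] that(2) v by auto
  ultimately show "(THE C. C \<in> graph_components {1..n} R \<and> A \<subseteq> C) = component_of {1..n} R v"
    using sub by (intro the_equality) blast+
qed

context
  fixes p :: real
  assumes p: "0 < p" "p < 1 / 2"
begin

text \<open>If the blob of rank \<open>i\<close> were not above the threshold, the blobs above it,
  at least \<open>K\<close> in number, would all precede it and its rank would exceed
  \<open>K\<close>.\<close>

lemma top_block:
  assumes sep: "separated_tops p d g K n (graph_components {1..n} F)" and i: "1 \<le> i" "i \<le> K"
  shows "ranked_component {1..n} F i \<in> graph_components {1..n} F"
    and "component_rank {1..n} F (ranked_component {1..n} F i) = i"
    and "d * real n powr p < real (card (ranked_component {1..n} F i))"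
proof -
  let ?P = "graph_components {1..n} F" and ?B = "ranked_component {1..n} F i"
  have K: "K \<le> card {B \<in> ?P. d * real n powr p < real (card B)}"
    using sep unfolding separated_tops_def by blast
  have fin: "finite ?P" by (rule finite_graph_components) simp
  have "card {B \<in> ?P. d * real n powr p < real (card B)} \<le> card ?P"
    using fin by (intro card_mono) auto
  then have "i \<le> card ?P" using K i by simp
  from ranked_component_props[OF finite_atLeastAtMost i(1) this]
  show B: "?B \<in> ?P" and rank: "component_rank {1..n} F ?B = i" .
  show "d * real n powr p < real (card ?B)"
  proof (rule ccontr)
    assume "\<not> d * real n powr p < real (card ?B)"
    then have "{B \<in> ?P. d * real n powr p < real (card B)} \<subseteq> {D \<in> ?P. ranked_before D ?B}"
      by (auto simp: ranked_before_def)
    then have "card {B \<in> ?P. d * real n powr p < real (card B)} \<le> card {D \<in> ?P. ranked_before D ?B}"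
      using fin by (intro card_mono) auto
    then have "K < component_rank {1..n} F ?B" using K by (simp add: component_rank_def)
    then show False using rank i by simp
  qed
qed

text \<open>Passing from a large blob to its component multiplies sizes by about
  \<open>1 / u \<ge> 1\<close>, so a gap of \<open>g * N\<close> survives an error of
  \<open>\<eta> * N\<close> on either side, while components without a large blob stay below half
  the threshold. Hence the order of the top blobs is inherited.\<close>

lemma full_component_ranks:
  assumes FR: "F \<subseteq> R" and n: "1 \<le> n"
    and sep: "separated_tops p d g K n (graph_components {1..n} F)"
    and good: "\<not> bad_components u \<delta> \<eta> \<theta> n (real n powr p) F R"
    and u: "0 < u" "u \<le> 1" and par: "0 < d" "0 < g" "\<delta> \<le> d" "2 * \<eta> \<le> g" "\<eta> \<le> d / 4" "\<theta> = d / 2"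
  shows "K \<le> card (graph_components {1..n} R)"
    and "\<And>i. 1 \<le> i \<Longrightarrow> i \<le> K \<Longrightarrow> ranked_component {1..n} R i =
      (THE C. C \<in> graph_components {1..n} R \<and> ranked_component {1..n} F i \<subseteq> C)"
proof -
  define N where "N = real n powr p"
  define B where "B i = ranked_component {1..n} F i" for i
  define comp where "comp A = component_of {1..n} R (SOME v. v \<in> A)" for A
  let ?P = "graph_components {1..n} F" and ?Q = "graph_components {1..n} R"
  have N: "0 < N" using n by (simp add: N_def)
  note fP = graph_component_nonempty[of _ "{1..n}" F] graph_component_subset[of _ "{1..n}" F]
  have rep: "(SOME v. v \<in> A) \<in> A" if "A \<in> ?P" for A
    using fP(1)[OF that] by (simp add: some_in_eq)
  have comp_in: "comp A \<in> ?Q" if "A \<in> ?P" for A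
    unfolding comp_def using rep[OF that] fP(2)[OF that] by (intro component_in_graph_components) auto
  have sub_comp: "A \<subseteq> comp A" and the_comp: "(THE C. C \<in> ?Q \<and> A \<subseteq> C) = comp A" if "A \<in> ?P" for A
    unfolding comp_def using full_component_containing[OF FR that rep[OF that]] by auto
  have comp_eq: "comp A = D" if "A \<in> ?P" "D \<in> ?Q" "A \<subseteq> D" for A D
    unfolding comp_def using graph_components_eq_component[OF that(2)] rep[OF that(1)] that(3) by blast
  have nb1: "\<bar>real (card (comp A)) - real (card A) / u\<bar> \<le> \<eta> * N" if "A \<in> ?P" "\<delta> * N < real (card A)" for A
  proof (rule ccontr)
    assume "\<not> \<bar>real (card (comp A)) - real (card A) / u\<bar> \<le> \<eta> * N"
    then show False
      using good that rep[OF that(1)] unfolding bad_components_def comp_def N_def by (meson not_le)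
  qed
  have nb2: "real (card D) < \<theta> * N"
    if D: "D \<in> ?Q" and no: "\<And>A. A \<in> ?P \<Longrightarrow> A \<subseteq> D \<Longrightarrow> real (card A) \<le> \<delta> * N" for D
  proof -
    obtain v where v: "v \<in> D" using graph_component_nonempty[OF D] by blast
    have vV: "v \<in> {1..n}" using graph_component_subset[OF D] v by auto
    define A where "A = component_of {1..n} F v"
    have A: "A \<in> ?P" "v \<in> A"
      using component_in_graph_components[OF vV] component_of_self[OF vV] by (auto simp: A_def)
    have Dv: "component_of {1..n} R v = D" by (rule graph_components_eq_component[OF D v])
    have "A \<subseteq> D" using full_component_containing(1)[OF FR A] Dv by simp
    then have "real (card A) \<le> \<delta> * N" using no A(1) by blast
    then show ?thesis
      using good A no Dv unfolding bad_components_def N_def by (metis not_le)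
  qed
  have Bi: "B i \<in> ?P" "component_rank {1..n} F (B i) = i" "d * N < real (card (B i))" "\<delta> * N < real (card (B i))"
    if "1 \<le> i" "i \<le> K" for i
  proof -
    show *: "B i \<in> ?P" "component_rank {1..n} F (B i) = i" "d * N < real (card (B i))"
      using top_block[OF sep that] by (auto simp: B_def N_def)
    have "\<delta> * N \<le> d * N" using par N by (intro mult_right_mono) auto
    then show "\<delta> * N < real (card (B i))" using * by simp
  qed
  have gap: "g * N < \<bar>real (card A) - real (card A')\<bar>"
    if "A \<in> ?P" "A' \<in> ?P" "A \<noteq> A'" "d * N \<le> real (card A)" for A A'
    using sep that unfolding separated_tops_def N_def by blast
  have smaller: "card (comp A) < card (comp (B i))"
    if i: "1 \<le> i" "i \<le> K" and A: "A \<in> ?P" "A \<noteq> B i" "card A \<le> card (B i)" "\<delta> * N < real (card A)" for i A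
  proof -
    have "g * N < \<bar>real (card (B i)) - real (card A)\<bar>"
      by (rule gap[OF Bi(1)[OF i] A(1) A(2)[symmetric] less_imp_le[OF Bi(3)[OF i]]])
    then have "g * N < real (card (B i)) - real (card A)" using A(3) by simp
    then have "g * N / u < (real (card (B i)) - real (card A)) / u"
      using u by (intro divide_strict_right_mono) auto
    moreover have "g * N \<le> g * N / u"
      using u par N by (simp add: pos_le_divide_eq mult_left_le)
    moreover have "2 * \<eta> * N \<le> g * N" using par N by (intro mult_right_mono) auto
    moreover have "(real (card (B i)) - real (card A)) / u = real (card (B i)) / u - real (card A) / u"
      by (rule diff_divide_distrib)
    ultimately have "real (card (comp A)) < real (card (comp (B i)))"
      using nb1[OF A(1,4)] nb1[OF Bi(1)[OF i] Bi(4)[OF i]] by linarith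
    then show ?thesis by simp
  qed
  \<comment> \<open>A component other than those of \<open>B 1\<close> to \<open>B i\<close> either
    contains a blob above \<open>\<delta> * N\<close> of rank beyond \<open>i\<close>, and is
    smaller by the gap, or contains none and stays below \<open>d / 2 * N\<close>, while the
    component of \<open>B i\<close> exceeds \<open>3 / 4 * d * N\<close>.\<close>
  have claim: "card D < card (comp (B i))"
    if i: "1 \<le> i" "i \<le> K" and D: "D \<in> ?Q" "\<And>j. 1 \<le> j \<Longrightarrow> j \<le> i \<Longrightarrow> D \<noteq> comp (B j)" for i D
  proof (cases "\<exists>A\<in>?P. A \<subseteq> D \<and> \<delta> * N < real (card A)")
    case True
    then obtain A where A: "A \<in> ?P" "A \<subseteq> D" "\<delta> * N < real (card A)" by blast
    have DA: "comp A = D" by (rule comp_eq[OF A(1) D(1) A(2)])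
    define k where "k = component_rank {1..n} F A"
    have Bk: "B k = A" unfolding B_def k_def by (rule ranked_component_rank[OF _ A(1)]) simp
    have "1 \<le> k" by (simp add: k_def component_rank_def)
    then have ki: "i < k" using D(2)[of k] DA Bk by (cases "k \<le> i") auto
    have "ranked_before (B i) A"
      by (rule ranked_before_if_rank_less[OF _ Bi(1)[OF i] A(1)]) (use ki Bi(2)[OF i] in \<open>simp_all add: k_def\<close>)
    then have "card A \<le> card (B i)" by (auto simp: ranked_before_def)
    moreover have "A \<noteq> B i" using ki Bi(2)[OF i] by (auto simp: k_def)
    ultimately show ?thesis using smaller[OF i A(1) _ _ A(3)] DA by simp
  next
    case False
    then have "real (card D) < \<theta> * N" by (intro nb2[OF D(1)]) (auto simp: not_less)
    moreover have "real (card (B i)) \<le> real (card (B i)) / u"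
      using u by (simp add: pos_le_divide_eq mult_left_le)
    moreover have "\<eta> * N \<le> d / 4 * N" using par N by (intro mult_right_mono) auto
    moreover have "0 < d * N" using par N by simp
    ultimately have "real (card D) < real (card (comp (B i)))"
      using nb1[OF Bi(1)[OF i] Bi(4)[OF i]] Bi(3)[OF i] unfolding par(6) by (simp add: abs_le_iff)
    then show ?thesis by simp
  qed
  \<comment> \<open>The strict inequality also shows that distinct top blobs lie in distinct
    components.\<close>
  have decreasing: "card (comp (B i)) < card (comp (B j))" if "1 \<le> j" "j < i" "i \<le> K" for i j
  proof -
    have i: "1 \<le> i" "i \<le> K" and j: "1 \<le> j" "j \<le> K" using that by auto
    have "ranked_before (B j) (B i)"
      by (rule ranked_before_if_rank_less[OF _ Bi(1)[OF j] Bi(1)[OF i]]) (use that Bi(2)[OF i] Bi(2)[OF j] in simp_all)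
    then have "card (B i) \<le> card (B j)" by (auto simp: ranked_before_def)
    moreover have "B i \<noteq> B j" using Bi(2)[OF i] Bi(2)[OF j] that by auto
    ultimately show ?thesis by (intro smaller[OF j Bi(1)[OF i] _ _ Bi(4)[OF i]])
  qed
  have rank: "component_rank {1..n} R (comp (B i)) = i" if i: "1 \<le> i" "i \<le> K" for i
  proof -
    have "{D \<in> ?Q. ranked_before D (comp (B i))} = (\<lambda>j. comp (B j)) ` {1..<i}"
    proof (intro equalityI subsetI)
      fix D assume "D \<in> {D \<in> ?Q. ranked_before D (comp (B i))}"
      then have D: "D \<in> ?Q" "ranked_before D (comp (B i))" by auto
      then have "\<not> card D < card (comp (B i))" "D \<noteq> comp (B i)"
        using ranked_before_irrefl by (auto simp: ranked_before_def)
      then obtain j where "1 \<le> j" "j \<le> i" "D = comp (B j)" using claim[OF i D(1)] by blast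
      moreover from this have "j \<noteq> i" using \<open>D \<noteq> comp (B i)\<close> by auto
      ultimately show "D \<in> (\<lambda>j. comp (B j)) ` {1..<i}" by auto
    next
      fix D assume "D \<in> (\<lambda>j. comp (B j)) ` {1..<i}"
      then obtain j where j: "1 \<le> j" "j < i" "D = comp (B j)" by auto
      then show "D \<in> {D \<in> ?Q. ranked_before D (comp (B i))}"
        using decreasing[of j i] comp_in Bi(1)[of j] i by (auto simp: ranked_before_def)
    qed
    moreover have "inj_on (\<lambda>j. comp (B j)) {1..<i}"
    proof (rule inj_onI, rule ccontr)
      fix j k assume *: "j \<in> {1..<i}" "k \<in> {1..<i}" "comp (B j) = comp (B k)" "j \<noteq> k"
      then show False
        using decreasing[of j k] decreasing[of k j] i by (cases "j < k") auto
    qed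
    ultimately have "card {D \<in> ?Q. ranked_before D (comp (B i))} = i - 1"
      by (simp add: card_image)
    then show ?thesis using i by (simp add: component_rank_def)
  qed
  show "ranked_component {1..n} R i = (THE C. C \<in> ?Q \<and> ranked_component {1..n} F i \<subseteq> C)"
    if i: "1 \<le> i" "i \<le> K" for i
    using ranked_component_rank[OF _ comp_in[OF Bi(1)[OF i]]] rank[OF i] the_comp[OF Bi(1)[OF i]]
    by (simp add: B_def)
  show "K \<le> card ?Q"
  proof (cases "K = 0")
    case False
    then have K: "1 \<le> K" "K \<le> K" by auto
    show ?thesis
      using component_rank_le_card[OF _ comp_in[OF Bi(1)[OF K]]] rank[OF K] by simp
  qed simp
qed

end

context
  fixes p lam :: real
  assumes p: "0 < p" "p < 1 / 2" and lam: "0 < lam" and sub: "rho p lam < 1"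
begin

text \<open>\<open>Q\<close> is any failure event excluded by separated top blobs and the absence of
  bad components. The constants \<open>d\<close> and \<open>g\<close> come first because \<eta> and
  \<theta> are chosen in terms of them; \<delta> depends on all of these.\<close>

lemma structure_with_high_probability:
  assumes e: "0 < e"
  shows "\<exists>d>0. \<exists>g>0. \<forall>\<eta> \<theta>. 0 < \<eta> \<longrightarrow> 0 < \<theta> \<longrightarrow> (\<exists>\<delta>\<le>d. \<forall>Q.
    (\<forall>n F R. 1 \<le> n \<longrightarrow> F \<subseteq> R \<longrightarrow> separated_tops p d g K n (graph_components {1..n} F) \<longrightarrow>
       \<not> bad_components (1 - rho p lam) \<delta> \<eta> \<theta> n (real n powr p) F R \<longrightarrow> \<not> Q n F R) \<longrightarrow>
    (\<forall>\<^sub>F n in sequentially. measure_pmf.prob (percolation_model lam p n)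
       {\<omega>. Q n (retained_tree_edges \<omega>) (retained_edges \<omega>)} \<le> e))"
proof -
  have e3: "0 < e / 3" using e by simp
  obtain d g where dg: "0 < d" "0 < g" "\<forall>\<^sub>F n in sequentially. measure_pmf.prob (blob_pmf p n) {P. \<not> separated_tops p d g K n P} \<le> e / 3"
    using separated_tops_prob[OF p e3] by blast
  have "\<exists>\<delta>\<le>d. \<forall>Q. (\<forall>n F R. 1 \<le> n \<longrightarrow> F \<subseteq> R \<longrightarrow> separated_tops p d g K n (graph_components {1..n} F) \<longrightarrow>
       \<not> bad_components (1 - rho p lam) \<delta> \<eta> \<theta> n (real n powr p) F R \<longrightarrow> \<not> Q n F R) \<longrightarrow>
    (\<forall>\<^sub>F n in sequentially. measure_pmf.prob (percolation_model lam p n)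
       {\<omega>. Q n (retained_tree_edges \<omega>) (retained_edges \<omega>)} \<le> e)"
    if \<eta>: "0 < \<eta>" and \<theta>: "0 < \<theta>" for \<eta> \<theta>
  proof -
    obtain \<delta>0 where \<delta>0: "0 < \<delta>0" "\<And>\<delta>. 0 < \<delta> \<Longrightarrow> \<delta> \<le> \<delta>0 \<Longrightarrow>
      \<exists>G \<beta>. (\<forall>\<^sub>F n in sequentially. measure_pmf.prob (blob_pmf p n) {P. \<not> G n P} \<le> e / 3) \<and> \<beta> \<longlonglongrightarrow> 0 \<and>
      (\<forall>\<^sub>F n in sequentially. \<forall>T F. (T, F) \<in> set_pmf (perc_tree p n) \<longrightarrow> G n (graph_components {1..n} F) \<longrightarrow>
        measure_pmf.prob (random_edge_subset (p * (lam / real n)) (vertex_pairs n - T))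
          {S. bad_components (1 - rho p lam) \<delta> \<eta> \<theta> n (real n powr p) F (F \<union> S)} \<le> \<beta> n)"
      using bad_components_rare[OF p lam sub e3 \<eta> \<theta>] by blast
    define \<delta> where "\<delta> = min \<delta>0 d"
    have \<delta>: "0 < \<delta>" "\<delta> \<le> \<delta>0" "\<delta> \<le> d" using \<delta>0 dg by (auto simp: \<delta>_def)
    obtain G \<beta> where G: "\<forall>\<^sub>F n in sequentially. measure_pmf.prob (blob_pmf p n) {P. \<not> G n P} \<le> e / 3" and \<beta>: "\<beta> \<longlonglongrightarrow> 0"
      and bad: "\<forall>\<^sub>F n in sequentially. \<forall>T F. (T, F) \<in> set_pmf (perc_tree p n) \<longrightarrow> G n (graph_components {1..n} F) \<longrightarrow>
        measure_pmf.prob (random_edge_subset (p * (lam / real n)) (vertex_pairs n - T))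
          {S. bad_components (1 - rho p lam) \<delta> \<eta> \<theta> n (real n powr p) F (F \<union> S)} \<le> \<beta> n"
      using \<delta>0(2)[OF \<delta>(1,2)] by blast
    have \<beta>e: "\<forall>\<^sub>F n in sequentially. \<beta> n < e / 3"
      using \<beta> e3 by (rule order_tendstoD(2))
    show ?thesis
    proof (intro exI[of _ \<delta>] conjI \<delta>(3) allI impI)
      fix Q
      assume Q: "\<forall>n F R. 1 \<le> n \<longrightarrow> F \<subseteq> R \<longrightarrow> separated_tops p d g K n (graph_components {1..n} F) \<longrightarrow>
       \<not> bad_components (1 - rho p lam) \<delta> \<eta> \<theta> n (real n powr p) F R \<longrightarrow> \<not> Q n F R"
      show "\<forall>\<^sub>F n in sequentially. measure_pmf.prob (percolation_model lam p n)
         {\<omega>. Q n (retained_tree_edges \<omega>) (retained_edges \<omega>)} \<le> e"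
        using dg(3) G bad \<beta>e eventually_lam_le[of lam] eventually_ge_at_top[of 1]
      proof eventually_elim
        case (elim n)
        let ?G = "\<lambda>P. G n P \<and> separated_tops p d g K n P"
        have "measure_pmf.prob (percolation_model lam p n) {\<omega>. Q n (retained_tree_edges \<omega>) (retained_edges \<omega>)}
          \<le> measure_pmf.prob (blob_pmf p n) {P. \<not> ?G P} + max 0 (\<beta> n)"
        proof (rule prob_percolation_model_le[where G = ?G])
          fix T F assume TF: "(T, F) \<in> set_pmf (perc_tree p n)" and GF: "?G (graph_components {1..n} F)"
          have "measure_pmf.prob (random_edge_subset (p * (lam / real n)) (vertex_pairs n - T)) {S. Q n F (F \<union> S)} \<le>
            measure_pmf.prob (random_edge_subset (p * (lam / real n)) (vertex_pairs n - T))
              {S. bad_components (1 - rho p lam) \<delta> \<eta> \<theta> n (real n powr p) F (F \<union> S)}"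
            by (rule prob_mono_pmf) (use Q elim(6) GF in blast)
          also have "\<dots> \<le> \<beta> n" using elim(3) TF GF by blast
          finally show "measure_pmf.prob (random_edge_subset (p * (lam / real n)) (vertex_pairs n - T)) {S. Q n F (F \<union> S)} \<le> max 0 (\<beta> n)"
            by simp
        qed (use p lam elim in auto)
        also have "measure_pmf.prob (blob_pmf p n) {P. \<not> ?G P} \<le>
          measure_pmf.prob (blob_pmf p n) {P. \<not> G n P} + measure_pmf.prob (blob_pmf p n) {P. \<not> separated_tops p d g K n P}"
          unfolding de_Morgan_conj by (rule prob_disj_le)
        finally show ?case using elim e by (simp add: max_def split: if_splits)
      qed
    qed
  qed
  then show ?thesis using dg(1,2) by blast
qed

lemma top_components_agree:
  "(\<lambda>n. measure_pmf.prob (percolation_model lam p n)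
     {\<omega>. K \<le> card (full_components n \<omega>) \<and>
        (\<forall>i\<in>{1..K}. ranked_full_component n i \<omega> = full_component_of_blob n i \<omega>)}) \<longlonglongrightarrow> 1"
proof -
  define Q where "Q n F R \<longleftrightarrow> \<not> (K \<le> card (graph_components {1..n} R) \<and>
     (\<forall>i\<in>{1..K}. ranked_component {1..n} R i =
        (THE C. C \<in> graph_components {1..n} R \<and> ranked_component {1..n} F i \<subseteq> C)))" for n F R
  let ?pr = "\<lambda>n. measure_pmf.prob (percolation_model lam p n) {\<omega>. Q n (retained_tree_edges \<omega>) (retained_edges \<omega>)}"
  have u: "0 < 1 - rho p lam" "1 - rho p lam \<le> 1"
    using sub p lam by (simp_all add: rho_def)
  have "?pr \<longlonglongrightarrow> 0"
  proof (rule tendsto_0_if_eventually_le)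
    fix e :: real assume e: "0 < e"
    obtain d g where dg: "0 < d" "0 < g" and H: "\<And>\<eta> \<theta>. 0 < \<eta> \<Longrightarrow> 0 < \<theta> \<Longrightarrow> (\<exists>\<delta>\<le>d. \<forall>Q.
      (\<forall>n F R. 1 \<le> n \<longrightarrow> F \<subseteq> R \<longrightarrow> separated_tops p d g K n (graph_components {1..n} F) \<longrightarrow>
         \<not> bad_components (1 - rho p lam) \<delta> \<eta> \<theta> n (real n powr p) F R \<longrightarrow> \<not> Q n F R) \<longrightarrow>
      (\<forall>\<^sub>F n in sequentially. measure_pmf.prob (percolation_model lam p n)
         {\<omega>. Q n (retained_tree_edges \<omega>) (retained_edges \<omega>)} \<le> e))"
      using structure_with_high_probability[OF e, of K] by blast
    define \<eta> where "\<eta> = min (g / 2) (d / 4)"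
    have \<eta>: "0 < \<eta>" "2 * \<eta> \<le> g" "\<eta> \<le> d / 4" using dg by (auto simp: \<eta>_def)
    have d2: "0 < d / 2" using dg by simp
    obtain \<delta> where \<delta>: "\<delta> \<le> d" and H': "\<And>Q.
      (\<forall>n F R. 1 \<le> n \<longrightarrow> F \<subseteq> R \<longrightarrow> separated_tops p d g K n (graph_components {1..n} F) \<longrightarrow>
         \<not> bad_components (1 - rho p lam) \<delta> \<eta> (d / 2) n (real n powr p) F R \<longrightarrow> \<not> Q n F R) \<Longrightarrow>
      (\<forall>\<^sub>F n in sequentially. measure_pmf.prob (percolation_model lam p n)
         {\<omega>. Q n (retained_tree_edges \<omega>) (retained_edges \<omega>)} \<le> e)"
      using H[OF \<eta>(1) d2] by blast
    show "\<forall>\<^sub>F n in sequentially. ?pr n \<le> e"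
    proof (rule H', intro allI impI)
      fix n F R
      assume n: "1 \<le> n" and FR: "F \<subseteq> R" and sep: "separated_tops p d g K n (graph_components {1..n} F)"
        and good: "\<not> bad_components (1 - rho p lam) \<delta> \<eta> (d / 2) n (real n powr p) F R"
      note * = full_component_ranks[OF p FR n sep good u dg \<delta> \<eta>(2,3) refl]
      then show "\<not> Q n F R" unfolding Q_def by auto
    qed
  qed simp
  then have "(\<lambda>n. 1 - ?pr n) \<longlonglongrightarrow> 1 - 0" by (intro tendsto_diff tendsto_const)
  moreover have "1 - ?pr n = measure_pmf.prob (percolation_model lam p n)
     {\<omega>. K \<le> card (full_components n \<omega>) \<and>
        (\<forall>i\<in>{1..K}. ranked_full_component n i \<omega> = full_component_of_blob n i \<omega>)}" for n
  proof -
    have "1 - ?pr n = measure_pmf.prob (percolation_model lam p n)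
      (space (measure_pmf (percolation_model lam p n)) - {\<omega>. Q n (retained_tree_edges \<omega>) (retained_edges \<omega>)})"
      by (rule measure_pmf.prob_compl[symmetric]) simp
    also have "space (measure_pmf (percolation_model lam p n)) - {\<omega>. Q n (retained_tree_edges \<omega>) (retained_edges \<omega>)} =
      {\<omega>. K \<le> card (full_components n \<omega>) \<and>
        (\<forall>i\<in>{1..K}. ranked_full_component n i \<omega> = full_component_of_blob n i \<omega>)}"
      by (auto simp: Q_def full_components_def ranked_full_component_def full_component_of_blob_def ranked_blob_def)
    finally show ?thesis .
  qed
  ultimately show ?thesis by simp
qed

text \<open>Separation puts the blob of rank \<open>i\<close> above \<open>d * n powr p\<close>,
  hence above \<open>\<delta> * n powr p\<close>, so the first clause of
  \<open>bad_components\<close> applies to it.\<close>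

lemma full_component_size:
  assumes i: "1 \<le> i"
  shows "small_o_prob (percolation_model lam p)
     (\<lambda>n \<omega>. \<bar>real (card (full_component_of_blob n i \<omega>)) - real (card (ranked_blob n i \<omega>)) / (1 - rho p lam)\<bar>)
     (\<lambda>n. real n powr p)"
  unfolding small_o_prob_def tendsto_in_prob_def
proof (intro allI impI, rule tendsto_0_if_eventually_le)
  fix d' e :: real assume d': "0 < d'" and e: "0 < e"
  define Q where "Q n F R \<longleftrightarrow> d' < \<bar>\<bar>real (card (THE C. C \<in> graph_components {1..n} R \<and> ranked_component {1..n} F i \<subseteq> C))
     - real (card (ranked_component {1..n} F i)) / (1 - rho p lam)\<bar> / real n powr p - 0\<bar>" for n F R
  obtain d g where dg: "0 < d" "0 < g" and H: "\<And>\<eta> \<theta>. 0 < \<eta> \<Longrightarrow> 0 < \<theta> \<Longrightarrow> (\<exists>\<delta>\<le>d. \<forall>Q.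
      (\<forall>n F R. 1 \<le> n \<longrightarrow> F \<subseteq> R \<longrightarrow> separated_tops p d g i n (graph_components {1..n} F) \<longrightarrow>
         \<not> bad_components (1 - rho p lam) \<delta> \<eta> \<theta> n (real n powr p) F R \<longrightarrow> \<not> Q n F R) \<longrightarrow>
      (\<forall>\<^sub>F n in sequentially. measure_pmf.prob (percolation_model lam p n)
         {\<omega>. Q n (retained_tree_edges \<omega>) (retained_edges \<omega>)} \<le> e))"
    using structure_with_high_probability[OF e, of i] by blast
  obtain \<delta> where \<delta>: "\<delta> \<le> d" and H': "\<And>Q.
      (\<forall>n F R. 1 \<le> n \<longrightarrow> F \<subseteq> R \<longrightarrow> separated_tops p d g i n (graph_components {1..n} F) \<longrightarrow>
         \<not> bad_components (1 - rho p lam) \<delta> d' 1 n (real n powr p) F R \<longrightarrow> \<not> Q n F R) \<Longrightarrow>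
      (\<forall>\<^sub>F n in sequentially. measure_pmf.prob (percolation_model lam p n)
         {\<omega>. Q n (retained_tree_edges \<omega>) (retained_edges \<omega>)} \<le> e)"
    using H[OF d', of 1] by auto
  have "\<forall>\<^sub>F n in sequentially. measure_pmf.prob (percolation_model lam p n)
         {\<omega>. Q n (retained_tree_edges \<omega>) (retained_edges \<omega>)} \<le> e"
  proof (rule H', intro allI impI)
    fix n F R
    assume n: "1 \<le> n" and FR: "F \<subseteq> R" and sep: "separated_tops p d g i n (graph_components {1..n} F)"
      and good: "\<not> bad_components (1 - rho p lam) \<delta> d' 1 n (real n powr p) F R"
    note top = top_block[OF p sep i order_refl]
    obtain v where v: "v \<in> ranked_component {1..n} F i" using graph_component_nonempty[OF top(1)] by blast
    have N: "0 < real n powr p" using n by simp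
    have "\<delta> * real n powr p \<le> d * real n powr p" using \<delta> by (intro mult_right_mono) auto
    then have "\<delta> * real n powr p < real (card (ranked_component {1..n} F i))" using top(3) by simp
    then have "\<bar>real (card (component_of {1..n} R v)) - real (card (ranked_component {1..n} F i)) / (1 - rho p lam)\<bar> \<le> d' * real n powr p"
      using good top(1) v unfolding bad_components_def by (meson not_le)
    then show "\<not> Q n F R"
      unfolding Q_def full_component_containing(2)[OF FR top(1) v] using N by (simp add: not_less pos_divide_le_eq)
  qed
  then show "\<forall>\<^sub>F n in sequentially. measure_pmf.prob (percolation_model lam p n)
      {\<omega>. d' < \<bar>\<bar>real (card (full_component_of_blob n i \<omega>)) - real (card (ranked_blob n i \<omega>)) / (1 - rho p lam)\<bar> / real n powr p - 0\<bar>} \<le> e"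
    by (simp only: Q_def full_components_def full_component_of_blob_def ranked_blob_def)
qed simp

end

theorem theorem3p1:
  fixes lam p :: real
  assumes "lam > 0" and "0 < p" and "p < p_crit lam"
  shows
    "(\<forall>\<epsilon>>0. \<exists>K::nat.
        limsup (\<lambda>n. ereal (measure_pmf.prob (percolation_model lam p n)
          {\<omega>. blob_rank n (blob_of n 1 \<omega>) \<omega> > K})) < ereal \<epsilon>)
     \<and>
     ((\<forall>k\<ge>1. tendsto_in_prob (percolation_model lam p)
          (\<lambda>n \<omega>. real (blob_count n k \<omega>) / real n) (q p k)) \<and>
      (\<lambda>k::nat. \<Sum>\<^sub>\<infinity>l\<in>{k..}. q p l) \<sim>[at_top]
        (\<lambda>k. (1 - p) * Gamma (1 + 1 / p) * real k powr (- 1 / p)) \<and>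
      (\<exists>W :: nat pmf.
        pmf W 0 = 0 \<and> (\<forall>k\<ge>1. pmf W k = real k * q p k) \<and>
        conv_in_distr (uniform_blob_size lam p) W \<and>
        (p < 1 / 2 \<longrightarrow>
          integrable (measure_pmf W) real \<and>
          measure_pmf.expectation W real = 1 / (1 - 2 * p) \<and>
          ((\<lambda>k. real k ^ 2 * q p k) has_sum (1 / (1 - 2 * p))) {1..})))
     \<and>
     ((\<forall>K. (\<lambda>n. measure_pmf.prob (percolation_model lam p n)
          {\<omega>. K \<le> card (full_components n \<omega>) \<and>
              (\<forall>i\<in>{1..K}. ranked_full_component n i \<omega> = full_component_of_blob n i \<omega>)})
          \<longlonglongrightarrow> 1) \<and>
      (\<forall>i\<ge>1. small_o_prob (percolation_model lam p)
          (\<lambda>n \<omega>. \<bar>real (card (full_component_of_blob n i \<omega>))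
                 - real (card (ranked_blob n i \<omega>)) / (1 - rho p lam)\<bar>)
          (\<lambda>n. real n powr p)))"
proof -
  \<comment> \<open>\<open>p < 1 / (lam + 2)\<close> reads \<open>p * lam < 1 - 2 * p\<close>, which
    gives both \<open>p < 1 / 2\<close> and \<open>rho p lam < 1\<close>.\<close>
  have crit: "p * lam + 2 * p < 1"
    using assms by (simp add: p_crit_def pos_less_divide_eq distrib_left mult.commute)
  have "0 < p * lam" using assms by simp
  with crit have "p < 1 / 2" by linarith
  with assms(2) have p: "0 < p" "p < 1 / 2" .
  have sub: "rho p lam < 1" using crit p by (simp add: rho_def)
  have W: "\<exists>W :: nat pmf.
        pmf W 0 = 0 \<and> (\<forall>k\<ge>1. pmf W k = real k * q p k) \<and>
        conv_in_distr (uniform_blob_size lam p) W \<and>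
        (p < 1 / 2 \<longrightarrow>
          integrable (measure_pmf W) real \<and>
          measure_pmf.expectation W real = 1 / (1 - 2 * p) \<and>
          ((\<lambda>k. real k ^ 2 * q p k) has_sum (1 / (1 - 2 * p))) {1..})"
    using pmf_limit_blob_size[OF p] uniform_blob_size_conv[OF p assms(1)] limit_blob_size_mean[OF p] q_second_moment[OF p]
    by (intro exI[of _ "limit_blob_size p"] conjI allI impI) simp_all
  show ?thesis
    using root_rank_tight[OF p assms(1)] blob_count_tendsto[OF p assms(1)] q_tail_asymptotics[OF p] W
      top_components_agree[OF p assms(1) sub] full_component_size[OF p assms(1) sub]
    by blast
qed

end
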